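(* Consider the Layer Model with Fault with piecewise constant permeability, let $\mu_0$ be the prior probability measure on $U$ with Lebesgue density $$\pi_0(u)=\pi_0^{A,g}(a)\,\pi_0^{A,g}(b)\,\pi_0^{C,g}(c)\prod_{i=1}^n\pi_0^i(\kappa_i),$$ and let $\Phi(u;y)=\frac12|y-\mathcal{G}(u)|_\Gamma^2$. Let $u\sim\mu_0$ and $y=\mathcal{G}(u)+\eta$ with $\eta\sim N(0,\Gamma)$ independent of $u$. Then the posterior distribution $\mu^y$ (the conditional distribution of $u$ given $y$) is well-defined. Moreover $\mu^y\ll\mu_0$ with Radon–Nikodym derivative $$\frac{d\mu^y}{d\mu_0}(u)=\frac1Z\exp(-\Phi(u;y)),\qquad Z=\int_U\exp(-\Phi(u;y))\,\mu_0(du)>0.$$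
   Context: Let $D=(0,1)^2$ with points $(x,y)$, $V=H^1_0(D)$ with norm $\|p\|_V=\|\nabla p\|_{L^2(D)}$, $V^*$ its dual, and $X=\{g\in L^\infty(D;\mathbb{R}) : \operatorname{ess\,inf}_D g>0\}$. Fix $f\in V^*$. For $\kappa\in X$ let $G(\kappa)=p\in V$ be the unique weak solution of $-\nabla\cdot(\kappa\nabla p)=f$ in $D$, $p=0$ on $\partial D$. Let $L:V\to Y=\mathbb{R}^J$, $L(p)=(l_1(p),\dots,l_J(p))^T$ with fixed $l_j\in V^*$. The unknown is $u=(u_g,u_\kappa)\in U=U_g\times U_\kappa$, $F(u)=\kappa=\sum_{i=1}^n\kappa_i\chi_{D_i}$ where the $D_i$ are determined by $u_g$, and $\mathcal{G}=L\circ G\circ F:U\to Y$. $\Gamma$ is a symmetric positive definite $J\times J$ matrix and $|\cdot|_\Gamma=|\Gamma^{-1/2}\cdot|$. Layer Model with Fault ($n\ge 2$ layers): $u_g=(a,b,c)\in U_g=A^2\times C$, $C=[-c^\star,c^\star]$ with $c^\star>0$ and $A=\{\mathbf{x}\in\mathbb{R}^{n-1}:\sum_{i=1}^{n-1}x_i\le1,\ x_i\ge0\}$. Here $a_i$ and $b_i$ are the thicknesses of layer $i$ at the right side $x=1$ and the left side $x=0$ of $D$, with layers numbered from top to bottom. For $1\le i\le n-1$ put $h_i(x)=\sum_{k=1}^i\big(b_k(1-x)+a_kx\big)$, and let the depth (distance below the top of $D$) of the interface between layers $i$ and $i+1$ be $S_i(x)=h_i(x)+c$ for $x<\frac12$ and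 $S_i(x)=h_i(x)$ for $x>\frac12$. With $S_0=-\infty$, $S_n=+\infty$, $D_i=\{(x,y)\in D: x\ne\frac12,\ S_{i-1}(x)<1-y<S_i(x)\}$. Piecewise constant permeability: $u_\kappa=(\kappa_1,\dots,\kappa_n)\in U_\kappa=(0,\infty)^n$. Prior densities: $\pi_0^{A,g}$ is the uniform density on $A$, $\pi_0^{C,g}$ the uniform density on $C$, and each $\pi_0^i$ is the Lebesgue density of one of the following laws for $\kappa_i$: lognormal ($\log\kappa_i\sim N(m_i,\sigma_i^2)$); uniform on $[\kappa^{i,-},\kappa^{i,+}]$ with $\kappa^{i,-}>0$; exponential with parameter $\lambda_i$. As usual for conditional distributions, well-definedness of $\mu^y$ means that a regular conditional distribution of $u$ given $y$ exists, and that the displayed formula gives a version of it. *)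

theory Defs
  imports "HOL-Analysis.Analysis" "HOL-Probability.Probability"
begin

section \<open>The space \<open>V = H\<^sup>1\<^sub>0(D)\<close> and its dual\<close>

text \<open>
  Elements of \<open>L\<^sup>2(D)\<close>, \<open>H\<^sup>1(D)\<close> and \<open>V\<close> are represented by all their Lebesgue measurable
  representatives; only the values on \<open>D\<close> matter, and functions that agree almost everywhere on
  \<open>D\<close> represent the same element.
\<close>

definition unit_square :: "(real \<times> real) set" where
  "unit_square = {0<..<1} \<times> {0<..<1}"

abbreviation leb_D :: "(real \<times> real) measure" where
  "leb_D \<equiv> lebesgue_on unit_square"

definition L2_D :: "(real \<times> real \<Rightarrow> 'b::euclidean_space) set" where
  "L2_D = {f. f \<in> borel_measurable leb_D \<and> integrable leb_D (\<lambda>z. (norm (f z))\<^sup>2)}"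

definition L2_norm_D :: "(real \<times> real \<Rightarrow> 'b::euclidean_space) \<Rightarrow> real" where
  "L2_norm_D f = sqrt (LINT z|leb_D. (norm (f z))\<^sup>2)"

text \<open>\<open>C_k k f\<close>: \<open>f\<close> is \<open>k\<close> times continuously differentiable on the plane.\<close>

primrec C_k :: "nat \<Rightarrow> (real \<times> real \<Rightarrow> real) \<Rightarrow> bool" where
  "C_k 0 f \<longleftrightarrow> continuous_on UNIV f"
| "C_k (Suc k) f \<longleftrightarrow> (\<exists>fx fy. (\<forall>z. (f has_derivative (\<lambda>d. fst d * fx z + snd d * fy z)) (at z)) \<and>
     C_k k fx \<and> C_k k fy)"

text \<open>\<open>C\<^sub>c\<^sup>\<infinity>(D)\<close>, each function being extended by zero to the plane.\<close>

definition test_functions :: "(real \<times> real \<Rightarrow> real) set" where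
  "test_functions = {\<phi>. (\<forall>k. C_k k \<phi>) \<and>
     (\<exists>K. compact K \<and> K \<subseteq> unit_square \<and> (\<forall>z. z \<notin> K \<longrightarrow> \<phi> z = 0))}"

definition weak_gradient ::
  "(real \<times> real \<Rightarrow> real) \<Rightarrow> (real \<times> real \<Rightarrow> real \<times> real) \<Rightarrow> bool" where
  "weak_gradient p g \<longleftrightarrow> g \<in> L2_D \<and>
     (\<forall>\<phi>\<in>test_functions. \<forall>i\<in>Basis.
        (LINT z|leb_D. p z * frechet_derivative \<phi> (at z) i) = - (LINT z|leb_D. (g z \<bullet> i) * \<phi> z))"

definition H1 :: "(real \<times> real \<Rightarrow> real) set" where
  "H1 = {p \<in> L2_D. \<exists>g. weak_gradient p g}"

text \<open>The weak gradient is determined up to a null set.\<close>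

definition grad :: "(real \<times> real \<Rightarrow> real) \<Rightarrow> real \<times> real \<Rightarrow> real \<times> real" where
  "grad p = (SOME g. weak_gradient p g)"

definition H1_norm :: "(real \<times> real \<Rightarrow> real) \<Rightarrow> real" where
  "H1_norm p = sqrt ((L2_norm_D p)\<^sup>2 + (L2_norm_D (grad p))\<^sup>2)"

definition V :: "(real \<times> real \<Rightarrow> real) set" where
  "V = {p \<in> H1. \<exists>\<phi>. (\<forall>k::nat. \<phi> k \<in> test_functions) \<and>
     (\<lambda>k. H1_norm (\<lambda>z. p z - \<phi> k z)) \<longlonglongrightarrow> 0}"

definition V_norm :: "(real \<times> real \<Rightarrow> real) \<Rightarrow> real" where
  "V_norm p = L2_norm_D (grad p)"

text \<open>
  Boundedness forces a functional in \<open>V_dual\<close> to take the same value on functions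
  that agree almost everywhere on \<open>D\<close>.
\<close>

definition V_dual :: "((real \<times> real \<Rightarrow> real) \<Rightarrow> real) set" where
  "V_dual = {l. (\<forall>p\<in>V. \<forall>q\<in>V. \<forall>s t. l (\<lambda>z. s * p z + t * q z) = s * l p + t * l q) \<and>
     (\<exists>C. \<forall>p\<in>V. \<bar>l p\<bar> \<le> C * V_norm p)}"

section \<open>The forward problem\<close>

text \<open>\<open>X\<close>: the functions in \<open>L\<^sup>\<infinity>(D)\<close> with positive essential infimum.\<close>

definition permeabilities :: "(real \<times> real \<Rightarrow> real) set" where
  "permeabilities = {\<kappa>. \<kappa> \<in> borel_measurable leb_D \<and>
     esssup leb_D (\<lambda>z. ereal \<bar>\<kappa> z\<bar>) < \<infinity> \<and> - esssup leb_D (\<lambda>z. - ereal (\<kappa> z)) > 0}"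

definition weak_solution ::
  "((real \<times> real \<Rightarrow> real) \<Rightarrow> real) \<Rightarrow> (real \<times> real \<Rightarrow> real) \<Rightarrow> (real \<times> real \<Rightarrow> real) \<Rightarrow> bool" where
  "weak_solution f \<kappa> p \<longleftrightarrow>
     p \<in> V \<and> (\<forall>v\<in>V. (LINT z|leb_D. \<kappa> z * (grad p z \<bullet> grad v z)) = f v)"

text \<open>The map \<open>G : X \<rightarrow> V\<close>; the weak solution is unique up to a null set.\<close>

definition solution_map ::
  "((real \<times> real \<Rightarrow> real) \<Rightarrow> real) \<Rightarrow> (real \<times> real \<Rightarrow> real) \<Rightarrow> real \<times> real \<Rightarrow> real" where
  "solution_map f = (\<lambda>\<kappa>\<in>permeabilities. SOME p. weak_solution f \<kappa> p)"

section \<open>The layer model with fault\<close>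

text \<open>
  A parameter is \<open>u = ((a, b, c), \<kappa>)\<close>.  Vectors with components \<open>1, \<dots>, m\<close> are functions in
  \<open>{1..m} \<rightarrow>\<^sub>E UNIV\<close>.
\<close>

type_synonym param = "((nat \<Rightarrow> real) \<times> (nat \<Rightarrow> real) \<times> real) \<times> (nat \<Rightarrow> real)"

definition thicknesses :: "nat \<Rightarrow> (nat \<Rightarrow> real) set" where
  "thicknesses n = {x \<in> {1..<n} \<rightarrow>\<^sub>E UNIV. (\<Sum>i\<in>{1..<n}. x i) \<le> 1 \<and> (\<forall>i\<in>{1..<n}. 0 \<le> x i)}"

definition param_set :: "nat \<Rightarrow> real \<Rightarrow> param set" where
  "param_set n cstar =
     (thicknesses n \<times> thicknesses n \<times> {-cstar..cstar}) \<times> ({1..n} \<rightarrow>\<^sub>E {0<..})"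

definition interface_height :: "(nat \<Rightarrow> real) \<Rightarrow> (nat \<Rightarrow> real) \<Rightarrow> nat \<Rightarrow> real \<Rightarrow> real" where
  "interface_height a b i x = (\<Sum>k=1..i. b k * (1 - x) + a k * x)"

definition interface_depth ::
  "nat \<Rightarrow> (nat \<Rightarrow> real) \<times> (nat \<Rightarrow> real) \<times> real \<Rightarrow> nat \<Rightarrow> real \<Rightarrow> ereal" where
  "interface_depth n = (\<lambda>(a, b, c) i x.
     if i = 0 then -\<infinity> else if i = n then \<infinity>
     else ereal (interface_height a b i x + (if x < 1/2 then c else 0)))"

definition layer ::
  "nat \<Rightarrow> (nat \<Rightarrow> real) \<times> (nat \<Rightarrow> real) \<times> real \<Rightarrow> nat \<Rightarrow> (real \<times> real) set" where
  "layer n ug i = {(x, y) \<in> unit_square. x \<noteq> 1/2 \<and>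
     interface_depth n ug (i - 1) x < ereal (1 - y) \<and> ereal (1 - y) < interface_depth n ug i x}"

definition permeability :: "nat \<Rightarrow> param \<Rightarrow> real \<times> real \<Rightarrow> real" where
  "permeability n = (\<lambda>(ug, \<kappa>) z. \<Sum>i=1..n. \<kappa> i * indicator (layer n ug i) z)"

text \<open>\<open>\<G> = L \<circ> G \<circ> F\<close>, where \<open>L p\<close> has the components \<open>l j p\<close>.\<close>

definition observation_map ::
  "nat \<Rightarrow> ((real \<times> real \<Rightarrow> real) \<Rightarrow> real) \<Rightarrow> ('j::finite \<Rightarrow> (real \<times> real \<Rightarrow> real) \<Rightarrow> real)
    \<Rightarrow> param \<Rightarrow> real^'j" where
  "observation_map n f l u = (\<chi> j. l j (solution_map f (permeability n u)))"

section \<open>Noise and potential\<close>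

definition sym_pos_def :: "real^'j^'j \<Rightarrow> bool" where
  "sym_pos_def \<Gamma> \<longleftrightarrow> transpose \<Gamma> = \<Gamma> \<and> (\<forall>v. v \<noteq> 0 \<longrightarrow> v \<bullet> (\<Gamma> *v v) > 0)"

definition matrix_sqrt :: "real^'j^'j \<Rightarrow> real^'j^'j" where
  "matrix_sqrt \<Gamma> = (THE S. sym_pos_def S \<and> S ** S = \<Gamma>)"

definition weighted_norm :: "real^'j^'j \<Rightarrow> real^'j \<Rightarrow> real" where
  "weighted_norm \<Gamma> v = norm (matrix_inv (matrix_sqrt \<Gamma>) *v v)"

text \<open>\<open>N(0, \<Gamma>)\<close>: the quadratic form of \<open>\<Gamma>\<^sup>-\<^sup>1\<close> is the square of \<open>weighted_norm \<Gamma>\<close>.\<close>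

definition gaussian :: "real^'j^'j \<Rightarrow> (real^'j) measure" where
  "gaussian \<Gamma> = density lborel (\<lambda>v. ennreal
     (exp (- (weighted_norm \<Gamma> v)\<^sup>2 / 2) / sqrt ((2 * pi) ^ CARD('j) * det \<Gamma>)))"

definition potential ::
  "nat \<Rightarrow> ((real \<times> real \<Rightarrow> real) \<Rightarrow> real) \<Rightarrow> ('j::finite \<Rightarrow> (real \<times> real \<Rightarrow> real) \<Rightarrow> real)
    \<Rightarrow> real^'j^'j \<Rightarrow> param \<Rightarrow> real^'j \<Rightarrow> real" where
  "potential n f l \<Gamma> u y = 1/2 * (weighted_norm \<Gamma> (y - observation_map n f l u))\<^sup>2"

section \<open>The prior\<close>

definition param_lebesgue :: "nat \<Rightarrow> param measure" where
  "param_lebesgue n =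
     ((\<Pi>\<^sub>M i\<in>{1..<n}. lborel) \<Otimes>\<^sub>M (\<Pi>\<^sub>M i\<in>{1..<n}. lborel) \<Otimes>\<^sub>M lborel) \<Otimes>\<^sub>M (\<Pi>\<^sub>M i\<in>{1..n}. lborel)"

definition param_space :: "nat \<Rightarrow> real \<Rightarrow> param measure" where
  "param_space n cstar = restrict_space (param_lebesgue n) (param_set n cstar)"

definition uniform_density :: "'a measure \<Rightarrow> 'a set \<Rightarrow> 'a \<Rightarrow> real" where
  "uniform_density M A x = indicator A x / measure M A"

text \<open>The admissible one-dimensional priors: lognormal, uniform, exponential.\<close>

definition permeability_density :: "(real \<Rightarrow> real) \<Rightarrow> bool" where
  "permeability_density g \<longleftrightarrow> g \<in> borel_measurable borel \<and> (\<forall>t. 0 \<le> g t) \<and>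
     ((\<exists>m \<sigma>. 0 < \<sigma> \<and>
         density lborel g = distr (density lborel (normal_density m \<sigma>)) borel exp) \<or>
      (\<exists>lo hi. 0 < lo \<and> lo < hi \<and> density lborel g = uniform_measure lborel {lo..hi}) \<or>
      (\<exists>r. 0 < r \<and> density lborel g = density lborel (exponential_density r)))"

definition prior_density :: "nat \<Rightarrow> real \<Rightarrow> (nat \<Rightarrow> real \<Rightarrow> real) \<Rightarrow> param \<Rightarrow> real" where
  "prior_density n cstar \<pi> = (\<lambda>((a, b, c), \<kappa>).
     uniform_density (\<Pi>\<^sub>M i\<in>{1..<n}. lborel) (thicknesses n) a *
     uniform_density (\<Pi>\<^sub>M i\<in>{1..<n}. lborel) (thicknesses n) b *
     uniform_density lborel {-cstar..cstar} c *
     (\<Prod>i=1..n. \<pi> i (\<kappa> i)))"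

definition prior :: "nat \<Rightarrow> real \<Rightarrow> (nat \<Rightarrow> real \<Rightarrow> real) \<Rightarrow> param measure" where
  "prior n cstar \<pi> = density (param_space n cstar) (\<lambda>u. ennreal (prior_density n cstar \<pi> u))"

definition evidence ::
  "nat \<Rightarrow> real \<Rightarrow> (nat \<Rightarrow> real \<Rightarrow> real) \<Rightarrow> ((real \<times> real \<Rightarrow> real) \<Rightarrow> real)
    \<Rightarrow> ('j::finite \<Rightarrow> (real \<times> real \<Rightarrow> real) \<Rightarrow> real) \<Rightarrow> real^'j^'j \<Rightarrow> real^'j \<Rightarrow> real" where
  "evidence n cstar \<pi> f l \<Gamma> y = (LINT u|prior n cstar \<pi>. exp (- potential n f l \<Gamma> u y))"

section \<open>Independence and conditional distributions\<close>

text \<open>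
  Independence of two random variables, which unlike in \<open>prob_space.indep_var\<close> may have values in
  different types.
\<close>

definition independent ::
  "'w measure \<Rightarrow> 'a measure \<Rightarrow> ('w \<Rightarrow> 'a) \<Rightarrow> 'b measure \<Rightarrow> ('w \<Rightarrow> 'b) \<Rightarrow> bool" where
  "independent M S X N Y \<longleftrightarrow> X \<in> M \<rightarrow>\<^sub>M S \<and> Y \<in> M \<rightarrow>\<^sub>M N \<and>
     prob_space.indep_set M (sets (vimage_algebra (space M) X S)) (sets (vimage_algebra (space M) Y N))"

text \<open>
  The probability kernel \<open>K\<close> is a regular conditional distribution of the \<open>S\<close>-valued random
  variable \<open>X\<close> given the \<open>N\<close>-valued random variable \<open>Y\<close>:
  \<open>K (Y \<omega>) A\<close> is a version of \<open>P(X \<in> A | \<sigma>(Y))\<close> for every measurable \<open>A\<close>.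
\<close>

definition regular_conditional_distribution ::
  "'w measure \<Rightarrow> 'a measure \<Rightarrow> ('w \<Rightarrow> 'a) \<Rightarrow> 'b measure \<Rightarrow> ('w \<Rightarrow> 'b) \<Rightarrow> ('b \<Rightarrow> 'a measure) \<Rightarrow> bool"
where
  "regular_conditional_distribution M S X N Y K \<longleftrightarrow>
     X \<in> M \<rightarrow>\<^sub>M S \<and> Y \<in> M \<rightarrow>\<^sub>M N \<and> K \<in> N \<rightarrow>\<^sub>M prob_algebra S \<and>
     (\<forall>A\<in>sets S. AE \<omega> in M. measure (K (Y \<omega>)) A =
        real_cond_exp M (vimage_algebra (space M) Y N) (indicator (X -` A \<inter> space M)) \<omega>)"

end

theory Submission
  imports Defs "HOL-Real_Asymp.Real_Asymp"
begin

text \<open>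
  Write \<open>h\<close> for the observation map.  Given \<open>u = v\<close>, the datum \<open>y = h(v) + \<eta>\<close> has a Gaussian density at
  \<open>y\<close> that is proportional to \<open>exp (- \<Phi>(v; y))\<close>.  As soon as \<open>h\<close> is measurable, Fubini's theorem therefore
  computes the joint law of \<open>(u, y)\<close>, and dividing by the marginal density of \<open>y\<close> gives Bayes' formula.
  The likelihood lies between \<open>0\<close> and \<open>1\<close> and never vanishes, and the prior is a probability measure, so that
  the evidence \<open>Z\<close> is finite and positive for every \<open>y\<close>.  This is Bayes' theorem for additive noise in
  the locale \<open>additive_noise_likelihood\<close>.

  The substance of the theorem is the measurability of \<open>h\<close>.  For a functional \<open>f\<close> in the dual of \<open>V\<close> and
  \<open>p\<close> the weak solution with right-hand side \<open>f\<close>, Dirichlet's principle says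
  \<open>f(p) = sup {2 f(v) - a(v, v) | v \<in> V}\<close>, where \<open>a(v, w) = \<integral> \<kappa> \<nabla>v \<cdot> \<nabla>w\<close>.
  For a fixed \<open>v\<close> the number \<open>a(v, v)\<close> depends continuously on the parameters: if parameters converge, the
  permeabilities converge at every point off the interfaces and the fault line of the limit, and these form a
  null set, so that dominated convergence applies (\<open>continuous_energy_form_permeability\<close>).  Hence \<open>f(p)\<close>
  is lower semicontinuous in the parameters and in particular Borel measurable
  (\<open>borel_measurable_solution_energy\<close>).  An observation \<open>l(p)\<close> with another functional \<open>l\<close> is recovered
  by polarization from the values of this kind for \<open>f\<close>, \<open>l\<close> and \<open>f + l\<close>, since \<open>a\<close> is symmetric
  (\<open>solution_polarization\<close>).

  Dirichlet's principle rests on the existence of weak solutions.  They are obtained by minimising the energy: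
  by the parallelogram identity the gradients of a minimising sequence form a Cauchy sequence, and \<open>V\<close>
  is complete for the gradient norm (\<open>V_complete\<close>).  Completeness combines the Riesz--Fischer theorem
  (\<open>L2_complete\<close>), the Poincare inequality, and the fact that a weak gradient is unique almost everywhere.
  Uniqueness is the fundamental lemma of the calculus of variations, for which smooth approximations of the
  indicators of boxes are built from \<open>exp (- 1 / t)\<close>.
\<close>

section \<open>Square-integrable functions on the unit square\<close>

definition L2_inner_D ::
  "(real \<times> real \<Rightarrow> 'b::euclidean_space) \<Rightarrow> (real \<times> real \<Rightarrow> 'b) \<Rightarrow> real" where
  "L2_inner_D f g = (LINT z|leb_D. f z \<bullet> g z)"

lemma unit_square_eq_box: "unit_square = box (0, 0) (1, 1)"
  by (auto simp: unit_square_def box_def Basis_prod_def)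

lemma sets_unit_square [measurable]: "unit_square \<in> sets lebesgue" "unit_square \<in> sets borel"
  by (simp_all add: unit_square_eq_box)

lemma prob_space_leb_D: "prob_space leb_D"
proof
  have "emeasure leb_D (space leb_D) = emeasure lborel (box (0, 0) (1, 1::real) :: (real \<times> real) set)"
    by (simp add: emeasure_restrict_space unit_square_eq_box)
  also have "\<dots> = 1"
    by (simp add: emeasure_lborel_box_eq Basis_prod_def prod.union_disjoint)
  finally show "emeasure leb_D (space leb_D) = 1" .
qed

interpretation leb_D: prob_space leb_D
  by (rule prob_space_leb_D)

lemma L2_D_measurable: "f \<in> L2_D \<Longrightarrow> f \<in> borel_measurable leb_D"
  by (simp add: L2_D_def)

lemma L2_D_square_integrable: "f \<in> L2_D \<Longrightarrow> integrable leb_D (\<lambda>z. (norm (f z))\<^sup>2)"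
  by (simp add: L2_D_def)

lemma L2_D_bound:
  fixes f :: "real \<times> real \<Rightarrow> 'b::euclidean_space"
  assumes "f \<in> borel_measurable leb_D" "integrable leb_D h" "AE z in leb_D. (norm (f z))\<^sup>2 \<le> h z"
  shows "f \<in> L2_D"
proof -
  have "integrable leb_D (\<lambda>z. (norm (f z))\<^sup>2)"
    using assms(1) by (intro Bochner_Integration.integrable_bound[OF assms(2)]) (use assms(3) in auto)
  with assms(1) show ?thesis by (simp add: L2_D_def)
qed

lemma L2_D_add:
  fixes f g :: "real \<times> real \<Rightarrow> 'b::euclidean_space"
  assumes "f \<in> L2_D" "g \<in> L2_D"
  shows "(\<lambda>z. f z + g z) \<in> L2_D"
proof (rule L2_D_bound)
  show "integrable leb_D (\<lambda>z. 2 * (norm (f z))\<^sup>2 + 2 * (norm (g z))\<^sup>2)"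
    using assms by (auto simp: L2_D_def)
  show "AE z in leb_D. (norm (f z + g z))\<^sup>2 \<le> 2 * (norm (f z))\<^sup>2 + 2 * (norm (g z))\<^sup>2"
  proof (rule AE_I2)
    fix z
    have "(norm (f z + g z))\<^sup>2 \<le> (norm (f z) + norm (g z))\<^sup>2"
      by (simp add: norm_triangle_ineq power_mono)
    also have "\<dots> \<le> 2 * (norm (f z))\<^sup>2 + 2 * (norm (g z))\<^sup>2"
      using zero_le_power2[of "norm (f z) - norm (g z)"]
      unfolding power2_sum power2_diff by linarith
    finally show "(norm (f z + g z))\<^sup>2 \<le> 2 * (norm (f z))\<^sup>2 + 2 * (norm (g z))\<^sup>2" .
  qed
qed (use assms in \<open>auto simp: L2_D_def\<close>)

lemma L2_D_scaleR:
  fixes f :: "real \<times> real \<Rightarrow> 'b::euclidean_space"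
  assumes "f \<in> L2_D"
  shows "(\<lambda>z. c *\<^sub>R f z) \<in> L2_D"
  using assms by (auto simp: L2_D_def power_mult_distrib)

lemma L2_D_combination:
  fixes f g :: "real \<times> real \<Rightarrow> 'b::euclidean_space"
  assumes "f \<in> L2_D" "g \<in> L2_D"
  shows "(\<lambda>z. s *\<^sub>R f z + t *\<^sub>R g z) \<in> L2_D"
  by (intro L2_D_add L2_D_scaleR assms)

lemma L2_D_diff:
  fixes f g :: "real \<times> real \<Rightarrow> 'b::euclidean_space"
  assumes "f \<in> L2_D" "g \<in> L2_D"
  shows "(\<lambda>z. f z - g z) \<in> L2_D"
  using L2_D_combination[OF assms, of 1 "-1"] by simp

lemma L2_D_inner_integrable:
  fixes f g :: "real \<times> real \<Rightarrow> 'b::euclidean_space"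
  assumes "f \<in> L2_D" "g \<in> L2_D"
  shows "integrable leb_D (\<lambda>z. f z \<bullet> g z)"
proof (rule Bochner_Integration.integrable_bound)
  show "integrable leb_D (\<lambda>z. (norm (f z))\<^sup>2 + (norm (g z))\<^sup>2)"
    using assms by (auto simp: L2_D_def)
  show "AE z in leb_D. norm (f z \<bullet> g z) \<le> norm ((norm (f z))\<^sup>2 + (norm (g z))\<^sup>2)"
  proof (rule AE_I2)
    fix z
    have "\<bar>f z \<bullet> g z\<bar> \<le> norm (f z) * norm (g z)"
      by (rule Cauchy_Schwarz_ineq2)
    also have "\<dots> \<le> (norm (f z))\<^sup>2 + (norm (g z))\<^sup>2"
      using zero_le_power2[of "norm (f z) - norm (g z)"] zero_le_power2[of "norm (f z)"]
        zero_le_power2[of "norm (g z)"]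
      unfolding power2_diff by linarith
    finally show "norm (f z \<bullet> g z) \<le> norm ((norm (f z))\<^sup>2 + (norm (g z))\<^sup>2)"
      by simp
  qed
qed (use assms in \<open>auto simp: L2_D_def\<close>)

lemma L2_norm_D_nonneg [simp]: "0 \<le> L2_norm_D f"
  by (simp add: L2_norm_D_def)

lemma L2_norm_D_square: "(L2_norm_D f)\<^sup>2 = L2_inner_D f f"
  by (simp add: L2_norm_D_def L2_inner_D_def power2_norm_eq_inner)

lemma L2_norm_D_cong_AE:
  assumes "f \<in> borel_measurable leb_D" "g \<in> borel_measurable leb_D" "AE z in leb_D. f z = g z"
  shows "L2_norm_D f = L2_norm_D g"
proof -
  have "(LINT z|leb_D. (norm (f z))\<^sup>2) = (LINT z|leb_D. (norm (g z))\<^sup>2)"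
    using assms by (intro integral_cong_AE) auto
  then show ?thesis by (simp add: L2_norm_D_def)
qed

lemma L2_inner_D_commute: "L2_inner_D f g = L2_inner_D g f"
  by (simp add: L2_inner_D_def inner_commute)

lemma L2_inner_D_combination:
  fixes f g :: "real \<times> real \<Rightarrow> 'b::euclidean_space"
  assumes "f \<in> L2_D" "g \<in> L2_D" "h \<in> L2_D"
  shows "L2_inner_D (\<lambda>z. s *\<^sub>R f z + t *\<^sub>R g z) h = s * L2_inner_D f h + t * L2_inner_D g h"
  using L2_D_inner_integrable[OF assms(1,3)] L2_D_inner_integrable[OF assms(2,3)]
  by (simp add: L2_inner_D_def inner_add_left)

lemma L2_norm_D_combination_square:
  fixes f g :: "real \<times> real \<Rightarrow> 'b::euclidean_space"
  assumes "f \<in> L2_D" "g \<in> L2_D"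
  shows "(L2_norm_D (\<lambda>z. s *\<^sub>R f z + t *\<^sub>R g z))\<^sup>2 =
    s\<^sup>2 * (L2_norm_D f)\<^sup>2 + 2 * s * t * L2_inner_D f g + t\<^sup>2 * (L2_norm_D g)\<^sup>2"
proof -
  let ?c = "\<lambda>z. s *\<^sub>R f z + t *\<^sub>R g z"
  have "L2_inner_D ?c ?c = s * L2_inner_D ?c f + t * L2_inner_D ?c g"
    using L2_inner_D_combination[OF assms L2_D_combination[OF assms], of s t s t]
    by (simp only: L2_inner_D_commute[of f ?c] L2_inner_D_commute[of g ?c])
  also have "L2_inner_D ?c f = s * L2_inner_D f f + t * L2_inner_D f g"
    by (subst L2_inner_D_combination) (simp_all only: assms L2_inner_D_commute[of g f])
  also have "L2_inner_D ?c g = s * L2_inner_D f g + t * L2_inner_D g g"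
    by (rule L2_inner_D_combination) (simp_all only: assms)
  finally show ?thesis
    unfolding L2_norm_D_square by (simp add: power2_eq_square algebra_simps)
qed

text \<open>The discriminant criterion yields the Cauchy--Schwarz inequality.  With \<open>a = 0\<close> it also says that
  the first variation \<open>b\<close> vanishes at a minimum.\<close>

lemma nonneg_quadratic_discriminant:
  fixes a b c :: real
  assumes "\<And>t. 0 \<le> a + 2 * t * b + t\<^sup>2 * c" "0 \<le> c"
  shows "b\<^sup>2 \<le> a * c"
proof (cases "c = 0")
  case True
  have "b = 0"
  proof (rule ccontr)
    assume "b \<noteq> 0"
    then show False
      using assms(1)[of "- (a + 1) / (2 * b)"] True by (simp add: field_simps)
  qed
  with True show ?thesis by simp
next
  case False
  then have "0 < c" using assms(2) by simp
  then show ?thesis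
    using assms(1)[of "- b / c"] by (simp add: field_simps power2_eq_square)
qed

lemma L2_Cauchy_Schwarz:
  fixes f g :: "real \<times> real \<Rightarrow> 'b::euclidean_space"
  assumes "f \<in> L2_D" "g \<in> L2_D"
  shows "\<bar>L2_inner_D f g\<bar> \<le> L2_norm_D f * L2_norm_D g"
proof -
  have "0 \<le> (L2_norm_D f)\<^sup>2 + 2 * t * L2_inner_D f g + t\<^sup>2 * (L2_norm_D g)\<^sup>2" for t
    using L2_norm_D_combination_square[OF assms, of 1 t]
      zero_le_power2[of "L2_norm_D (\<lambda>z. 1 *\<^sub>R f z + t *\<^sub>R g z)"] by simp
  then have "(L2_inner_D f g)\<^sup>2 \<le> (L2_norm_D f)\<^sup>2 * (L2_norm_D g)\<^sup>2"
    by (rule nonneg_quadratic_discriminant) simp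
  then have "(L2_inner_D f g)\<^sup>2 \<le> (L2_norm_D f * L2_norm_D g)\<^sup>2"
    by (simp only: power_mult_distrib)
  then have "\<bar>L2_inner_D f g\<bar> \<le> \<bar>L2_norm_D f * L2_norm_D g\<bar>"
    by (simp only: abs_le_square_iff)
  then show ?thesis by simp
qed

lemma L2_norm_D_scaleR: "L2_norm_D (\<lambda>z. c *\<^sub>R f z) = \<bar>c\<bar> * L2_norm_D f"
  by (simp add: L2_norm_D_def power_mult_distrib real_sqrt_mult)

lemma L2_norm_D_diff_commute: "L2_norm_D (\<lambda>z. f z - g z) = L2_norm_D (\<lambda>z. g z - f z)"
  by (simp add: L2_norm_D_def norm_minus_commute)

lemma L2_triangle:
  fixes f g :: "real \<times> real \<Rightarrow> 'b::euclidean_space"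
  assumes "f \<in> L2_D" "g \<in> L2_D"
  shows "L2_norm_D (\<lambda>z. f z + g z) \<le> L2_norm_D f + L2_norm_D g"
proof (rule power2_le_imp_le)
  show "(L2_norm_D (\<lambda>z. f z + g z))\<^sup>2 \<le> (L2_norm_D f + L2_norm_D g)\<^sup>2"
    using L2_norm_D_combination_square[OF assms, of 1 1] L2_Cauchy_Schwarz[OF assms]
    by (simp add: power2_sum)
qed simp

lemma L2_triangle_diff:
  fixes f g h :: "real \<times> real \<Rightarrow> 'b::euclidean_space"
  assumes "f \<in> L2_D" "g \<in> L2_D" "h \<in> L2_D"
  shows "L2_norm_D (\<lambda>z. f z - h z) \<le> L2_norm_D (\<lambda>z. f z - g z) + L2_norm_D (\<lambda>z. g z - h z)"
  using L2_triangle[OF L2_D_diff[OF assms(1,2)] L2_D_diff[OF assms(2,3)]] by simp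

lemma L2_norm_D_le_add_diff:
  fixes f g :: "real \<times> real \<Rightarrow> 'b::euclidean_space"
  assumes "f \<in> L2_D" "g \<in> L2_D"
  shows "L2_norm_D f \<le> L2_norm_D g + L2_norm_D (\<lambda>z. f z - g z)"
  using L2_triangle[OF assms(2) L2_D_diff[OF assms]] by simp

lemma L2_norm_D_tendsto:
  fixes f :: "nat \<Rightarrow> real \<times> real \<Rightarrow> 'b::euclidean_space"
  assumes "\<And>k. f k \<in> L2_D" "g \<in> L2_D" "(\<lambda>k. L2_norm_D (\<lambda>z. g z - f k z)) \<longlonglongrightarrow> 0"
  shows "(\<lambda>k. L2_norm_D (f k)) \<longlonglongrightarrow> L2_norm_D g"
proof -
  have "\<bar>L2_norm_D (f k) - L2_norm_D g\<bar> \<le> L2_norm_D (\<lambda>z. g z - f k z)" for k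
    using L2_norm_D_le_add_diff[OF assms(2) assms(1)[of k]]
      L2_norm_D_le_add_diff[OF assms(1)[of k] assms(2)] L2_norm_D_diff_commute[of g "f k"]
    by linarith
  then have "(\<lambda>k. L2_norm_D (f k) - L2_norm_D g) \<longlonglongrightarrow> 0"
    by (intro Lim_null_comparison[OF _ assms(3)]) auto
  then show ?thesis by (simp add: LIM_zero_iff)
qed

lemma L2_inner_D_tendsto:
  fixes f :: "nat \<Rightarrow> real \<times> real \<Rightarrow> 'b::euclidean_space"
  assumes "\<And>k. f k \<in> L2_D" "g \<in> L2_D" "(\<lambda>k. L2_norm_D (\<lambda>z. g z - f k z)) \<longlonglongrightarrow> 0" "h \<in> L2_D"
  shows "(\<lambda>k. L2_inner_D (f k) h) \<longlonglongrightarrow> L2_inner_D g h"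
proof -
  have "\<bar>L2_inner_D (f k) h - L2_inner_D g h\<bar> \<le> L2_norm_D (\<lambda>z. g z - f k z) * L2_norm_D h" for k
    using L2_Cauchy_Schwarz[OF L2_D_diff[OF assms(2) assms(1)[of k]] assms(4)]
      L2_inner_D_combination[OF assms(2) assms(1)[of k] assms(4), of 1 "-1"]
    by (simp add: abs_minus_commute)
  then have "(\<lambda>k. L2_inner_D (f k) h - L2_inner_D g h) \<longlonglongrightarrow> 0"
    by (intro Lim_null_comparison[OF _ tendsto_mult_left_zero[OF assms(3), of "L2_norm_D h"]]) auto
  then show ?thesis by (simp add: LIM_zero_iff)
qed

lemma L2_norm_D_mono:
  fixes f :: "real \<times> real \<Rightarrow> 'b::euclidean_space" and g :: "real \<times> real \<Rightarrow> 'c::euclidean_space"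
  assumes "f \<in> L2_D" "g \<in> L2_D" "AE z in leb_D. norm (f z) \<le> c * norm (g z)" "0 \<le> c"
  shows "L2_norm_D f \<le> c * L2_norm_D g"
proof -
  have "(LINT z|leb_D. (norm (f z))\<^sup>2) \<le> (LINT z|leb_D. (norm (c *\<^sub>R g z))\<^sup>2)"
  proof (rule integral_mono_AE)
    show "AE z in leb_D. (norm (f z))\<^sup>2 \<le> (norm (c *\<^sub>R g z))\<^sup>2"
      using assms(3) by eventually_elim (simp add: assms(4) power_mono)
  qed (intro L2_D_square_integrable L2_D_scaleR assms)+
  then have "L2_norm_D f \<le> L2_norm_D (\<lambda>z. c *\<^sub>R g z)"
    by (simp add: L2_norm_D_def)
  then show ?thesis using assms(4) by (simp add: L2_norm_D_scaleR)
qed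

text \<open>The square has unit area, so the constant \<open>1\<close> has norm \<open>1\<close> and Cauchy--Schwarz applies to it and \<open>norm f\<close>.\<close>

lemma L1_le_L2_norm_D:
  fixes f :: "real \<times> real \<Rightarrow> 'b::euclidean_space"
  assumes "f \<in> L2_D"
  shows "(LINT z|leb_D. norm (f z)) \<le> L2_norm_D f"
proof -
  have *: "(\<lambda>z. norm (f z)) \<in> L2_D" "(\<lambda>_. 1::real) \<in> L2_D"
    using assms by (auto simp: L2_D_def)
  have "L2_norm_D (\<lambda>_. 1::real) = 1"
    using leb_D.prob_space by (simp add: L2_norm_D_def)
  moreover have "L2_norm_D (\<lambda>z. norm (f z)) = L2_norm_D f"
    by (simp add: L2_norm_D_def)
  ultimately show ?thesis
    using L2_Cauchy_Schwarz[OF *] by (simp add: L2_inner_D_def)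
qed

lemma L2_D_integrable:
  fixes f :: "real \<times> real \<Rightarrow> 'b::euclidean_space"
  assumes "f \<in> L2_D"
  shows "integrable leb_D f"
proof -
  have "(\<lambda>z. norm (f z)) \<in> L2_D" "(\<lambda>_. 1::real) \<in> L2_D"
    using assms by (auto simp: L2_D_def)
  from L2_D_inner_integrable[OF this] assms show ?thesis
    by (simp add: L2_D_def integrable_norm_iff)
qed

text \<open>The Riesz--Fischer theorem.  A Cauchy sequence for the \<open>L\<^sup>2\<close> norm is one for the \<open>L\<^sup>1\<close> norm, so that a
  subsequence converges almost everywhere.  Fatou's lemma along this subsequence bounds the distance of the
  pointwise limit from the members of the sequence.\<close>

lemma L2_complete:
  fixes f :: "nat \<Rightarrow> real \<times> real \<Rightarrow> 'b::euclidean_space"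
  assumes f: "\<And>k. f k \<in> L2_D"
    and Cauchy: "\<And>e. e > 0 \<Longrightarrow> \<exists>N. \<forall>m\<ge>N. \<forall>k\<ge>N. L2_norm_D (\<lambda>z. f m z - f k z) < e"
  shows "\<exists>g\<in>L2_D. (\<lambda>k. L2_norm_D (\<lambda>z. g z - f k z)) \<longlonglongrightarrow> 0"
proof -
  have [measurable]: "f k \<in> borel_measurable leb_D" for k
    using f L2_D_measurable by blast
  have "\<exists>N. \<forall>i\<ge>N. \<forall>j\<ge>N. (LINT z|leb_D. norm (f i z - f j z)) < e" if "e > 0" for e
    using Cauchy[OF that] L1_le_L2_norm_D[OF L2_D_diff[OF f f]] by (meson order_le_less_trans)
  then obtain r where r: "strict_mono r" "AE z in leb_D. Cauchy (\<lambda>i. f (r i) z)"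
    using cauchy_L1_AE_cauchy_subseq[of leb_D f, OF L2_D_integrable[OF f]] by blast
  define g where "g z = lim (\<lambda>i. f (r i) z)" for z
  have [measurable]: "g \<in> borel_measurable leb_D"
    unfolding g_def by measurable
  have lim: "AE z in leb_D. (\<lambda>i. f (r i) z) \<longlonglongrightarrow> g z"
    using r(2) by eventually_elim (simp add: g_def Cauchy_convergent convergent_LIMSEQ_iff[symmetric])
  \<comment> \<open>Fatou's lemma, in extended nonnegative integrals because \<open>g\<close> is not yet known to be square integrable.\<close>
  have bound: "(\<integral>\<^sup>+z. ennreal ((norm (g z - f m z))\<^sup>2) \<partial>leb_D) \<le> ennreal (e\<^sup>2)"
    if "\<And>k. k \<ge> N \<Longrightarrow> L2_norm_D (\<lambda>z. f m z - f k z) < e" for e m N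
  proof -
    have "(\<integral>\<^sup>+z. ennreal ((norm (g z - f m z))\<^sup>2) \<partial>leb_D) =
        (\<integral>\<^sup>+z. liminf (\<lambda>i. ennreal ((norm (f (r i) z - f m z))\<^sup>2)) \<partial>leb_D)"
    proof (rule nn_integral_cong_AE, use lim in eventually_elim)
      fix z assume "(\<lambda>i. f (r i) z) \<longlonglongrightarrow> g z"
      then have "(\<lambda>i. ennreal ((norm (f (r i) z - f m z))\<^sup>2)) \<longlonglongrightarrow> ennreal ((norm (g z - f m z))\<^sup>2)"
        by (intro tendsto_ennrealI tendsto_intros)
      then show "ennreal ((norm (g z - f m z))\<^sup>2) =
          liminf (\<lambda>i. ennreal ((norm (f (r i) z - f m z))\<^sup>2))"
        using lim_imp_Liminf[OF sequentially_bot] by metis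
    qed
    also have "\<dots> \<le> liminf (\<lambda>i. \<integral>\<^sup>+z. ennreal ((norm (f (r i) z - f m z))\<^sup>2) \<partial>leb_D)"
      by (rule nn_integral_liminf) measurable
    also have "\<dots> \<le> ennreal (e\<^sup>2)"
    proof (rule Liminf_le)
      show "\<forall>\<^sub>F i in sequentially. (\<integral>\<^sup>+z. ennreal ((norm (f (r i) z - f m z))\<^sup>2) \<partial>leb_D) \<le> ennreal (e\<^sup>2)"
        using eventually_ge_at_top[of N]
      proof eventually_elim
        fix i assume "N \<le> i"
        then have "N \<le> r i" using seq_suble[OF r(1), of i] by simp
        have "(\<integral>\<^sup>+z. ennreal ((norm (f (r i) z - f m z))\<^sup>2) \<partial>leb_D) =
            ennreal ((L2_norm_D (\<lambda>z. f m z - f (r i) z))\<^sup>2)"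
          using L2_D_square_integrable[OF L2_D_diff[OF f f]]
          by (subst nn_integral_eq_integral) (auto simp: L2_norm_D_def norm_minus_commute)
        also have "\<dots> \<le> ennreal (e\<^sup>2)"
          using that[OF \<open>N \<le> r i\<close>] by (intro ennreal_leI power_mono) auto
        finally show "(\<integral>\<^sup>+z. ennreal ((norm (f (r i) z - f m z))\<^sup>2) \<partial>leb_D) \<le> ennreal (e\<^sup>2)" .
      qed
    qed simp
    finally show ?thesis .
  qed
  have L2: "(\<lambda>z. g z - f m z) \<in> L2_D \<and> L2_norm_D (\<lambda>z. g z - f m z) \<le> e"
    if "\<And>k. k \<ge> N \<Longrightarrow> L2_norm_D (\<lambda>z. f m z - f k z) < e" for e m N
  proof -
    have int: "integrable leb_D (\<lambda>z. (norm (g z - f m z))\<^sup>2)"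
      using bound[of N m e] that
      by (intro integrableI_bounded) (auto simp: le_less_trans[OF _ ennreal_less_top])
    have "0 \<le> e" using that[of N] L2_norm_D_nonneg[of "\<lambda>z. f m z - f N z"] by linarith
    moreover have "(LINT z|leb_D. (norm (g z - f m z))\<^sup>2) \<le> e\<^sup>2"
      using bound[of N m e] that nn_integral_eq_integral[OF int] by simp
    ultimately show ?thesis
      using int by (auto simp: L2_D_def L2_norm_D_def intro: real_le_lsqrt)
  qed
  obtain N where "\<forall>m\<ge>N. \<forall>k\<ge>N. L2_norm_D (\<lambda>z. f m z - f k z) < 1"
    using Cauchy[of 1] by auto
  then have "(\<lambda>z. g z - f N z) \<in> L2_D"
    using L2[of N N 1] by simp
  then have "g \<in> L2_D"
    using L2_D_add[OF _ f[of N], of "\<lambda>z. g z - f N z"] by simp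
  moreover have "(\<lambda>k. L2_norm_D (\<lambda>z. g z - f k z)) \<longlonglongrightarrow> 0"
  proof (rule LIMSEQ_I)
    fix e :: real assume "e > 0"
    then obtain N where "\<forall>m\<ge>N. \<forall>k\<ge>N. L2_norm_D (\<lambda>z. f m z - f k z) < e / 2"
      using Cauchy[of "e / 2"] by auto
    then have "L2_norm_D (\<lambda>z. g z - f m z) \<le> e / 2" if "m \<ge> N" for m
      using L2[of N m "e / 2"] that by simp
    then have "L2_norm_D (\<lambda>z. g z - f m z) < e" if "m \<ge> N" for m
      using that \<open>e > 0\<close> by fastforce
    then show "\<exists>N. \<forall>m\<ge>N. norm (L2_norm_D (\<lambda>z. g z - f m z) - 0) < e"
      by auto
  qed
  ultimately show ?thesis by blast
qed

section \<open>Test functions\<close>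

lemma C_k_SucI:
  assumes "\<And>z. (f has_derivative (\<lambda>d. fst d * fx z + snd d * fy z)) (at z)" "C_k k fx" "C_k k fy"
  shows "C_k (Suc k) f"
  using assms by auto

lemma C_k_Suc_imp: "C_k (Suc k) f \<Longrightarrow> C_k k f"
proof (induction k arbitrary: f)
  case 0
  then obtain fx fy where "\<And>z. (f has_derivative (\<lambda>d. fst d * fx z + snd d * fy z)) (at z)"
    by auto
  then have "isCont f z" for z
    by (rule has_derivative_continuous)
  then show ?case by (simp add: continuous_on_eq_continuous_at)
next
  case (Suc k)
  then show ?case by (metis C_k.simps(2))
qed

lemma C_k_add: "C_k k f \<Longrightarrow> C_k k g \<Longrightarrow> C_k k (\<lambda>z. f z + g z)"
proof (induction k arbitrary: f g)
  case 0
  then show ?case by (auto intro: continuous_on_add)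
next
  case (Suc k)
  from Suc.prems obtain fx fy gx gy where
    f: "\<And>z. (f has_derivative (\<lambda>d. fst d * fx z + snd d * fy z)) (at z)" "C_k k fx" "C_k k fy" and
    g: "\<And>z. (g has_derivative (\<lambda>d. fst d * gx z + snd d * gy z)) (at z)" "C_k k gx" "C_k k gy"
    by auto
  show ?case unfolding C_k.simps
  proof (intro exI conjI allI)
    show "((\<lambda>z. f z + g z) has_derivative
        (\<lambda>d. fst d * (fx z + gx z) + snd d * (fy z + gy z))) (at z)" for z
      by (rule has_derivative_eq_rhs[OF has_derivative_add[OF f(1) g(1)]])
        (auto simp: algebra_simps)
  qed (use Suc.IH f g in auto)
qed

lemma C_k_mult: "C_k k f \<Longrightarrow> C_k k g \<Longrightarrow> C_k k (\<lambda>z. f z * g z)"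
proof (induction k arbitrary: f g)
  case 0
  then show ?case by (auto intro: continuous_on_mult)
next
  case (Suc k)
  from Suc.prems obtain fx fy gx gy where
    f: "\<And>z. (f has_derivative (\<lambda>d. fst d * fx z + snd d * fy z)) (at z)" "C_k k fx" "C_k k fy" and
    g: "\<And>z. (g has_derivative (\<lambda>d. fst d * gx z + snd d * gy z)) (at z)" "C_k k gx" "C_k k gy"
    by auto
  have fg: "C_k k f" "C_k k g"
    using Suc.prems C_k_Suc_imp by blast+
  show ?case unfolding C_k.simps
  proof (intro exI conjI allI)
    show "((\<lambda>z. f z * g z) has_derivative
        (\<lambda>d. fst d * (fx z * g z + f z * gx z) + snd d * (fy z * g z + f z * gy z))) (at z)" for z
      by (rule has_derivative_eq_rhs[OF has_derivative_mult[OF f(1) g(1)]])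
        (auto simp: algebra_simps)
  qed (use Suc.IH f g fg C_k_add in auto)
qed

lemma C_k_const: "C_k k (\<lambda>z. c)"
proof (induction k arbitrary: c)
  case (Suc k)
  show ?case unfolding C_k.simps
    by (intro exI[of _ "\<lambda>_. 0"] conjI Suc.IH allI) auto
qed simp

text \<open>The sequence \<open>h\<close> lists the successive derivatives of \<open>h 0\<close>; quantifying over the index makes the
  induction on the order of differentiability go through.\<close>

lemma C_k_one_variable:
  fixes h :: "nat \<Rightarrow> real \<Rightarrow> real"
  assumes "\<And>m t. (h m has_real_derivative h (Suc m) t) (at t)"
  shows "C_k k (\<lambda>z. h m (fst z))" "C_k k (\<lambda>z. h m (snd z))"
proof -
  have cont: "continuous_on UNIV (h m)" for m
    using DERIV_isCont[OF assms] by (simp add: continuous_at_imp_continuous_on)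
  have der: "(h m has_derivative (*) (h (Suc m) t)) (at t)" for m t
    using assms[of m t] by (simp add: has_field_derivative_def)
  have "C_k k (\<lambda>z. h m (fst z)) \<and> C_k k (\<lambda>z. h m (snd z))"
  proof (induction k arbitrary: m)
    case 0
    then show ?case
      by (auto intro!: continuous_on_compose2[OF cont] continuous_intros)
  next
    case (Suc k)
    have "((\<lambda>z. h m (fst z)) has_derivative
        (\<lambda>d. fst d * h (Suc m) (fst z) + snd d * 0)) (at z)" for z :: "real \<times> real"
      by (rule has_derivative_eq_rhs[OF has_derivative_compose[OF has_derivative_fst[OF has_derivative_ident] der]])
        (auto simp: mult.commute)
    then have "C_k (Suc k) (\<lambda>z. h m (fst z))"
      using Suc.IH by (intro C_k_SucI[of _ "\<lambda>z. h (Suc m) (fst z)" "\<lambda>_. 0"] C_k_const) auto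
    moreover have "((\<lambda>z. h m (snd z)) has_derivative
        (\<lambda>d. fst d * 0 + snd d * h (Suc m) (snd z))) (at z)" for z :: "real \<times> real"
      by (rule has_derivative_eq_rhs[OF has_derivative_compose[OF has_derivative_snd[OF has_derivative_ident] der]])
        (auto simp: mult.commute)
    then have "C_k (Suc k) (\<lambda>z. h m (snd z))"
      using Suc.IH by (intro C_k_SucI[of _ "\<lambda>_. 0" "\<lambda>z. h (Suc m) (snd z)"] C_k_const) auto
    ultimately show ?case ..
  qed
  then show "C_k k (\<lambda>z. h m (fst z))" "C_k k (\<lambda>z. h m (snd z))" by auto
qed

text \<open>The functions \<open>P(1/t) exp (- 1/t)\<close>, continued by \<open>0\<close> to \<open>t \<le> 0\<close>.  This class contains the classical
  smooth function that is flat at \<open>0\<close> (the case \<open>P = 1\<close>), and differentiation maps it into itself,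
  which gives derivatives of all orders at once.\<close>

definition flat_exp :: "real poly \<Rightarrow> real \<Rightarrow> real" where
  "flat_exp P t = (if t \<le> 0 then 0 else poly P (1 / t) * exp (- 1 / t))"

text \<open>With \<open>s = 1/t\<close> the derivative with respect to \<open>t\<close> is \<open>- s\<^sup>2\<close> times the derivative with respect to \<open>s\<close>,
  and \<open>P(s) exp (- s)\<close> has the derivative \<open>(P'(s) - P(s)) exp (- s)\<close>.\<close>

definition flat_exp_deriv :: "real poly \<Rightarrow> real poly" where
  "flat_exp_deriv P = [:0, 0, 1:] * (P - pderiv P)"

lemma poly_times_exp_neg_tendsto_0:
  fixes P :: "real poly"
  shows "((\<lambda>s. poly P s * exp (- s)) \<longlongrightarrow> 0) at_top"
proof -
  have "((\<lambda>s::real. s ^ i * exp (- s)) \<longlongrightarrow> 0) at_top" for i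
    using tendsto_power_div_exp_0[of i] by (simp add: exp_minus field_simps)
  then have "((\<lambda>s. \<Sum>i\<le>degree P. coeff P i * (s ^ i * exp (- s))) \<longlongrightarrow> (\<Sum>i\<le>degree P. coeff P i * 0)) at_top"
    by (intro tendsto_sum tendsto_mult_left)
  then show ?thesis
    by (simp add: poly_altdef sum_distrib_right mult.assoc)
qed

lemma flat_exp_tendsto_0: "(flat_exp P \<longlongrightarrow> 0) (at 0)"
proof -
  have "((\<lambda>t. poly P (inverse t) * exp (- inverse t)) \<longlongrightarrow> 0) (at_right 0)"
    by (rule filterlim_compose[OF poly_times_exp_neg_tendsto_0 filterlim_inverse_at_top_right])
  then have "(flat_exp P \<longlongrightarrow> 0) (at_right 0)"
    by (rule Lim_transform_eventually)
      (auto simp: flat_exp_def field_simps eventually_at_right_less intro: eventually_mono[OF eventually_at_right_less[of 0]])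
  moreover have "(flat_exp P \<longlongrightarrow> 0) (at_left 0)"
    by (rule Lim_transform_eventually[OF tendsto_const])
      (auto simp: flat_exp_def eventually_at_filter)
  ultimately show ?thesis by (simp add: filterlim_at_split)
qed

text \<open>At \<open>t = 0\<close> the difference quotient belongs to the same class, with the polynomial \<open>s P(s)\<close>, and hence tends to
  \<open>0\<close>.\<close>

lemma flat_exp_has_derivative:
  "(flat_exp P has_real_derivative flat_exp (flat_exp_deriv P) t) (at t)"
proof -
  consider "t < 0" | "t > 0" | "t = 0" by linarith
  then show ?thesis
  proof cases
    case 1
    then have "((\<lambda>_. 0) has_real_derivative flat_exp (flat_exp_deriv P) t) (at t)"
      by (simp add: flat_exp_def)
    then show ?thesis
      by (rule has_field_derivative_transform_within_open[where S="{..<0}"])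
        (use 1 in \<open>auto simp: flat_exp_def\<close>)
  next
    case 2
    then have "((\<lambda>t. poly P (1 / t) * exp (- 1 / t)) has_real_derivative flat_exp (flat_exp_deriv P) t) (at t)"
      by (auto intro!: derivative_eq_intros poly_DERIV DERIV_chain2[of "poly P"]
          simp: flat_exp_def flat_exp_deriv_def power2_eq_square field_simps)
    then show ?thesis
      by (rule has_field_derivative_transform_within_open[where S="{0<..}"])
        (use 2 in \<open>auto simp: flat_exp_def\<close>)
  next
    case 3
    have "((\<lambda>t. (flat_exp P t - flat_exp P 0) / (t - 0)) \<longlongrightarrow> 0) (at 0)"
      by (rule Lim_transform_eventually[OF flat_exp_tendsto_0[of "[:0, 1:] * P"]])
        (auto simp: flat_exp_def eventually_at_filter)
    then show ?thesis
      using 3 by (simp add: has_field_derivative_iff flat_exp_def)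
  qed
qed

definition smooth_step :: "real \<Rightarrow> real \<Rightarrow> real \<Rightarrow> real" where
  "smooth_step \<alpha> \<beta> t = flat_exp 1 (\<alpha> * t + \<beta>)"

lemma C_k_smooth_step:
  "C_k k (\<lambda>z. smooth_step \<alpha> \<beta> (fst z))" "C_k k (\<lambda>z. smooth_step \<alpha> \<beta> (snd z))"
proof -
  define h where "h m t = \<alpha> ^ m * flat_exp ((flat_exp_deriv ^^ m) 1) (\<alpha> * t + \<beta>)" for m t
  have "(h m has_real_derivative h (Suc m) t) (at t)" for m t
    unfolding h_def
    by (rule derivative_eq_intros DERIV_chain2[OF flat_exp_has_derivative] refl | simp)+
  from C_k_one_variable[of h k 0, OF this]
  show "C_k k (\<lambda>z. smooth_step \<alpha> \<beta> (fst z))" "C_k k (\<lambda>z. smooth_step \<alpha> \<beta> (snd z))"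
    by (simp_all add: h_def smooth_step_def)
qed

lemma smooth_step_bounds: "0 \<le> smooth_step \<alpha> \<beta> t" "smooth_step \<alpha> \<beta> t \<le> 1"
  by (auto simp: smooth_step_def flat_exp_def)

lemma smooth_step_eq_0_iff: "smooth_step \<alpha> \<beta> t = 0 \<longleftrightarrow> \<alpha> * t + \<beta> \<le> 0"
  by (simp add: smooth_step_def flat_exp_def)

text \<open>Rescaling sharpens the step at the zero of \<open>s t + r\<close>.  The summand \<open>- 1\<close> makes the \<open>k\<close>-th step vanish
  already where \<open>s t + r \<le> 1 / (k + 1)\<close>, which keeps its support inside the half-line \<open>s t + r > 0\<close>.\<close>

lemma smooth_step_tendsto:
  "(\<lambda>k. smooth_step (real (Suc k) * s) (real (Suc k) * r - 1) t) \<longlonglongrightarrow> (if s * t + r > 0 then 1 else 0)"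
proof (cases "s * t + r > 0")
  case True
  define q where "q = s * t + r"
  have *: "real (Suc k) * s * t + (real (Suc k) * r - 1) = real (Suc k) * q - 1" for k
    by (simp add: q_def algebra_simps)
  have lim: "(\<lambda>k. exp (- 1 / (real (Suc k) * q - 1))) \<longlonglongrightarrow> 1"
    using True[folded q_def] by real_asymp
  have "\<forall>\<^sub>F k in sequentially. real (Suc k) * q - 1 > 0"
    using True[folded q_def] by real_asymp
  then have "\<forall>\<^sub>F k in sequentially. exp (- 1 / (real (Suc k) * q - 1)) =
      smooth_step (real (Suc k) * s) (real (Suc k) * r - 1) t"
    by eventually_elim (simp add: smooth_step_def flat_exp_def * del: of_nat_Suc)
  with lim have "(\<lambda>k. smooth_step (real (Suc k) * s) (real (Suc k) * r - 1) t) \<longlonglongrightarrow> 1"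
    by (rule Lim_transform_eventually)
  with True show ?thesis by simp
next
  case False
  have "real (Suc k) * s * t + (real (Suc k) * r - 1) \<le> 0" for k
  proof -
    have "real (Suc k) * (s * t + r) \<le> 0"
      using False by (intro mult_nonneg_nonpos) auto
    then show ?thesis by (simp add: algebra_simps)
  qed
  then have "smooth_step (real (Suc k) * s) (real (Suc k) * r - 1) t = 0" for k
    by (simp only: smooth_step_eq_0_iff)
  with False show ?thesis by simp
qed

text \<open>Products of four steps, one for each side of the box.  Since each step vanishes in a strip along its side,
  the support is a compact subset of the open box.\<close>

lemma box_indicator_approximation:
  fixes a b :: "real \<times> real"
  assumes "box a b \<subseteq> unit_square"
  shows "\<exists>\<phi>. (\<forall>k::nat. \<phi> k \<in> test_functions) \<and> (\<forall>k z. 0 \<le> \<phi> k z \<and> \<phi> k z \<le> 1) \<and>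
    (\<forall>z. (\<lambda>k. \<phi> k z) \<longlonglongrightarrow> indicator (box a b) z)"
proof -
  obtain a1 a2 b1 b2 where ab: "a = (a1, a2)" "b = (b1, b2)"
    by (metis surj_pair)
  define st where "st k s r t = smooth_step (real (Suc k) * s) (real (Suc k) * r - 1) t" for k s r t
  define \<phi> where "\<phi> k z = st k 1 (- a1) (fst z) * st k (-1) b1 (fst z) *
     st k 1 (- a2) (snd z) * st k (-1) b2 (snd z)" for k :: nat and z
  have bounds: "0 \<le> st k s r t" "st k s r t \<le> 1" for k s r t
    by (simp_all only: st_def smooth_step_bounds)
  have "0 \<le> \<phi> k z \<and> \<phi> k z \<le> 1" for k z
    unfolding \<phi>_def by (intro conjI mult_nonneg_nonneg mult_le_one bounds)
  moreover have "(\<lambda>k. \<phi> k z) \<longlonglongrightarrow> indicator (box a b) z" for z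
  proof -
    have "(\<lambda>k. \<phi> k z) \<longlonglongrightarrow> (if 1 * fst z + (- a1) > 0 then 1 else 0) * (if (-1) * fst z + b1 > 0 then 1 else 0) *
        (if 1 * snd z + (- a2) > 0 then 1 else 0) * (if (-1) * snd z + b2 > 0 then 1 else 0)"
      (is "_ \<longlonglongrightarrow> ?l")
      unfolding \<phi>_def st_def by (intro tendsto_mult smooth_step_tendsto)
    moreover have "?l = indicator (box a b) z"
      by (cases z) (auto simp: ab box_def Basis_prod_def indicator_def)
    ultimately show ?thesis by simp
  qed
  moreover have "\<phi> k \<in> test_functions" for k
  proof -
    \<comment> \<open>The \<open>k\<close>-th function vanishes at distance up to \<open>d\<close> from the sides of the box.\<close>
    define d where "d = 1 / real (Suc k)"
    have zero: "st k s r t = 0" if "s * t + r \<le> d" for s r t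
    proof -
      have "real (Suc k) * (s * t + r) \<le> real (Suc k) * d"
        using that by (intro mult_left_mono) auto
      then show ?thesis
        by (simp add: st_def smooth_step_eq_0_iff d_def algebra_simps del: of_nat_Suc)
    qed
    let ?K = "cbox (a1 + d, a2 + d) (b1 - d, b2 - d)"
    have "d > 0" by (simp add: d_def)
    then have "?K \<subseteq> box a b"
      by (auto simp: ab box_def cbox_def Basis_prod_def)
    then have "?K \<subseteq> unit_square" using assms by blast
    moreover have "\<phi> k z = 0" if "z \<notin> ?K" for z
    proof -
      have "1 * fst z + - a1 \<le> d \<or> (-1) * fst z + b1 \<le> d \<or> 1 * snd z + - a2 \<le> d \<or> (-1) * snd z + b2 \<le> d"
        using that by (cases z) (auto simp: cbox_def Basis_prod_def)
      then show ?thesis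
        unfolding \<phi>_def using zero by (metis mult_zero_left mult_zero_right)
    qed
    moreover have "C_k m (\<phi> k)" for m
      unfolding \<phi>_def st_def by (intro C_k_mult C_k_smooth_step)
    ultimately show ?thesis
      unfolding test_functions_def
      by (intro CollectI conjI allI exI[of _ ?K] impI compact_cbox)
  qed
  ultimately show ?thesis by blast
qed

section \<open>Integration by parts\<close>
lemma continuous_L2_D:
  fixes g :: "real \<times> real \<Rightarrow> 'b::euclidean_space"
  assumes "continuous_on UNIV g"
  shows "g \<in> L2_D"
proof -
  have "compact (g ` cbox (0, 0) (1, 1))"
    using assms by (intro compact_continuous_image) (auto intro: continuous_on_subset)
  then obtain B where B: "\<And>z. z \<in> cbox (0, 0) (1, 1) \<Longrightarrow> norm (g z) \<le> B"
    using compact_imp_bounded bounded_iff by (metis imageI)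
  have "g \<in> borel_measurable lborel"
    using borel_measurable_continuous_onI[OF assms] by simp
  then have "g \<in> borel_measurable leb_D"
    by (intro measurable_restrict_space1 measurable_completion)
  then show ?thesis
  proof (rule L2_D_bound)
    show "AE z in leb_D. (norm (g z))\<^sup>2 \<le> B\<^sup>2"
    proof (rule AE_I2)
      fix z assume "z \<in> space leb_D"
      then have "z \<in> cbox (0, 0) (1, 1)"
        using box_subset_cbox unfolding unit_square_eq_box by auto
      then show "(norm (g z))\<^sup>2 \<le> B\<^sup>2"
        using B by (intro power_mono) auto
    qed
  qed simp
qed

text \<open>Fubini's theorem reduces this to the fundamental theorem of calculus on the lines parallel to an axis: on each
  of them \<open>\<psi>\<close> vanishes at both ends of the square.\<close>

lemma integral_partial_derivatives_eq_0:
  fixes \<psi> px py :: "real \<times> real \<Rightarrow> real"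
  assumes der: "\<And>z. (\<psi> has_derivative (\<lambda>d. fst d * px z + snd d * py z)) (at z)"
    and cont: "continuous_on UNIV px" "continuous_on UNIV py"
    and K: "compact K" "K \<subseteq> unit_square" "\<And>z. z \<notin> K \<Longrightarrow> \<psi> z = 0"
  shows "(LINT z|leb_D. px z) = 0" "(LINT z|leb_D. py z) = 0"
proof -
  have zero: "px z = 0 \<and> py z = 0" if "z \<notin> K" for z
  proof -
    have "((\<lambda>_. 0) has_derivative (\<lambda>d. fst d * px z + snd d * py z)) (at z)"
      by (rule has_derivative_transform_within_open[OF der open_Compl[OF compact_imp_closed[OF K(1)]]])
        (use K(3) that in auto)
    then have "(\<lambda>d. fst d * px z + snd d * py z) = (\<lambda>d. 0)"
      using has_derivative_unique has_derivative_const by blast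
    from fun_cong[OF this, of "(1, 0)"] fun_cong[OF this, of "(0, 1)"] show ?thesis by simp
  qed
  \<comment> \<open>Functions supported in \<open>K\<close> have the same integral over the square and over the plane.\<close>
  have to_plane: "(LINT z|leb_D. g z) = (LINT z|(lborel \<Otimes>\<^sub>M lborel). g z)"
      "integrable (lborel \<Otimes>\<^sub>M lborel) g"
    if "continuous_on UNIV g" "\<And>z. z \<notin> K \<Longrightarrow> g z = 0" for g :: "real \<times> real \<Rightarrow> real"
  proof -
    have [measurable]: "g \<in> borel_measurable borel"
      using borel_measurable_continuous_onI[OF that(1)] .
    have "(LINT z|leb_D. g z) = (LINT z|lebesgue. indicator unit_square z *\<^sub>R g z)"
      by (subst integral_restrict_space) auto
    also have "(\<lambda>z. indicator unit_square z *\<^sub>R g z) = g"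
      using that(2) K(2) by (auto simp: indicator_def fun_eq_iff)
    also have "(LINT z|lebesgue. g z) = (LINT z|lborel. g z)"
      by (rule integral_completion) auto
    finally show "(LINT z|leb_D. g z) = (LINT z|(lborel \<Otimes>\<^sub>M lborel). g z)"
      by (simp add: lborel_prod)
    have "integrable lborel (\<lambda>z. indicator K z *\<^sub>R g z)"
      by (intro borel_integrable_compact[OF K(1)] continuous_on_subset[OF that(1)]) simp
    also have "(\<lambda>z. indicator K z *\<^sub>R g z) = g"
      using that(2) by (auto simp: indicator_def fun_eq_iff)
    finally show "integrable (lborel \<Otimes>\<^sub>M lborel) g"
      by (simp add: lborel_prod)
  qed
  have out: "(x, y) \<notin> K" if "x \<le> 0 \<or> x \<ge> 1 \<or> y \<le> 0 \<or> y \<ge> 1" for x y :: real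
    using that K(2) by (auto simp: unit_square_def)
  have "px (x, y) = px (x, y) * indicator {0..1} x" "py (x, y) = py (x, y) * indicator {0..1} y"
    for x y
  proof -
    have "x \<notin> {0..1} \<or> y \<notin> {0..1} \<Longrightarrow> (x, y) \<notin> K"
      using out[of x y] by auto
    then show "px (x, y) = px (x, y) * indicator {0..1} x" "py (x, y) = py (x, y) * indicator {0..1} y"
      using zero by (auto simp: indicator_def)
  qed
  note cut = this
  have "(LINT x|lborel. px (x, y)) = 0" for y
  proof -
    have "(LINT x|lborel. px (x, y)) = (LINT x|lborel. px (x, y) * indicator {0..1} x)"
      by (intro Bochner_Integration.integral_cong refl cut)
    also have "\<dots> = \<psi> (1, y) - \<psi> (0, y)"
    proof (rule integral_FTC_Icc_real)
      fix x :: real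
      have "((\<lambda>x. (x, y)) has_derivative (\<lambda>d. (d, 0))) (at x)"
        by (auto intro!: derivative_eq_intros)
      from has_derivative_compose[OF this der]
      show "((\<lambda>x. \<psi> (x, y)) has_real_derivative px (x, y)) (at x)"
        by (simp add: has_field_derivative_def mult_commute_abs)
      show "isCont (\<lambda>x. px (x, y)) x"
        using cont(1) by (intro continuous_on_interior[of UNIV] continuous_on_compose2[OF cont(1)] continuous_intros) auto
    qed simp
    also have "\<dots> = 0" using out K(3) by simp
    finally show ?thesis .
  qed
  then show "(LINT z|leb_D. px z) = 0"
    using lborel_pair.integral_snd[of "\<lambda>x y. px (x, y)"] to_plane[of px] cont zero by simp
  have "(LINT y|lborel. py (x, y)) = 0" for x
  proof -
    have "(LINT y|lborel. py (x, y)) = (LINT y|lborel. py (x, y) * indicator {0..1} y)"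
      by (intro Bochner_Integration.integral_cong refl cut)
    also have "\<dots> = \<psi> (x, 1) - \<psi> (x, 0)"
    proof (rule integral_FTC_Icc_real)
      fix y :: real
      have "((\<lambda>y. (x, y)) has_derivative (\<lambda>d. (0, d))) (at y)"
        by (auto intro!: derivative_eq_intros)
      from has_derivative_compose[OF this der]
      show "((\<lambda>y. \<psi> (x, y)) has_real_derivative py (x, y)) (at y)"
        by (simp add: has_field_derivative_def mult_commute_abs)
      show "isCont (\<lambda>y. py (x, y)) y"
        by (intro continuous_on_interior[of UNIV] continuous_on_compose2[OF cont(2)] continuous_intros) auto
    qed simp
    also have "\<dots> = 0" using out K(3) by simp
    finally show ?thesis .
  qed
  then show "(LINT z|leb_D. py z) = 0"
    using lborel_pair.integral_fst'[of py] to_plane[of py] cont zero by simp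
qed

section \<open>The fundamental lemma of the calculus of variations\<close>

text \<open>Approximating indicators by test functions shows that \<open>h\<close> integrates to \<open>0\<close> over every box in the square.
  Boxes are stable under intersection and generate the Borel sets, so \<open>h\<close> integrates to \<open>0\<close> over every
  Borel subset of the square.\<close>

lemma fundamental_lemma:
  fixes h :: "real \<times> real \<Rightarrow> real"
  assumes h: "integrable leb_D h"
    and orth: "\<And>\<phi>. \<phi> \<in> test_functions \<Longrightarrow> (LINT z|leb_D. h z * \<phi> z) = 0"
  shows "AE z in leb_D. h z = 0"
proof -
  have [measurable]: "h \<in> borel_measurable leb_D" using h by auto
  have box0: "(LINT z|leb_D. h z * indicator (box a b) z) = 0" if sub: "box a b \<subseteq> unit_square" for a b
  proof -
    obtain \<phi> where \<phi>: "\<And>k::nat. \<phi> k \<in> test_functions" "\<And>k z. 0 \<le> \<phi> k z \<and> \<phi> k z \<le> 1"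
        "\<And>z. (\<lambda>k. \<phi> k z) \<longlonglongrightarrow> indicator (box a b) z"
      using box_indicator_approximation[OF sub] by blast
    have [measurable]: "\<phi> k \<in> borel_measurable leb_D" for k
    proof -
      have "C_k 0 (\<phi> k)" using \<phi>(1)[of k] unfolding test_functions_def by blast
      then have "\<phi> k \<in> borel_measurable lborel"
        using borel_measurable_continuous_onI by simp
      then show ?thesis by (intro measurable_restrict_space1 measurable_completion)
    qed
    have "(\<lambda>k. LINT z|leb_D. h z * \<phi> k z) \<longlonglongrightarrow> (LINT z|leb_D. h z * indicator (box a b) z)"
    proof (rule integral_dominated_convergence[where w = "\<lambda>z. norm (h z)"])
      show "AE z in leb_D. norm (h z * \<phi> k z) \<le> norm (h z)" for k
        using \<phi>(2) by (intro AE_I2) (simp add: abs_mult mult_left_le)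
      show "AE z in leb_D. (\<lambda>k. h z * \<phi> k z) \<longlonglongrightarrow> h z * indicator (box a b) z"
        using \<phi>(3) by (intro AE_I2 tendsto_mult_left)
      have "indicator (box a b) \<in> borel_measurable (lborel :: (real \<times> real) measure)" by simp
      then have "(indicator (box a b) :: _ \<Rightarrow> real) \<in> borel_measurable leb_D"
        by (intro measurable_restrict_space1 measurable_completion)
      then show "(\<lambda>z. h z * indicator (box a b) z) \<in> borel_measurable leb_D"
        by measurable
    qed (use h in auto)
    then show ?thesis
      using orth[OF \<phi>(1)] by (simp add: LIMSEQ_const_iff)
  qed
  \<comment> \<open>Extend \<open>h\<close> by zero to the plane, and pass to a Borel measurable version \<open>h'\<close>, for which it suffices to
    look at Borel sets.\<close>
  define H where "H z = indicator unit_square z *\<^sub>R h z" for z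
  have H: "integrable lebesgue H"
    using h unfolding H_def by (subst (asm) integrable_restrict_space) auto
  then obtain h' where h'[measurable]: "h' \<in> borel_measurable lborel" and eq: "AE z in lborel. H z = h' z"
    using completion_ex_borel_measurable_real[of H lborel] by auto
  have eq': "AE z in lebesgue. H z = h' z"
    using eq by (rule AE_completion)
  have "integrable lebesgue h'"
    using H eq' h' by (subst integrable_cong_AE[of _ _ H]) (auto intro: measurable_completion)
  then have int: "integrable lborel h'"
    using integrable_completion[OF h'] by simp
  have transfer: "(LINT z:A|lborel. h' z) = (LINT z|leb_D. h z * indicator A z)" if [measurable]: "A \<in> sets borel" for A
  proof -
    have m: "(indicator A :: _ \<Rightarrow> real) \<in> borel_measurable lebesgue"
      by (intro measurable_completion) simp
    have "(LINT z:A|lborel. h' z) = (LINT z|lebesgue. indicator A z *\<^sub>R h' z)"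
      unfolding set_lebesgue_integral_def by (rule integral_completion[symmetric]) simp
    also have "\<dots> = (LINT z|lebesgue. indicator A z *\<^sub>R H z)"
    proof (rule integral_cong_AE)
      show "(\<lambda>z. indicator A z *\<^sub>R h' z) \<in> borel_measurable lebesgue"
        using h' m by (intro borel_measurable_scaleR measurable_completion) auto
      show "AE z in lebesgue. indicator A z *\<^sub>R h' z = indicator A z *\<^sub>R H z"
        using eq' by eventually_elim simp
    qed (use H m in auto)
    also have "\<dots> = (LINT z|lebesgue. indicator unit_square z *\<^sub>R (h z * indicator A z))"
      by (intro Bochner_Integration.integral_cong) (auto simp: H_def)
    also have "\<dots> = (LINT z|leb_D. h z * indicator A z)"
      by (subst integral_restrict_space) auto
    finally show ?thesis .
  qed
  have "(LINT z:A|lborel. h' z) = 0" if "A \<in> sets borel" for A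
  proof -
    let ?G = "range (\<lambda>(a, b). box a b) :: (real \<times> real) set set"
    have "Int_stable ?G"
      by (auto simp: Int_stable_def box_Int_box)
    moreover have "?G \<subseteq> Pow UNIV" by simp
    moreover have "A \<in> sigma_sets UNIV ?G"
      using that by (simp add: borel_eq_box)
    ultimately show ?thesis
    proof (induction rule: sigma_sets_induct_disjoint)
      case (basic A)
      then obtain a b where "A = box a b" by auto
      have "\<exists>c d. A \<inter> unit_square = box c d"
        unfolding \<open>A = box a b\<close> unit_square_eq_box box_Int_box by blast
      then obtain c d where cd: "A \<inter> unit_square = box c d" by blast
      have "(LINT z:A|lborel. h' z) = (LINT z|leb_D. h z * indicator A z)"
        using \<open>A = box a b\<close> by (intro transfer) simp
      also have "\<dots> = (LINT z|leb_D. h z * indicator (box c d) z)"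
        unfolding cd[symmetric] by (intro Bochner_Integration.integral_cong) (auto simp: indicator_def)
      also have "\<dots> = 0"
        by (rule box0) (use cd in blast)
      finally show ?case .
    next
      case empty
      then show ?case by (simp add: set_lebesgue_integral_def)
    next
      case (compl A)
      have A: "A \<in> sets borel"
        using compl(1) by (simp add: borel_eq_box)
      have "(LINT z:UNIV|lborel. h' z) = (LINT z:A|lborel. h' z) + (LINT z:UNIV - A|lborel. h' z)"
      proof -
        have "set_integrable lborel B h'" if "B \<in> sets borel" for B
          unfolding set_integrable_def using that int by (intro integrable_mult_indicator) auto
        moreover have "UNIV - A \<in> sets borel" using A by auto
        ultimately show ?thesis
          using set_integral_Un[of A "UNIV - A" lborel h'] A by simp
      qed
      moreover have "(LINT z:UNIV|lborel. h' z) = 0"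
        using transfer[of UNIV] box0[of "(0, 0)" "(1, 1)"]
          Bochner_Integration.integral_cong[of leb_D leb_D "\<lambda>z. h z * indicator UNIV z" "\<lambda>z. h z * indicator unit_square z"]
        by (simp add: unit_square_eq_box)
      ultimately show ?case using compl by simp
    next
      case (union A)
      have A: "A i \<in> sets lborel" for i
        using union(2) by (auto simp: borel_eq_box)
      have "(LINT z:(\<Union>i. A i)|lborel. h' z) = (\<Sum>i. (LINT z:A i|lborel. h' z))"
      proof (rule lebesgue_integral_countable_add)
        show "A i \<inter> A j = {}" if "i \<noteq> j" for i j
          using union(1) that by (auto simp: disjoint_family_on_def)
        have "(\<Union>i. A i) \<in> sets lborel" using A by blast
        then show "set_integrable lborel (\<Union>i. A i) h'"
          using int unfolding set_integrable_def by (rule integrable_mult_indicator)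
      qed (rule A)
      then show ?case using union by simp
    qed
  qed
  then have "AE z in lborel. h' z = 0"
    using density_unique_real[OF int, of "\<lambda>_. 0"] by (simp add: set_lebesgue_integral_def)
  with eq have "AE z in lborel. H z = 0"
    by eventually_elim simp
  then have "AE z in lebesgue. H z = 0" by (rule AE_completion)
  then show ?thesis
    by (subst AE_restrict_space_iff) (auto simp: H_def elim!: eventually_mono)
qed

section \<open>Weak gradients\<close>

definition classical_grad :: "(real \<times> real \<Rightarrow> real) \<Rightarrow> real \<times> real \<Rightarrow> real \<times> real" where
  "classical_grad \<phi> z = (frechet_derivative \<phi> (at z) (1, 0), frechet_derivative \<phi> (at z) (0, 1))"

lemma test_function_derivative:
  assumes "\<phi> \<in> test_functions"
  shows "(\<phi> has_derivative (\<lambda>d. fst d * fst (classical_grad \<phi> z) + snd d * snd (classical_grad \<phi> z))) (at z)"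
    and "continuous_on UNIV (\<lambda>z. fst (classical_grad \<phi> z))"
    and "continuous_on UNIV (\<lambda>z. snd (classical_grad \<phi> z))"
    and "continuous_on UNIV \<phi>"
proof -
  have "C_k (Suc 0) \<phi>" using assms unfolding test_functions_def by blast
  then obtain fx fy where der: "\<And>z. (\<phi> has_derivative (\<lambda>d. fst d * fx z + snd d * fy z)) (at z)"
    and cont: "continuous_on UNIV fx" "continuous_on UNIV fy"
    by auto
  have "frechet_derivative \<phi> (at z) = (\<lambda>d. fst d * fx z + snd d * fy z)" for z
    using frechet_derivative_at[OF der[of z]] by simp
  then have "classical_grad \<phi> z = (fx z, fy z)" for z
    by (simp add: classical_grad_def)
  then show "(\<phi> has_derivative (\<lambda>d. fst d * fst (classical_grad \<phi> z) + snd d * snd (classical_grad \<phi> z))) (at z)"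
    "continuous_on UNIV (\<lambda>z. fst (classical_grad \<phi> z))"
    "continuous_on UNIV (\<lambda>z. snd (classical_grad \<phi> z))"
    using der cont by simp_all
  have "C_k 0 \<phi>" using assms unfolding test_functions_def by blast
  then show "continuous_on UNIV \<phi>" by simp
qed

lemma classical_grad_continuous:
  "\<phi> \<in> test_functions \<Longrightarrow> continuous_on UNIV (classical_grad \<phi>)"
  using continuous_on_Pair[OF test_function_derivative(2,3), of \<phi> \<phi>] by simp

lemma classical_grad_L2_D: "\<phi> \<in> test_functions \<Longrightarrow> classical_grad \<phi> \<in> L2_D"
  by (rule continuous_L2_D[OF classical_grad_continuous])

lemma test_function_L2_D: "\<phi> \<in> test_functions \<Longrightarrow> \<phi> \<in> L2_D"
  by (rule continuous_L2_D[OF test_function_derivative(4)])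

lemma test_function_support:
  assumes "\<phi> \<in> test_functions"
  obtains K where "compact K" "K \<subseteq> unit_square" "\<And>z. z \<notin> K \<Longrightarrow> \<phi> z = 0"
  using assms unfolding test_functions_def by blast

lemma Basis_plane: "Basis = {(1, 0), (0, 1) :: real \<times> real}"
  by (auto simp: Basis_prod_def)

lemma frechet_derivative_classical_grad:
  "i \<in> Basis \<Longrightarrow> frechet_derivative \<phi> (at z) i = classical_grad \<phi> z \<bullet> i"
  by (auto simp: Basis_plane classical_grad_def)

text \<open>Integration by parts is the vanishing of the integrals of the partial derivatives of the product \<open>p \<phi>\<close>.\<close>

lemma weak_gradient_classical_grad:
  assumes "p \<in> test_functions"
  shows "weak_gradient p (classical_grad p)"
  unfolding weak_gradient_def
proof (intro conjI ballI)
  show "classical_grad p \<in> L2_D" by (rule classical_grad_L2_D[OF assms])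
  fix \<phi> :: "real \<times> real \<Rightarrow> real" and i :: "real \<times> real"
  assume phi: "\<phi> \<in> test_functions" and i: "i \<in> Basis"
  let ?p = "classical_grad p" and ?q = "classical_grad \<phi>"
  obtain K where K: "compact K" "K \<subseteq> unit_square" "\<And>z. z \<notin> K \<Longrightarrow> p z = 0"
    using test_function_support[OF assms] by blast
  have der: "((\<lambda>z. p z * \<phi> z) has_derivative (\<lambda>d. fst d * (fst (?p z) * \<phi> z + p z * fst (?q z)) +
      snd d * (snd (?p z) * \<phi> z + p z * snd (?q z)))) (at z)" for z
    by (rule has_derivative_eq_rhs[OF has_derivative_mult[OF test_function_derivative(1)[OF assms]
            test_function_derivative(1)[OF phi]]]) (auto simp: algebra_simps)
  note cont = test_function_derivative(2-4)[OF assms] test_function_derivative(2-4)[OF phi]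
  have zero: "(LINT z|leb_D. fst (?p z) * \<phi> z + p z * fst (?q z)) = 0"
      "(LINT z|leb_D. snd (?p z) * \<phi> z + p z * snd (?q z)) = 0"
    by (rule integral_partial_derivatives_eq_0[OF der _ _ K(1,2)];
        (intro continuous_intros cont)?; simp add: K(3))+
  have "(LINT z|leb_D. (?p z \<bullet> i) * \<phi> z + p z * (?q z \<bullet> i)) = 0"
    using i zero by (auto simp: Basis_plane inner_prod_def)
  moreover have "integrable leb_D (\<lambda>z. (?p z \<bullet> i) * \<phi> z)" "integrable leb_D (\<lambda>z. p z * (?q z \<bullet> i))"
    by (intro L2_D_integrable continuous_L2_D continuous_intros cont
        classical_grad_continuous assms phi)+
  ultimately show "(LINT z|leb_D. p z * frechet_derivative \<phi> (at z) i) = - (LINT z|leb_D. (?p z \<bullet> i) * \<phi> z)"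
    by (simp add: frechet_derivative_classical_grad[OF i])
qed

lemma weak_gradientD:
  assumes "weak_gradient p g" "\<phi> \<in> test_functions" "i \<in> Basis"
  shows "(LINT z|leb_D. p z * (classical_grad \<phi> z \<bullet> i)) = - (LINT z|leb_D. (g z \<bullet> i) * \<phi> z)"
proof -
  have "(LINT z|leb_D. p z * frechet_derivative \<phi> (at z) i) = - (LINT z|leb_D. (g z \<bullet> i) * \<phi> z)"
    using assms unfolding weak_gradient_def by blast
  then show ?thesis by (simp add: frechet_derivative_classical_grad[OF assms(3)])
qed

text \<open>The function \<open>grad p\<close> is an arbitrary choice among the weak gradients of \<open>p\<close>.  Uniqueness lets it be
  replaced by any weak gradient that is at hand, and makes it linear in \<open>p\<close> almost everywhere.\<close>

lemma weak_gradient_AE_unique: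
  assumes "weak_gradient p g" "weak_gradient p h"
  shows "AE z in leb_D. g z = h z"
proof -
  have L2: "g \<in> L2_D" "h \<in> L2_D" using assms by (simp_all add: weak_gradient_def)
  have "AE z in leb_D. (g z - h z) \<bullet> i = 0" if i: "i \<in> Basis" for i
  proof (rule fundamental_lemma)
    note int = L2_D_integrable[OF L2(1)] L2_D_integrable[OF L2(2)]
    then show "integrable leb_D (\<lambda>z. (g z - h z) \<bullet> i)"
      by (intro integrable_inner_left Bochner_Integration.integrable_diff) auto
    fix \<phi> assume phi: "\<phi> \<in> test_functions"
    have *: "(\<lambda>z. \<phi> z *\<^sub>R i) \<in> L2_D"
      using test_function_derivative(4)[OF phi] by (intro continuous_L2_D continuous_intros)
    have int: "integrable leb_D (\<lambda>z. (g z \<bullet> i) * \<phi> z)" "integrable leb_D (\<lambda>z. (h z \<bullet> i) * \<phi> z)"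
      using L2_D_inner_integrable[OF L2(1) *] L2_D_inner_integrable[OF L2(2) *]
      by (simp_all add: mult.commute)
    have "(LINT z|leb_D. (g z \<bullet> i) * \<phi> z) = (LINT z|leb_D. (h z \<bullet> i) * \<phi> z)"
      using weak_gradientD[OF assms(1) phi i] weak_gradientD[OF assms(2) phi i] by simp
    then show "(LINT z|leb_D. ((g z - h z) \<bullet> i) * \<phi> z) = 0"
      using int by (simp add: inner_diff_left left_diff_distrib)
  qed
  then have "AE z in leb_D. \<forall>i\<in>Basis. (g z - h z) \<bullet> i = 0"
    by (simp add: AE_finite_all)
  then show ?thesis
    by eventually_elim (metis euclidean_all_zero_iff right_minus_eq)
qed

lemma weak_gradient_combination:
  assumes "p \<in> L2_D" "q \<in> L2_D" "weak_gradient p g" "weak_gradient q h"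
  shows "weak_gradient (\<lambda>z. s * p z + t * q z) (\<lambda>z. s *\<^sub>R g z + t *\<^sub>R h z)"
  unfolding weak_gradient_def
proof (intro conjI ballI)
  have L2: "g \<in> L2_D" "h \<in> L2_D" using assms by (simp_all add: weak_gradient_def)
  then show "(\<lambda>z. s *\<^sub>R g z + t *\<^sub>R h z) \<in> L2_D" by (rule L2_D_combination)
  fix \<phi> :: "real \<times> real \<Rightarrow> real" and i :: "real \<times> real"
  assume phi: "\<phi> \<in> test_functions" and i: "i \<in> Basis"
  have 1: "(\<lambda>z. \<phi> z *\<^sub>R i) \<in> L2_D"
    using test_function_derivative(4)[OF phi] by (intro continuous_L2_D continuous_intros)
  have 2: "(\<lambda>z. classical_grad \<phi> z \<bullet> i) \<in> L2_D"
    using classical_grad_continuous[OF phi] by (intro continuous_L2_D continuous_intros)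
  note int = L2_D_inner_integrable[OF L2(1) 1] L2_D_inner_integrable[OF L2(2) 1]
    L2_D_inner_integrable[OF assms(1) 2] L2_D_inner_integrable[OF assms(2) 2]
  have eq: "(LINT z|leb_D. p z * (classical_grad \<phi> z \<bullet> i)) = - (LINT z|leb_D. (g z \<bullet> i) * \<phi> z)"
      "(LINT z|leb_D. q z * (classical_grad \<phi> z \<bullet> i)) = - (LINT z|leb_D. (h z \<bullet> i) * \<phi> z)"
    by (rule weak_gradientD[OF assms(3) phi i], rule weak_gradientD[OF assms(4) phi i])
  have "(LINT z|leb_D. (s * p z + t * q z) * (classical_grad \<phi> z \<bullet> i)) =
      s * (LINT z|leb_D. p z * (classical_grad \<phi> z \<bullet> i)) + t * (LINT z|leb_D. q z * (classical_grad \<phi> z \<bullet> i))"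
    using int(3,4) by (simp add: distrib_right mult.assoc)
  also have "\<dots> = - (LINT z|leb_D. ((s *\<^sub>R g z + t *\<^sub>R h z) \<bullet> i) * \<phi> z)"
    using int(1,2) unfolding eq by (simp add: inner_add_left distrib_right mult.assoc mult.commute[of "\<phi> _"])
  finally show "(LINT z|leb_D. (s * p z + t * q z) * frechet_derivative \<phi> (at z) i) =
      - (LINT z|leb_D. ((s *\<^sub>R g z + t *\<^sub>R h z) \<bullet> i) * \<phi> z)"
    by (simp add: frechet_derivative_classical_grad[OF i])
qed

section \<open>The space \<open>V\<close>\<close>

lemma test_functions_combination:
  assumes "\<phi> \<in> test_functions" "\<psi> \<in> test_functions"
  shows "(\<lambda>z. s * \<phi> z + t * \<psi> z) \<in> test_functions"
    and "classical_grad (\<lambda>z. s * \<phi> z + t * \<psi> z) = (\<lambda>z. s *\<^sub>R classical_grad \<phi> z + t *\<^sub>R classical_grad \<psi> z)"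
proof -
  obtain K where K: "compact K" "K \<subseteq> unit_square" "\<And>z. z \<notin> K \<Longrightarrow> \<phi> z = 0"
    using test_function_support[OF assms(1)] by blast
  obtain L where L: "compact L" "L \<subseteq> unit_square" "\<And>z. z \<notin> L \<Longrightarrow> \<psi> z = 0"
    using test_function_support[OF assms(2)] by blast
  have "C_k k (\<lambda>z. s * \<phi> z + t * \<psi> z)" for k
    using assms by (intro C_k_add C_k_mult C_k_const) (auto simp: test_functions_def)
  then show test: "(\<lambda>z. s * \<phi> z + t * \<psi> z) \<in> test_functions"
    using K L unfolding test_functions_def
    by (intro CollectI conjI allI exI[of _ "K \<union> L"]) auto
  show "classical_grad (\<lambda>z. s * \<phi> z + t * \<psi> z) = (\<lambda>z. s *\<^sub>R classical_grad \<phi> z + t *\<^sub>R classical_grad \<psi> z)"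
  proof
    fix z
    let ?c = "\<lambda>z. s * \<phi> z + t * \<psi> z" and ?g = "s *\<^sub>R classical_grad \<phi> z + t *\<^sub>R classical_grad \<psi> z"
    have "(?c has_derivative (\<lambda>d. fst d * fst ?g + snd d * snd ?g)) (at z)"
      by (rule has_derivative_eq_rhs[OF has_derivative_add[OF
              has_derivative_mult_right[OF test_function_derivative(1)[OF assms(1)]]
              has_derivative_mult_right[OF test_function_derivative(1)[OF assms(2)]]]])
        (auto simp: algebra_simps)
    then have "frechet_derivative ?c (at z) = (\<lambda>d. fst d * fst ?g + snd d * snd ?g)"
      by (rule frechet_derivative_at[symmetric])
    then show "classical_grad ?c z = ?g"
      unfolding classical_grad_def[of ?c] by (simp add: prod_eq_iff)
  qed
qed

text \<open>The closure in \<open>L\<^sup>2 \<times> L\<^sup>2\<close> of the pairs \<open>(\<phi>, \<nabla>\<phi>)\<close> with a test function \<open>\<phi>\<close>.  Up to the choice of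
  representatives this is the graph of the gradient on \<open>V\<close> (\<open>V_graph_imp_V\<close> and \<open>V_graph_grad\<close>);
  carrying the gradient along makes limits explicit where \<open>H1_norm\<close> hides a choice.\<close>

definition V_graph :: "(real \<times> real \<Rightarrow> real) \<Rightarrow> (real \<times> real \<Rightarrow> real \<times> real) \<Rightarrow> bool" where
  "V_graph p g \<longleftrightarrow> p \<in> L2_D \<and> g \<in> L2_D \<and> (\<exists>\<phi>. (\<forall>k::nat. \<phi> k \<in> test_functions) \<and>
     (\<lambda>k. L2_norm_D (\<lambda>z. p z - \<phi> k z)) \<longlonglongrightarrow> 0 \<and>
     (\<lambda>k. L2_norm_D (\<lambda>z. g z - classical_grad (\<phi> k) z)) \<longlonglongrightarrow> 0)"

lemma V_graphE:
  assumes "V_graph p g"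
  obtains \<phi> where "\<And>k::nat. \<phi> k \<in> test_functions"
    "(\<lambda>k. L2_norm_D (\<lambda>z. p z - \<phi> k z)) \<longlonglongrightarrow> 0"
    "(\<lambda>k. L2_norm_D (\<lambda>z. g z - classical_grad (\<phi> k) z)) \<longlonglongrightarrow> 0"
    "p \<in> L2_D" "g \<in> L2_D"
  using assms unfolding V_graph_def by blast

lemma V_graph_test_function:
  "\<phi> \<in> test_functions \<Longrightarrow> V_graph \<phi> (classical_grad \<phi>)"
  unfolding V_graph_def
  by (intro conjI test_function_L2_D classical_grad_L2_D exI[of _ "\<lambda>_. \<phi>"]) (auto simp: L2_norm_D_def)

lemma V_graph_combination:
  assumes "V_graph p g" "V_graph q h"
  shows "V_graph (\<lambda>z. s * p z + t * q z) (\<lambda>z. s *\<^sub>R g z + t *\<^sub>R h z)"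
proof -
  have le: "L2_norm_D (\<lambda>z. s *\<^sub>R f1 z + t *\<^sub>R f2 z) \<le> \<bar>s\<bar> * L2_norm_D f1 + \<bar>t\<bar> * L2_norm_D f2"
    if "f1 \<in> L2_D" "f2 \<in> L2_D" for f1 f2 :: "real \<times> real \<Rightarrow> 'a::euclidean_space"
    using L2_triangle[OF L2_D_scaleR[OF that(1)] L2_D_scaleR[OF that(2)]]
    by (simp add: L2_norm_D_scaleR)
  obtain \<phi> where \<phi>: "\<And>k::nat. \<phi> k \<in> test_functions" "(\<lambda>k. L2_norm_D (\<lambda>z. p z - \<phi> k z)) \<longlonglongrightarrow> 0"
    "(\<lambda>k. L2_norm_D (\<lambda>z. g z - classical_grad (\<phi> k) z)) \<longlonglongrightarrow> 0" "p \<in> L2_D" "g \<in> L2_D"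
    using V_graphE[OF assms(1)] by blast
  obtain \<psi> where \<psi>: "\<And>k::nat. \<psi> k \<in> test_functions" "(\<lambda>k. L2_norm_D (\<lambda>z. q z - \<psi> k z)) \<longlonglongrightarrow> 0"
    "(\<lambda>k. L2_norm_D (\<lambda>z. h z - classical_grad (\<psi> k) z)) \<longlonglongrightarrow> 0" "q \<in> L2_D" "h \<in> L2_D"
    using V_graphE[OF assms(2)] by blast
  define \<theta> where "\<theta> k z = s * \<phi> k z + t * \<psi> k z" for k z
  have \<theta>: "\<theta> k \<in> test_functions"
      "classical_grad (\<theta> k) = (\<lambda>z. s *\<^sub>R classical_grad (\<phi> k) z + t *\<^sub>R classical_grad (\<psi> k) z)" for k
    unfolding \<theta>_def using test_functions_combination[OF \<phi>(1) \<psi>(1)] by auto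
  have lim: "(\<lambda>k. \<bar>s\<bar> * a k + \<bar>t\<bar> * b k) \<longlonglongrightarrow> 0" if "a \<longlonglongrightarrow> 0" "b \<longlonglongrightarrow> 0" for a b :: "nat \<Rightarrow> real"
    using tendsto_add[OF tendsto_mult_right_zero[OF that(1), of "\<bar>s\<bar>"] tendsto_mult_right_zero[OF that(2), of "\<bar>t\<bar>"]]
    by simp
  have "(\<lambda>k. L2_norm_D (\<lambda>z. (s * p z + t * q z) - \<theta> k z)) \<longlonglongrightarrow> 0"
  proof (rule Lim_null_comparison[OF _ lim[OF \<phi>(2) \<psi>(2)]])
    show "\<forall>\<^sub>F k in sequentially. norm (L2_norm_D (\<lambda>z. (s * p z + t * q z) - \<theta> k z)) \<le>
        \<bar>s\<bar> * L2_norm_D (\<lambda>z. p z - \<phi> k z) + \<bar>t\<bar> * L2_norm_D (\<lambda>z. q z - \<psi> k z)"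
      using le[OF L2_D_diff[OF \<phi>(4) test_function_L2_D[OF \<phi>(1)]] L2_D_diff[OF \<psi>(4) test_function_L2_D[OF \<psi>(1)]]]
      by (intro always_eventually allI) (simp add: \<theta>_def algebra_simps)
  qed
  moreover have "(\<lambda>k. L2_norm_D (\<lambda>z. (s *\<^sub>R g z + t *\<^sub>R h z) - classical_grad (\<theta> k) z)) \<longlonglongrightarrow> 0"
  proof (rule Lim_null_comparison[OF _ lim[OF \<phi>(3) \<psi>(3)]])
    show "\<forall>\<^sub>F k in sequentially. norm (L2_norm_D (\<lambda>z. (s *\<^sub>R g z + t *\<^sub>R h z) - classical_grad (\<theta> k) z)) \<le>
        \<bar>s\<bar> * L2_norm_D (\<lambda>z. g z - classical_grad (\<phi> k) z) + \<bar>t\<bar> * L2_norm_D (\<lambda>z. h z - classical_grad (\<psi> k) z)"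
      using le[OF L2_D_diff[OF \<phi>(5) classical_grad_L2_D[OF \<phi>(1)]] L2_D_diff[OF \<psi>(5) classical_grad_L2_D[OF \<psi>(1)]]]
      by (intro always_eventually allI) (simp add: \<theta>(2) algebra_simps)
  qed
  moreover have "(\<lambda>z. s * p z + t * q z) \<in> L2_D"
    using L2_D_combination[OF \<phi>(4) \<psi>(4)] by simp
  ultimately show ?thesis
    unfolding V_graph_def using L2_D_combination[OF \<phi>(5) \<psi>(5)] \<theta>(1) by blast
qed

text \<open>Both sides of the integration by parts formula are continuous for \<open>L\<^sup>2\<close> convergence.\<close>

lemma V_graph_weak_gradient:
  assumes "V_graph p g"
  shows "weak_gradient p g"
  unfolding weak_gradient_def
proof (intro conjI ballI)
  obtain \<phi> where \<phi>: "\<And>k::nat. \<phi> k \<in> test_functions" "(\<lambda>k. L2_norm_D (\<lambda>z. p z - \<phi> k z)) \<longlonglongrightarrow> 0"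
    "(\<lambda>k. L2_norm_D (\<lambda>z. g z - classical_grad (\<phi> k) z)) \<longlonglongrightarrow> 0" "p \<in> L2_D" "g \<in> L2_D"
    using V_graphE[OF assms(1)] by blast
  show "g \<in> L2_D" by fact
  fix \<psi> :: "real \<times> real \<Rightarrow> real" and i :: "real \<times> real"
  assume psi: "\<psi> \<in> test_functions" and i: "i \<in> Basis"
  have 1: "(\<lambda>z. \<psi> z *\<^sub>R i) \<in> L2_D"
    using test_function_derivative(4)[OF psi] by (intro continuous_L2_D continuous_intros)
  have 2: "(\<lambda>z. classical_grad \<psi> z \<bullet> i) \<in> L2_D"
    using classical_grad_continuous[OF psi] by (intro continuous_L2_D continuous_intros)
  have "L2_inner_D (\<phi> k) (\<lambda>z. classical_grad \<psi> z \<bullet> i) = - L2_inner_D (classical_grad (\<phi> k)) (\<lambda>z. \<psi> z *\<^sub>R i)" for k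
    using weak_gradientD[OF weak_gradient_classical_grad[OF \<phi>(1)[of k]] psi i]
    by (simp add: L2_inner_D_def mult.commute)
  moreover have "(\<lambda>k. L2_inner_D (\<phi> k) (\<lambda>z. classical_grad \<psi> z \<bullet> i)) \<longlonglongrightarrow> L2_inner_D p (\<lambda>z. classical_grad \<psi> z \<bullet> i)"
    by (rule L2_inner_D_tendsto[OF test_function_L2_D[OF \<phi>(1)] \<phi>(4) \<phi>(2) 2])
  moreover have "(\<lambda>k. - L2_inner_D (classical_grad (\<phi> k)) (\<lambda>z. \<psi> z *\<^sub>R i)) \<longlonglongrightarrow> - L2_inner_D g (\<lambda>z. \<psi> z *\<^sub>R i)"
    by (intro tendsto_minus L2_inner_D_tendsto[OF classical_grad_L2_D[OF \<phi>(1)] \<phi>(5) \<phi>(3) 1])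
  ultimately have "L2_inner_D p (\<lambda>z. classical_grad \<psi> z \<bullet> i) = - L2_inner_D g (\<lambda>z. \<psi> z *\<^sub>R i)"
    using LIMSEQ_unique by auto
  then show "(LINT z|leb_D. p z * frechet_derivative \<psi> (at z) i) = - (LINT z|leb_D. (g z \<bullet> i) * \<psi> z)"
    by (simp add: L2_inner_D_def frechet_derivative_classical_grad[OF i] mult.commute)
qed

lemma weak_gradient_grad: "weak_gradient p g \<Longrightarrow> weak_gradient p (grad p)"
  unfolding grad_def using someI[of "weak_gradient p"] by blast

lemma grad_AE_eq: "weak_gradient p g \<Longrightarrow> AE z in leb_D. grad p z = g z"
  using weak_gradient_AE_unique weak_gradient_grad by blast

lemma weak_gradient_L2_D: "weak_gradient p g \<Longrightarrow> g \<in> L2_D"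
  by (simp add: weak_gradient_def)

lemma L2_norm_grad: "weak_gradient p g \<Longrightarrow> L2_norm_D (grad p) = L2_norm_D g"
  by (intro L2_norm_D_cong_AE L2_D_measurable grad_AE_eq weak_gradient_L2_D[OF weak_gradient_grad] weak_gradient_L2_D)

lemma V_graph_imp_V:
  assumes "V_graph p g"
  shows "p \<in> V"
proof -
  obtain \<phi> where \<phi>: "\<And>k::nat. \<phi> k \<in> test_functions" "(\<lambda>k. L2_norm_D (\<lambda>z. p z - \<phi> k z)) \<longlonglongrightarrow> 0"
    "(\<lambda>k. L2_norm_D (\<lambda>z. g z - classical_grad (\<phi> k) z)) \<longlonglongrightarrow> 0" "p \<in> L2_D" "g \<in> L2_D"
    using V_graphE[OF assms(1)] by blast
  have "weak_gradient (\<lambda>z. p z - \<phi> k z) (\<lambda>z. g z - classical_grad (\<phi> k) z)" for k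
    using V_graph_weak_gradient[OF V_graph_combination[OF assms V_graph_test_function[OF \<phi>(1)[of k]], of 1 "-1"]] by simp
  then have "H1_norm (\<lambda>z. p z - \<phi> k z) = sqrt ((L2_norm_D (\<lambda>z. p z - \<phi> k z))\<^sup>2 +
      (L2_norm_D (\<lambda>z. g z - classical_grad (\<phi> k) z))\<^sup>2)" for k
    by (simp add: H1_norm_def L2_norm_grad)
  moreover have "(\<lambda>k. sqrt ((L2_norm_D (\<lambda>z. p z - \<phi> k z))\<^sup>2 +
      (L2_norm_D (\<lambda>z. g z - classical_grad (\<phi> k) z))\<^sup>2)) \<longlonglongrightarrow> sqrt (0\<^sup>2 + 0\<^sup>2)"
    by (intro tendsto_intros \<phi>)
  ultimately have "(\<lambda>k. H1_norm (\<lambda>z. p z - \<phi> k z)) \<longlonglongrightarrow> 0"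
    by simp
  moreover have "p \<in> H1"
    using \<phi>(4) V_graph_weak_gradient[OF assms] by (auto simp: H1_def)
  ultimately show ?thesis
    unfolding V_def using \<phi>(1) by blast
qed

lemma V_graph_grad:
  assumes "p \<in> V"
  shows "V_graph p (grad p)"
proof -
  obtain g where p: "p \<in> L2_D" "weak_gradient p g"
    using assms by (auto simp: V_def H1_def)
  note g = weak_gradient_grad[OF p(2)]
  obtain \<phi> where \<phi>: "\<And>k::nat. \<phi> k \<in> test_functions" and lim: "(\<lambda>k. H1_norm (\<lambda>z. p z - \<phi> k z)) \<longlonglongrightarrow> 0"
    using assms by (auto simp: V_def)
  have "weak_gradient (\<lambda>z. p z - \<phi> k z) (\<lambda>z. grad p z - classical_grad (\<phi> k) z)" for k
    using weak_gradient_combination[OF p(1) test_function_L2_D[OF \<phi>] g weak_gradient_classical_grad[OF \<phi>], of 1 "-1"] by simp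
  then have eq: "H1_norm (\<lambda>z. p z - \<phi> k z) = sqrt ((L2_norm_D (\<lambda>z. p z - \<phi> k z))\<^sup>2 +
      (L2_norm_D (\<lambda>z. grad p z - classical_grad (\<phi> k) z))\<^sup>2)" for k
    by (simp add: H1_norm_def L2_norm_grad)
  have "(\<lambda>k. L2_norm_D (\<lambda>z. p z - \<phi> k z)) \<longlonglongrightarrow> 0"
    by (rule Lim_null_comparison[OF _ lim]) (simp add: eq)
  moreover have "(\<lambda>k. L2_norm_D (\<lambda>z. grad p z - classical_grad (\<phi> k) z)) \<longlonglongrightarrow> 0"
    by (rule Lim_null_comparison[OF _ lim]) (simp add: eq)
  ultimately show ?thesis
    unfolding V_graph_def using p(1) weak_gradient_L2_D[OF g] \<phi> by blast
qed

lemma grad_L2_D: "p \<in> V \<Longrightarrow> grad p \<in> L2_D"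
  using V_graph_grad by (simp add: V_graph_def)

lemma V_combination:
  assumes "p \<in> V" "q \<in> V"
  shows "(\<lambda>z. s * p z + t * q z) \<in> V"
    and "AE z in leb_D. grad (\<lambda>z. s * p z + t * q z) z = s *\<^sub>R grad p z + t *\<^sub>R grad q z"
  using V_graph_combination[OF V_graph_grad[OF assms(1)] V_graph_grad[OF assms(2)]]
    V_graph_imp_V grad_AE_eq V_graph_weak_gradient by blast+

text \<open>The derivative of \<open>x \<phi>\<^sup>2\<close> in the first direction, \<open>\<phi>\<^sup>2 + 2 x \<phi> \<partial>\<^sub>x\<phi>\<close>, has integral \<open>0\<close>, and \<open>0 \<le> x \<le> 1\<close> on
  the square.  By Cauchy--Schwarz \<open>\<parallel>\<phi>\<parallel>\<^sup>2 \<le> 2 \<parallel>\<phi>\<parallel> \<parallel>\<nabla>\<phi>\<parallel>\<close>.\<close>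

lemma Poincare_test_function:
  assumes "\<phi> \<in> test_functions"
  shows "L2_norm_D \<phi> \<le> 2 * L2_norm_D (classical_grad \<phi>)"
proof -
  let ?g = "classical_grad \<phi>"
  obtain K where K: "compact K" "K \<subseteq> unit_square" "\<And>z. z \<notin> K \<Longrightarrow> \<phi> z = 0"
    using test_function_support[OF assms] by blast
  note cont = test_function_derivative(2-4)[OF assms]
  have der: "((\<lambda>z. fst z * (\<phi> z * \<phi> z)) has_derivative
      (\<lambda>d. fst d * (\<phi> z * \<phi> z + 2 * (fst z * \<phi> z) * fst (?g z)) + snd d * (2 * (fst z * \<phi> z) * snd (?g z)))) (at z)" for z
    by (rule has_derivative_eq_rhs[OF has_derivative_mult[OF has_derivative_fst[OF has_derivative_ident]
            has_derivative_mult[OF test_function_derivative(1)[OF assms] test_function_derivative(1)[OF assms]]]])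
      (auto simp: algebra_simps)
  have "(LINT z|leb_D. \<phi> z * \<phi> z + 2 * (fst z * \<phi> z) * fst (?g z)) = 0"
    by (rule integral_partial_derivatives_eq_0(1)[OF der _ _ K(1,2)])
      (auto intro!: continuous_intros cont simp: K(3))
  moreover have L2: "\<phi> \<in> L2_D" "(\<lambda>z. fst z * \<phi> z) \<in> L2_D" "(\<lambda>z. fst (?g z)) \<in> L2_D" "?g \<in> L2_D"
    by (intro continuous_L2_D continuous_intros cont classical_grad_continuous assms)+
  ultimately have "(L2_norm_D \<phi>)\<^sup>2 + 2 * L2_inner_D (\<lambda>z. fst z * \<phi> z) (\<lambda>z. fst (?g z)) = 0"
    using L2_D_inner_integrable[OF L2(1,1)] L2_D_inner_integrable[OF L2(2,3)]
    by (simp add: L2_norm_D_square L2_inner_D_def mult.assoc)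
  then have "(L2_norm_D \<phi>)\<^sup>2 \<le> 2 * (L2_norm_D (\<lambda>z. fst z * \<phi> z) * L2_norm_D (\<lambda>z. fst (?g z)))"
    using L2_Cauchy_Schwarz[OF L2(2,3)] by linarith
  also have "\<dots> \<le> 2 * (L2_norm_D \<phi> * L2_norm_D ?g)"
  proof (intro mult_left_mono mult_mono)
    show "L2_norm_D (\<lambda>z. fst z * \<phi> z) \<le> L2_norm_D \<phi>"
    proof -
      have "AE z in leb_D. norm (fst z * \<phi> z) \<le> 1 * norm (\<phi> z)"
        by (rule AE_I2) (auto simp: abs_mult unit_square_def intro!: mult_left_le_one_le)
      from L2_norm_D_mono[OF L2(2,1) this] show ?thesis by simp
    qed
    show "L2_norm_D (\<lambda>z. fst (?g z)) \<le> L2_norm_D ?g"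
    proof -
      have "norm (fst (?g z)) \<le> 1 * norm (?g z)" for z
        using norm_fst_le[of "fst (?g z)" "snd (?g z)"] by simp
      from L2_norm_D_mono[OF L2(3,4) AE_I2[OF this]] show ?thesis by simp
    qed
  qed auto
  finally have "L2_norm_D \<phi> * L2_norm_D \<phi> \<le> L2_norm_D \<phi> * (2 * L2_norm_D ?g)"
    by (simp add: power2_eq_square mult_ac)
  then show ?thesis
    by (cases "L2_norm_D \<phi> = 0") (auto simp: less_le)
qed

lemma Poincare:
  assumes "V_graph p g"
  shows "L2_norm_D p \<le> 2 * L2_norm_D g"
proof -
  obtain \<phi> where \<phi>: "\<And>k::nat. \<phi> k \<in> test_functions" "(\<lambda>k. L2_norm_D (\<lambda>z. p z - \<phi> k z)) \<longlonglongrightarrow> 0"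
    "(\<lambda>k. L2_norm_D (\<lambda>z. g z - classical_grad (\<phi> k) z)) \<longlonglongrightarrow> 0" "p \<in> L2_D" "g \<in> L2_D"
    using V_graphE[OF assms(1)] by blast
  have "(\<lambda>k. L2_norm_D (\<phi> k)) \<longlonglongrightarrow> L2_norm_D p"
    by (rule L2_norm_D_tendsto[OF test_function_L2_D[OF \<phi>(1)] \<phi>(4) \<phi>(2)])
  moreover have "(\<lambda>k. 2 * L2_norm_D (classical_grad (\<phi> k))) \<longlonglongrightarrow> 2 * L2_norm_D g"
    by (intro tendsto_intros L2_norm_D_tendsto[OF classical_grad_L2_D[OF \<phi>(1)] \<phi>(5) \<phi>(3)])
  ultimately show ?thesis
    using Poincare_test_function[OF \<phi>(1)] by (blast intro: LIMSEQ_le)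
qed

lemma V_graph_closed:
  assumes V: "\<And>k::nat. V_graph (p k) (g k)" and L2: "q \<in> L2_D" "h \<in> L2_D"
    and lim: "(\<lambda>k. L2_norm_D (\<lambda>z. q z - p k z)) \<longlonglongrightarrow> 0" "(\<lambda>k. L2_norm_D (\<lambda>z. h z - g k z)) \<longlonglongrightarrow> 0"
  shows "V_graph q h"
proof -
  \<comment> \<open>A diagonal argument: replace \<open>p k\<close> by a test function within distance \<open>1 / (k + 1)\<close>.\<close>
  have "\<exists>\<phi>. \<phi> \<in> test_functions \<and> L2_norm_D (\<lambda>z. p k z - \<phi> z) < inverse (real (Suc k)) \<and>
      L2_norm_D (\<lambda>z. g k z - classical_grad \<phi> z) < inverse (real (Suc k))" for k
  proof -
    obtain \<phi> where \<phi>: "\<And>m::nat. \<phi> m \<in> test_functions" "(\<lambda>m. L2_norm_D (\<lambda>z. p k z - \<phi> m z)) \<longlonglongrightarrow> 0"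
      "(\<lambda>m. L2_norm_D (\<lambda>z. g k z - classical_grad (\<phi> m) z)) \<longlonglongrightarrow> 0"
      using V_graphE[OF V[of k]] by blast
    have "\<forall>\<^sub>F m in sequentially. L2_norm_D (\<lambda>z. p k z - \<phi> m z) < inverse (real (Suc k)) \<and>
      L2_norm_D (\<lambda>z. g k z - classical_grad (\<phi> m) z) < inverse (real (Suc k))"
      by (intro eventually_conj order_tendstoD(2)[OF \<phi>(2)] order_tendstoD(2)[OF \<phi>(3)]) simp_all
    then show ?thesis using \<phi>(1) eventually_happens'[OF sequentially_bot] by blast
  qed
  then obtain \<phi> where \<phi>: "\<And>k. \<phi> k \<in> test_functions"
      "\<And>k. L2_norm_D (\<lambda>z. p k z - \<phi> k z) < inverse (real (Suc k))"
      "\<And>k. L2_norm_D (\<lambda>z. g k z - classical_grad (\<phi> k) z) < inverse (real (Suc k))"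
    by metis
  have pg: "p k \<in> L2_D" "g k \<in> L2_D" for k
    using V[of k] by (simp_all add: V_graph_def)
  have "(\<lambda>k. L2_norm_D (\<lambda>z. q z - \<phi> k z)) \<longlonglongrightarrow> 0"
  proof (rule Lim_null_comparison)
    show "(\<lambda>k. L2_norm_D (\<lambda>z. q z - p k z) + inverse (real (Suc k))) \<longlonglongrightarrow> 0"
      using tendsto_add[OF lim(1) LIMSEQ_inverse_real_of_nat] by simp
    show "\<forall>\<^sub>F k in sequentially. norm (L2_norm_D (\<lambda>z. q z - \<phi> k z)) \<le>
        L2_norm_D (\<lambda>z. q z - p k z) + inverse (real (Suc k))"
    proof (intro always_eventually allI)
      fix k
      show "norm (L2_norm_D (\<lambda>z. q z - \<phi> k z)) \<le> L2_norm_D (\<lambda>z. q z - p k z) + inverse (real (Suc k))"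
        using L2_triangle_diff[OF L2(1) pg(1)[of k] test_function_L2_D[OF \<phi>(1)[of k]]] \<phi>(2)[of k]
        unfolding real_norm_def abs_of_nonneg[OF L2_norm_D_nonneg] by linarith
    qed
  qed
  moreover have "(\<lambda>k. L2_norm_D (\<lambda>z. h z - classical_grad (\<phi> k) z)) \<longlonglongrightarrow> 0"
  proof (rule Lim_null_comparison)
    show "(\<lambda>k. L2_norm_D (\<lambda>z. h z - g k z) + inverse (real (Suc k))) \<longlonglongrightarrow> 0"
      using tendsto_add[OF lim(2) LIMSEQ_inverse_real_of_nat] by simp
    show "\<forall>\<^sub>F k in sequentially. norm (L2_norm_D (\<lambda>z. h z - classical_grad (\<phi> k) z)) \<le>
        L2_norm_D (\<lambda>z. h z - g k z) + inverse (real (Suc k))"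
    proof (intro always_eventually allI)
      fix k
      show "norm (L2_norm_D (\<lambda>z. h z - classical_grad (\<phi> k) z)) \<le> L2_norm_D (\<lambda>z. h z - g k z) + inverse (real (Suc k))"
        using L2_triangle_diff[OF L2(2) pg(2)[of k] classical_grad_L2_D[OF \<phi>(1)[of k]]] \<phi>(3)[of k]
        unfolding real_norm_def abs_of_nonneg[OF L2_norm_D_nonneg] by linarith
    qed
  qed
  ultimately show ?thesis
    unfolding V_graph_def using L2 \<phi>(1) by blast
qed

text \<open>By the Poincare inequality a sequence whose gradients form a Cauchy sequence is itself Cauchy in \<open>L\<^sup>2\<close>, and
  the limits of both sequences form a pair in the closed relation \<open>V_graph\<close>.\<close>

lemma V_complete:
  assumes p: "\<And>k::nat. p k \<in> V"
    and Cauchy: "\<And>e. e > 0 \<Longrightarrow> \<exists>N. \<forall>m\<ge>N. \<forall>k\<ge>N. L2_norm_D (\<lambda>z. grad (p m) z - grad (p k) z) < e"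
  shows "\<exists>q\<in>V. (\<lambda>k. L2_norm_D (\<lambda>z. grad q z - grad (p k) z)) \<longlonglongrightarrow> 0"
proof -
  note g = grad_L2_D[OF p]
  have pL2: "p k \<in> L2_D" for k
    using V_graph_grad[OF p[of k]] by (simp add: V_graph_def)
  obtain h where h: "h \<in> L2_D" "(\<lambda>k. L2_norm_D (\<lambda>z. h z - grad (p k) z)) \<longlonglongrightarrow> 0"
    using L2_complete[OF g Cauchy] by blast
  have "\<exists>N. \<forall>m\<ge>N. \<forall>k\<ge>N. L2_norm_D (\<lambda>z. p m z - p k z) < e" if "e > 0" for e
  proof -
    have "L2_norm_D (\<lambda>z. p m z - p k z) \<le> 2 * L2_norm_D (\<lambda>z. grad (p m) z - grad (p k) z)" for m k
      using Poincare[OF V_graph_combination[OF V_graph_grad[OF p] V_graph_grad[OF p], of 1 m "-1" k]] by simp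
    moreover have "e / 2 > 0" using that by simp
    then obtain N where "\<forall>m\<ge>N. \<forall>k\<ge>N. L2_norm_D (\<lambda>z. grad (p m) z - grad (p k) z) < e / 2"
      using Cauchy by blast
    then have "2 * L2_norm_D (\<lambda>z. grad (p m) z - grad (p k) z) < e" if "m \<ge> N" "k \<ge> N" for m k
      using that by fastforce
    ultimately show ?thesis
      by (meson le_less_trans)
  qed
  then obtain q where q: "q \<in> L2_D" "(\<lambda>k. L2_norm_D (\<lambda>z. q z - p k z)) \<longlonglongrightarrow> 0"
    using L2_complete[of p] pL2 by blast
  have qh: "V_graph q h"
    by (rule V_graph_closed[OF V_graph_grad[OF p] q(1) h(1) q(2) h(2)])
  have "L2_norm_D (\<lambda>z. grad q z - grad (p k) z) = L2_norm_D (\<lambda>z. h z - grad (p k) z)" for k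
  proof (rule L2_norm_D_cong_AE)
    show "AE z in leb_D. grad q z - grad (p k) z = h z - grad (p k) z"
      using grad_AE_eq[OF V_graph_weak_gradient[OF qh]] by eventually_elim simp
  qed (intro L2_D_measurable L2_D_diff grad_L2_D V_graph_imp_V[OF qh] p h(1))+
  then show ?thesis
    using h(2) V_graph_imp_V[OF qh] by (intro bexI[of _ q]) simp_all
qed

section \<open>Weak solutions\<close>

definition energy_form ::
  "(real \<times> real \<Rightarrow> real) \<Rightarrow> (real \<times> real \<Rightarrow> real) \<Rightarrow> (real \<times> real \<Rightarrow> real) \<Rightarrow> real" where
  "energy_form \<kappa> p q = (LINT z|leb_D. \<kappa> z * (grad p z \<bullet> grad q z))"

lemma weak_solution_iff:
  "weak_solution f \<kappa> p \<longleftrightarrow> p \<in> V \<and> (\<forall>v\<in>V. energy_form \<kappa> p v = f v)"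
  by (simp add: weak_solution_def energy_form_def)

lemma permeability_bounds:
  assumes "\<kappa> \<in> permeabilities"
  obtains \<alpha> \<beta> where "0 < \<alpha>" "AE z in leb_D. \<alpha> \<le> \<kappa> z \<and> \<bar>\<kappa> z\<bar> \<le> \<beta>"
proof -
  have [measurable]: "\<kappa> \<in> borel_measurable leb_D"
    and sup: "esssup leb_D (\<lambda>z. ereal \<bar>\<kappa> z\<bar>) < \<infinity>" and inf: "- esssup leb_D (\<lambda>z. - ereal (\<kappa> z)) > 0"
    using assms by (auto simp: permeabilities_def)
  obtain b where b: "esssup leb_D (\<lambda>z. ereal \<bar>\<kappa> z\<bar>) < ereal b"
    using ereal_dense2[OF sup] by blast
  have "esssup leb_D (\<lambda>z. - ereal (\<kappa> z)) < 0"
    using inf by (cases "esssup leb_D (\<lambda>z. - ereal (\<kappa> z))") auto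
  then obtain a where a: "esssup leb_D (\<lambda>z. - ereal (\<kappa> z)) < ereal a" "ereal a < 0"
    using ereal_dense2 by blast
  have "AE z in leb_D. - ereal (\<kappa> z) \<le> esssup leb_D (\<lambda>z. - ereal (\<kappa> z))"
    by (rule esssup_AE)
  moreover have "AE z in leb_D. ereal \<bar>\<kappa> z\<bar> \<le> esssup leb_D (\<lambda>z. ereal \<bar>\<kappa> z\<bar>)"
    by (rule esssup_AE)
  ultimately have "AE z in leb_D. - a \<le> \<kappa> z \<and> \<bar>\<kappa> z\<bar> \<le> b"
  proof eventually_elim
    fix z assume "- ereal (\<kappa> z) \<le> esssup leb_D (\<lambda>z. - ereal (\<kappa> z))"
      "ereal \<bar>\<kappa> z\<bar> \<le> esssup leb_D (\<lambda>z. ereal \<bar>\<kappa> z\<bar>)"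
    from le_less_trans[OF this(1) a(1)] le_less_trans[OF this(2) b]
    show "- a \<le> \<kappa> z \<and> \<bar>\<kappa> z\<bar> \<le> b" by auto
  qed
  with a(2) show thesis by (intro that[of "- a" b]) auto
qed

lemma weighted_grad_L2_D:
  assumes "\<kappa> \<in> permeabilities" "v \<in> V"
  shows "(\<lambda>z. \<kappa> z *\<^sub>R grad v z) \<in> L2_D"
proof -
  obtain \<alpha> \<beta> where bounds: "AE z in leb_D. \<alpha> \<le> \<kappa> z \<and> \<bar>\<kappa> z\<bar> \<le> \<beta>"
    using permeability_bounds[OF assms(1)] by metis
  have [measurable]: "\<kappa> \<in> borel_measurable leb_D" "grad v \<in> borel_measurable leb_D"
    using assms L2_D_measurable[OF grad_L2_D] by (auto simp: permeabilities_def)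
  show ?thesis
  proof (rule L2_D_bound)
    show "integrable leb_D (\<lambda>z. \<beta>\<^sup>2 * (norm (grad v z))\<^sup>2)"
      using L2_D_square_integrable[OF grad_L2_D[OF assms(2)]] by simp
    show "AE z in leb_D. (norm (\<kappa> z *\<^sub>R grad v z))\<^sup>2 \<le> \<beta>\<^sup>2 * (norm (grad v z))\<^sup>2"
      using bounds
    proof eventually_elim
      fix z assume "\<alpha> \<le> \<kappa> z \<and> \<bar>\<kappa> z\<bar> \<le> \<beta>"
      then have "(\<bar>\<kappa> z\<bar> * norm (grad v z))\<^sup>2 \<le> (\<beta> * norm (grad v z))\<^sup>2"
        by (intro power_mono mult_right_mono) auto
      then show "(norm (\<kappa> z *\<^sub>R grad v z))\<^sup>2 \<le> \<beta>\<^sup>2 * (norm (grad v z))\<^sup>2"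
        by (simp add: power_mult_distrib)
    qed
  qed measurable
qed

lemma energy_form_eq_inner:
  "energy_form \<kappa> p v = L2_inner_D (grad p) (\<lambda>z. \<kappa> z *\<^sub>R grad v z)"
  by (simp add: energy_form_def L2_inner_D_def)

lemma energy_form_commute: "energy_form \<kappa> p q = energy_form \<kappa> q p"
  by (simp add: energy_form_def inner_commute)

lemma energy_form_combination:
  assumes \<kappa>: "\<kappa> \<in> permeabilities" and V: "p \<in> V" "q \<in> V" "v \<in> V"
  shows "energy_form \<kappa> (\<lambda>z. s * p z + t * q z) v = s * energy_form \<kappa> p v + t * energy_form \<kappa> q v"
proof -
  let ?w = "\<lambda>z. \<kappa> z *\<^sub>R grad v z"
  have "L2_inner_D (grad (\<lambda>z. s * p z + t * q z)) ?w = L2_inner_D (\<lambda>z. s *\<^sub>R grad p z + t *\<^sub>R grad q z) ?w"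
    unfolding L2_inner_D_def
  proof (rule integral_cong_AE)
    show "AE z in leb_D. grad (\<lambda>z. s * p z + t * q z) z \<bullet> ?w z = (s *\<^sub>R grad p z + t *\<^sub>R grad q z) \<bullet> ?w z"
      using V_combination(2)[OF V(1,2), of s t] by eventually_elim simp
  qed (intro borel_measurable_integrable L2_D_inner_integrable weighted_grad_L2_D[OF \<kappa> V(3)]
      L2_D_combination grad_L2_D V V_combination(1))+
  then show ?thesis
    by (simp add: energy_form_eq_inner L2_inner_D_combination grad_L2_D V weighted_grad_L2_D[OF \<kappa>])
qed

lemma energy_form_combination_square:
  assumes \<kappa>: "\<kappa> \<in> permeabilities" and V: "p \<in> V" "q \<in> V"
  shows "energy_form \<kappa> (\<lambda>z. s * p z + t * q z) (\<lambda>z. s * p z + t * q z) =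
    s\<^sup>2 * energy_form \<kappa> p p + 2 * s * t * energy_form \<kappa> p q + t\<^sup>2 * energy_form \<kappa> q q"
proof -
  let ?w = "\<lambda>z. s * p z + t * q z"
  have "energy_form \<kappa> ?w ?w = s * energy_form \<kappa> p ?w + t * energy_form \<kappa> q ?w"
    by (rule energy_form_combination[OF \<kappa> V V_combination(1)[OF V]])
  also have "energy_form \<kappa> p ?w = s * energy_form \<kappa> p p + t * energy_form \<kappa> p q"
    unfolding energy_form_commute[of \<kappa> p ?w] energy_form_commute[of \<kappa> p q]
    by (rule energy_form_combination[OF \<kappa> V V(1)])
  also have "energy_form \<kappa> q ?w = s * energy_form \<kappa> p q + t * energy_form \<kappa> q q"
    unfolding energy_form_commute[of \<kappa> q ?w]
    by (rule energy_form_combination[OF \<kappa> V V(2)])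
  finally show ?thesis by (simp add: power2_eq_square algebra_simps)
qed

lemma energy_form_coercive:
  assumes \<kappa>: "\<kappa> \<in> permeabilities"
  obtains \<alpha> where "0 < \<alpha>" "\<And>p. p \<in> V \<Longrightarrow> \<alpha> * (V_norm p)\<^sup>2 \<le> energy_form \<kappa> p p"
proof -
  obtain \<alpha> \<beta> where bounds: "0 < \<alpha>" "AE z in leb_D. \<alpha> \<le> \<kappa> z \<and> \<bar>\<kappa> z\<bar> \<le> \<beta>"
    using permeability_bounds[OF \<kappa>] by metis
  have "\<alpha> * (V_norm p)\<^sup>2 \<le> energy_form \<kappa> p p" if p: "p \<in> V" for p
  proof -
    have "\<alpha> * (V_norm p)\<^sup>2 = (LINT z|leb_D. \<alpha> * (grad p z \<bullet> grad p z))"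
      by (simp add: V_norm_def L2_norm_D_square L2_inner_D_def)
    also have "\<dots> \<le> energy_form \<kappa> p p"
      unfolding energy_form_def
    proof (rule integral_mono_AE)
      show "integrable leb_D (\<lambda>z. \<kappa> z * (grad p z \<bullet> grad p z))"
        using L2_D_inner_integrable[OF grad_L2_D[OF p] weighted_grad_L2_D[OF \<kappa> p]] by simp
      show "integrable leb_D (\<lambda>z. \<alpha> * (grad p z \<bullet> grad p z))"
        using L2_D_inner_integrable[OF grad_L2_D[OF p] grad_L2_D[OF p]] by simp
      show "AE z in leb_D. \<alpha> * (grad p z \<bullet> grad p z) \<le> \<kappa> z * (grad p z \<bullet> grad p z)"
        using bounds(2) by eventually_elim (simp add: mult_right_mono)
    qed
    finally show ?thesis .
  qed
  with bounds(1) show thesis by (rule that)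
qed

lemma V_nonempty: "V \<noteq> {}"
proof -
  have "box (0, 0) (1, 1) \<subseteq> unit_square" by (simp add: unit_square_eq_box)
  then obtain \<phi> where "\<phi> \<in> test_functions"
    using box_indicator_approximation by blast
  then show ?thesis
    using V_graph_imp_V[OF V_graph_test_function] by blast
qed

lemma V_dual_combination:
  "l \<in> V_dual \<Longrightarrow> p \<in> V \<Longrightarrow> q \<in> V \<Longrightarrow> l (\<lambda>z. s * p z + t * q z) = s * l p + t * l q"
  by (simp add: V_dual_def)

lemma V_dual_bound:
  assumes "l \<in> V_dual"
  obtains C where "0 \<le> C" "\<And>p. p \<in> V \<Longrightarrow> \<bar>l p\<bar> \<le> C * V_norm p"
proof -
  obtain C where C: "\<And>p. p \<in> V \<Longrightarrow> \<bar>l p\<bar> \<le> C * V_norm p"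
    using assms unfolding V_dual_def by blast
  have "\<bar>l p\<bar> \<le> max C 0 * V_norm p" if "p \<in> V" for p
  proof -
    have "C * V_norm p \<le> max C 0 * V_norm p"
      by (intro mult_right_mono) (auto simp: V_norm_def)
    with C[OF that] show ?thesis by simp
  qed
  then show thesis by (intro that[of "max C 0"]) auto
qed

text \<open>The direct method of the calculus of variations, applied to the energy \<open>J v = a(v, v) - 2 f(v)\<close>.
  Coercivity bounds \<open>J\<close> from below, the parallelogram identity makes every minimising sequence Cauchy for
  the gradient norm, and the first variation of \<open>J\<close> vanishes at the limit.\<close>

lemma weak_solution_exists:
  assumes f: "f \<in> V_dual" and \<kappa>: "\<kappa> \<in> permeabilities"
  shows "\<exists>p. weak_solution f \<kappa> p"
proof -
  define J where "J v = energy_form \<kappa> v v - 2 * f v" for v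
  obtain \<alpha> where \<alpha>: "0 < \<alpha>" "\<And>p. p \<in> V \<Longrightarrow> \<alpha> * (V_norm p)\<^sup>2 \<le> energy_form \<kappa> p p"
    using energy_form_coercive[OF \<kappa>] by metis
  obtain C where C: "0 \<le> C" "\<And>p. p \<in> V \<Longrightarrow> \<bar>f p\<bar> \<le> C * V_norm p"
    using V_dual_bound[OF f] by metis
  have J_lower: "- (C\<^sup>2 / \<alpha>) \<le> J v" if v: "v \<in> V" for v
  proof -
    have "0 \<le> (\<alpha> * V_norm v - C)\<^sup>2 / \<alpha>" using \<alpha>(1) by simp
    also have "\<dots> = \<alpha> * (V_norm v)\<^sup>2 - 2 * (C * V_norm v) + C\<^sup>2 / \<alpha>"
      using \<alpha>(1) by (simp add: power2_diff field_simps power2_eq_square)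
    finally show ?thesis
      using \<alpha>(2)[OF v] C(2)[OF v] by (simp add: J_def)
  qed
  define m where "m = Inf (J ` V)"
  have m: "m \<le> J v" if "v \<in> V" for v
    unfolding m_def using that J_lower by (intro cInf_lower bdd_belowI2) auto
  have "\<exists>v\<in>V. J v < m + inverse (real (Suc k))" for k
    using cInf_lessD[of "J ` V" "m + inverse (real (Suc k))"] V_nonempty by (auto simp: m_def)
  then obtain v where v: "\<And>k. v k \<in> V" "\<And>k. J (v k) < m + inverse (real (Suc k))"
    by metis
  have close: "\<alpha> * (L2_norm_D (\<lambda>z. grad (v i) z - grad (v j) z))\<^sup>2 \<le>
      2 * inverse (real (Suc i)) + 2 * inverse (real (Suc j))" for i j
  proof -
    let ?d = "\<lambda>z. 1 * v i z + (-1) * v j z" and ?h = "\<lambda>z. 1/2 * v i z + 1/2 * v j z"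
    have V: "?d \<in> V" "?h \<in> V" by (rule V_combination(1)[OF v(1) v(1)])+
    have "L2_norm_D (\<lambda>z. grad (v i) z - grad (v j) z) = V_norm ?d"
      unfolding V_norm_def
    proof (rule L2_norm_D_cong_AE)
      show "AE z in leb_D. grad (v i) z - grad (v j) z = grad ?d z"
        using V_combination(2)[OF v(1)[of i] v(1)[of j], of 1 "-1"] by eventually_elim simp
    qed (intro L2_D_measurable L2_D_diff grad_L2_D V v(1))+
    then have "\<alpha> * (L2_norm_D (\<lambda>z. grad (v i) z - grad (v j) z))\<^sup>2 \<le> energy_form \<kappa> ?d ?d"
      using \<alpha>(2)[OF V(1)] by simp
    \<comment> \<open>The parallelogram identity; the linear parts of \<open>J\<close> cancel.\<close>
    also have "\<dots> = 2 * J (v i) + 2 * J (v j) - 4 * J ?h"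
      unfolding J_def energy_form_combination_square[OF \<kappa> v(1) v(1)] V_dual_combination[OF f v(1) v(1)]
      by (simp add: power2_eq_square field_simps)
    also have "\<dots> \<le> 2 * inverse (real (Suc i)) + 2 * inverse (real (Suc j))"
      using m[OF V(2)] v(2)[of i] v(2)[of j] by linarith
    finally show ?thesis .
  qed
  have "\<exists>N. \<forall>i\<ge>N. \<forall>j\<ge>N. L2_norm_D (\<lambda>z. grad (v i) z - grad (v j) z) < e" if "e > 0" for e
  proof -
    have "0 < \<alpha> * e\<^sup>2 / 4" using \<alpha>(1) that by simp
    then obtain N where N: "inverse (real (Suc N)) < \<alpha> * e\<^sup>2 / 4"
      using reals_Archimedean by blast
    have "L2_norm_D (\<lambda>z. grad (v i) z - grad (v j) z) < e" if "i \<ge> N" "j \<ge> N" for i j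
    proof -
      have "inverse (real (Suc i)) \<le> inverse (real (Suc N))" "inverse (real (Suc j)) \<le> inverse (real (Suc N))"
        using that by (auto intro!: le_imp_inverse_le)
      then have "\<alpha> * (L2_norm_D (\<lambda>z. grad (v i) z - grad (v j) z))\<^sup>2 < \<alpha> * e\<^sup>2"
        using close[of i j] N by linarith
      then show ?thesis
        using \<alpha>(1) \<open>e > 0\<close> by (simp add: power_less_imp_less_base)
    qed
    then show ?thesis by blast
  qed
  from V_complete[OF v(1) this]
  obtain q where q: "q \<in> V" "(\<lambda>k. L2_norm_D (\<lambda>z. grad q z - grad (v k) z)) \<longlonglongrightarrow> 0"
    by blast
  have "energy_form \<kappa> q w = f w" if w: "w \<in> V" for w
  proof -
    have lim: "(\<lambda>k. energy_form \<kappa> (v k) w) \<longlonglongrightarrow> energy_form \<kappa> q w"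
      unfolding energy_form_eq_inner
      by (intro L2_inner_D_tendsto grad_L2_D v(1) q weighted_grad_L2_D \<kappa> w)
    \<comment> \<open>The value \<open>J (v k)\<close> is within \<open>1 / (k + 1)\<close> of the infimum, so perturbing \<open>v k\<close> by \<open>t w\<close> lowers \<open>J\<close> by
      at most that much.  This survives the limit without knowing that \<open>J\<close> is continuous.\<close>
    have "0 \<le> 0 + 2 * t * (energy_form \<kappa> q w - f w) + t\<^sup>2 * energy_form \<kappa> w w" for t
    proof (rule LIMSEQ_le_const)
      show "(\<lambda>k. inverse (real (Suc k)) + 2 * t * (energy_form \<kappa> (v k) w - f w) + t\<^sup>2 * energy_form \<kappa> w w)
          \<longlonglongrightarrow> 0 + 2 * t * (energy_form \<kappa> q w - f w) + t\<^sup>2 * energy_form \<kappa> w w"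
        by (intro tendsto_add tendsto_mult_left tendsto_diff lim tendsto_const LIMSEQ_inverse_real_of_nat)
      have "0 \<le> inverse (real (Suc k)) + 2 * t * (energy_form \<kappa> (v k) w - f w) + t\<^sup>2 * energy_form \<kappa> w w" for k
      proof -
        let ?c = "\<lambda>z. 1 * v k z + t * w z"
        have "J (v k) - inverse (real (Suc k)) \<le> J ?c"
          using m[OF V_combination(1)[OF v(1) w, of 1 k t]] v(2)[of k] by linarith
        also have "J ?c = J (v k) + 2 * t * (energy_form \<kappa> (v k) w - f w) + t\<^sup>2 * energy_form \<kappa> w w"
          unfolding J_def energy_form_combination_square[OF \<kappa> v(1) w] V_dual_combination[OF f v(1) w]
          by (simp add: algebra_simps)
        finally show ?thesis by linarith
      qed
      then show "\<exists>N. \<forall>k\<ge>N. 0 \<le> inverse (real (Suc k)) + 2 * t * (energy_form \<kappa> (v k) w - f w) + t\<^sup>2 * energy_form \<kappa> w w"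
        by blast
    qed
    moreover have "0 \<le> energy_form \<kappa> w w"
      using \<alpha>(2)[OF w] \<alpha>(1) by (meson mult_nonneg_nonneg order_less_imp_le order_trans zero_le_power2)
    ultimately have "(energy_form \<kappa> q w - f w)\<^sup>2 \<le> 0 * energy_form \<kappa> w w"
      by (rule nonneg_quadratic_discriminant)
    then show ?thesis by simp
  qed
  with q(1) show ?thesis
    unfolding weak_solution_iff by blast
qed

lemma weak_solution_solution_map:
  assumes "f \<in> V_dual" "\<kappa> \<in> permeabilities"
  shows "weak_solution f \<kappa> (solution_map f \<kappa>)"
  using someI_ex[OF weak_solution_exists[OF assms]] assms(2) by (simp add: solution_map_def)

text \<open>Dirichlet's principle \<open>f(p) = max {2 f(v) - a(v, v) | v \<in> V}\<close>, from \<open>a(p - v, p - v) \<ge> 0\<close>.  It writes a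
  superlevel set of the solution functional as a union of sets in which \<open>\<kappa>\<close> enters only through the form at a
  fixed \<open>v\<close>.\<close>

lemma less_solution_energy_iff:
  assumes f: "f \<in> V_dual" and \<kappa>: "\<kappa> \<in> permeabilities"
  shows "c < f (solution_map f \<kappa>) \<longleftrightarrow> (\<exists>v\<in>V. c < 2 * f v - energy_form \<kappa> v v)"
proof -
  let ?p = "solution_map f \<kappa>"
  have p: "?p \<in> V" "\<And>v. v \<in> V \<Longrightarrow> energy_form \<kappa> ?p v = f v"
    using weak_solution_solution_map[OF f \<kappa>] by (auto simp: weak_solution_iff)
  have max: "2 * f v - energy_form \<kappa> v v \<le> f ?p" if v: "v \<in> V" for v
  proof -
    obtain \<alpha> where \<alpha>: "0 < \<alpha>" "\<And>p. p \<in> V \<Longrightarrow> \<alpha> * (V_norm p)\<^sup>2 \<le> energy_form \<kappa> p p"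
      using energy_form_coercive[OF \<kappa>] by metis
    let ?d = "\<lambda>z. 1 * ?p z + (-1) * v z"
    have "0 \<le> \<alpha> * (V_norm ?d)\<^sup>2" using \<alpha>(1) by simp
    also have "\<dots> \<le> energy_form \<kappa> ?d ?d"
      by (rule \<alpha>(2)[OF V_combination(1)[OF p(1) v]])
    also have "\<dots> = f ?p - 2 * f v + energy_form \<kappa> v v"
      unfolding energy_form_combination_square[OF \<kappa> p(1) v] using p v by simp
    finally show ?thesis by simp
  qed
  have "2 * f ?p - energy_form \<kappa> ?p ?p = f ?p" using p by simp
  then show ?thesis
    using max p(1) by (metis less_le_trans)
qed

lemma V_dual_add:
  assumes "f \<in> V_dual" "l \<in> V_dual"
  shows "(\<lambda>p. f p + l p) \<in> V_dual"
proof -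
  obtain C where C: "\<And>p. p \<in> V \<Longrightarrow> \<bar>f p\<bar> \<le> C * V_norm p" using V_dual_bound[OF assms(1)] by metis
  obtain B where B: "\<And>p. p \<in> V \<Longrightarrow> \<bar>l p\<bar> \<le> B * V_norm p" using V_dual_bound[OF assms(2)] by metis
  have "\<bar>f p + l p\<bar> \<le> (C + B) * V_norm p" if "p \<in> V" for p
    using C[OF that] B[OF that] by (simp add: distrib_right)
  moreover have "f (\<lambda>z. s * p z + t * q z) + l (\<lambda>z. s * p z + t * q z) =
      s * (f p + l p) + t * (f q + l q)" if "p \<in> V" "q \<in> V" for p q s t
    unfolding V_dual_combination[OF assms(1) that] V_dual_combination[OF assms(2) that]
    by (simp add: algebra_simps)
  ultimately show ?thesis unfolding V_dual_def by blast
qed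

text \<open>If \<open>p\<close> and \<open>q\<close> solve the problems for \<open>f\<close> and \<open>l\<close>, then \<open>p + q\<close> solves the one for \<open>f + l\<close>, and the cross
  terms \<open>f(q)\<close> and \<open>l(p)\<close> both equal \<open>a(p, q)\<close>.  So \<open>l(p)\<close> is expressed by solution energies alone.\<close>

lemma solution_polarization:
  assumes f: "f \<in> V_dual" and l: "l \<in> V_dual" and \<kappa>: "\<kappa> \<in> permeabilities"
  defines "g \<equiv> \<lambda>p. f p + l p"
  shows "l (solution_map f \<kappa>) =
    (g (solution_map g \<kappa>) - f (solution_map f \<kappa>) - l (solution_map l \<kappa>)) / 2"
proof -
  let ?p = "solution_map f \<kappa>" and ?q = "solution_map l \<kappa>" and ?r = "solution_map g \<kappa>"
  let ?w = "\<lambda>z. 1 * ?p z + 1 * ?q z"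
  have g: "g \<in> V_dual" unfolding g_def by (rule V_dual_add[OF f l])
  have p: "?p \<in> V" "\<And>v. v \<in> V \<Longrightarrow> energy_form \<kappa> ?p v = f v"
    using weak_solution_solution_map[OF f \<kappa>] by (auto simp: weak_solution_iff)
  have q: "?q \<in> V" "\<And>v. v \<in> V \<Longrightarrow> energy_form \<kappa> ?q v = l v"
    using weak_solution_solution_map[OF l \<kappa>] by (auto simp: weak_solution_iff)
  have r: "?r \<in> V" "\<And>v. v \<in> V \<Longrightarrow> energy_form \<kappa> ?r v = g v"
    using weak_solution_solution_map[OF g \<kappa>] by (auto simp: weak_solution_iff)
  have w: "?w \<in> V" by (rule V_combination(1)[OF p(1) q(1)])
  have "g ?r = energy_form \<kappa> ?w ?r"
    unfolding energy_form_combination[OF \<kappa> p(1) q(1) r(1)] using p(2) q(2) r(1) by (simp add: g_def)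
  also have "\<dots> = g ?w"
    unfolding energy_form_commute[of \<kappa> ?w ?r] by (rule r(2)[OF w])
  also have "\<dots> = f ?p + f ?q + l ?p + l ?q"
    unfolding g_def V_dual_combination[OF f p(1) q(1)] V_dual_combination[OF l p(1) q(1)] by simp
  also have "f ?q = l ?p"
    using p(2)[OF q(1)] q(2)[OF p(1)] by (simp add: energy_form_commute)
  finally show ?thesis by simp
qed

section \<open>The layered permeability depends continuously on the parameters\<close>

text \<open>The depth of an interface between two layers as a real number, without the values \<open>-\<infinity>\<close> and \<open>\<infinity>\<close> that
  \<open>interface_depth\<close> takes above the first and below the last layer.\<close>

definition interface_position ::
  "(nat \<Rightarrow> real) \<times> (nat \<Rightarrow> real) \<times> real \<Rightarrow> nat \<Rightarrow> real \<Rightarrow> real" where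
  "interface_position = (\<lambda>(a, b, c) i x. interface_height a b i x + (if x < 1/2 then c else 0))"

definition off_interfaces ::
  "nat \<Rightarrow> (nat \<Rightarrow> real) \<times> (nat \<Rightarrow> real) \<times> real \<Rightarrow> real \<times> real \<Rightarrow> bool" where
  "off_interfaces n ug z \<longleftrightarrow> fst z \<noteq> 1/2 \<and> (\<forall>i\<in>{1..<n}. 1 - snd z \<noteq> interface_position ug i (fst z))"

lemma in_layer_iff:
  assumes "i \<in> {1..n}"
  shows "z \<in> layer n ug i \<longleftrightarrow> z \<in> unit_square \<and> fst z \<noteq> 1/2 \<and>
    (i = 1 \<or> interface_position ug (i - 1) (fst z) < 1 - snd z) \<and>
    (i = n \<or> 1 - snd z < interface_position ug i (fst z))"
proof -
  obtain a b c where ug: "ug = (a, b, c)" by (metis surj_pair)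
  have "i - 1 \<noteq> n" "i \<noteq> 0" "i - 1 = 0 \<longleftrightarrow> i = 1" using assms by auto
  then show ?thesis
    by (cases z) (auto simp: ug layer_def interface_depth_def interface_position_def)
qed

lemma continuous_interface_position:
  "continuous_on UNIV (\<lambda>ug. interface_position ug i x)"
proof -
  have *: "continuous_on UNIV (\<lambda>ug::(nat \<Rightarrow> real) \<times> (nat \<Rightarrow> real) \<times> real. fst ug k)"
      "continuous_on UNIV (\<lambda>ug::(nat \<Rightarrow> real) \<times> (nat \<Rightarrow> real) \<times> real. fst (snd ug) k)" for k
    by (rule continuous_on_compose2[OF continuous_on_product_coordinates[of k]
          continuous_on_fst[OF continuous_on_id]], simp)
      (rule continuous_on_compose2[OF continuous_on_product_coordinates[of k]
          continuous_on_fst[OF continuous_on_snd[OF continuous_on_id]]], simp)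
  have eq: "(\<lambda>ug. interface_position ug i x) = (\<lambda>ug. (\<Sum>k=1..i. fst (snd ug) k * (1 - x) + fst ug k * x)
      + (if x < 1/2 then snd (snd ug) else 0))"
    by (auto simp: interface_position_def interface_height_def fun_eq_iff)
  show ?thesis unfolding eq
    by (cases "x < 1/2") (simp_all only: if_True if_False, (intro continuous_intros *)+)
qed

lemma borel_measurable_interface_position [measurable]:
  "interface_position ug i \<in> borel_measurable borel"
proof -
  obtain a b c where "ug = (a, b, c)" by (metis surj_pair)
  then show ?thesis by (simp add: interface_position_def interface_height_def)
qed

lemma sets_layer:
  assumes "i \<in> {1..n}"
  shows "layer n ug i \<in> sets leb_D"
proof -
  have "layer n ug i = {z \<in> unit_square. fst z \<noteq> 1/2 \<and>
    (i = 1 \<or> interface_position ug (i - 1) (fst z) < 1 - snd z) \<and>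
    (i = n \<or> 1 - snd z < interface_position ug i (fst z))}" (is "_ = ?A")
    by (intro set_eqI) (simp only: in_layer_iff[OF assms] mem_Collect_eq)
  moreover have "?A \<in> sets borel"
  proof -
    have "{z \<in> space (borel \<Otimes>\<^sub>M borel). fst z \<noteq> 1/2 \<and>
        (i = 1 \<or> interface_position ug (i - 1) (fst z) < 1 - snd z) \<and>
        (i = n \<or> 1 - snd z < interface_position ug i (fst z))} \<in> sets (borel \<Otimes>\<^sub>M borel)"
      by measurable
    then have "{z. fst z \<noteq> 1/2 \<and> (i = 1 \<or> interface_position ug (i - 1) (fst z) < 1 - snd z) \<and>
        (i = n \<or> 1 - snd z < interface_position ug i (fst z))} \<in> sets borel"
      unfolding borel_prod space_borel by (simp only: UNIV_I simp_thms)
    from sets.Int[OF sets_unit_square(2) this] show ?thesis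
      by (simp add: Int_def)
  qed
  ultimately have "layer n ug i \<in> sets lebesgue" by simp
  moreover have "layer n ug i \<subseteq> unit_square" by (auto simp: layer_def)
  ultimately show ?thesis by (simp add: sets_restrict_space_iff)
qed

lemma borel_measurable_permeability: "permeability n u \<in> borel_measurable leb_D"
proof -
  have [measurable]: "(indicator (layer n (fst u) i) :: _ \<Rightarrow> real) \<in> borel_measurable leb_D" if "i \<in> {1..n}" for i
    using sets_layer[OF that] by simp
  show ?thesis
    unfolding permeability_def case_prod_beta by measurable
qed

text \<open>The graph of a measurable function meets every vertical line in one point and is a null set by Fubini's theorem; a
  vertical line is null as well.\<close>

lemma AE_off_graph:
  fixes g :: "real \<Rightarrow> real"
  assumes [measurable]: "g \<in> borel_measurable borel"
  shows "AE z in leb_D. snd z \<noteq> g (fst z)" and "AE z in leb_D. fst z \<noteq> c"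
proof -
  have "AE z in lborel \<Otimes>\<^sub>M lborel. snd z \<noteq> g (fst z)"
  proof (rule lborel_pair.AE_pair_measure)
    show "{z \<in> space (lborel \<Otimes>\<^sub>M lborel). snd z \<noteq> g (fst z)} \<in> sets (lborel \<Otimes>\<^sub>M lborel)"
      by measurable
  qed (simp add: AE_lborel_singleton)
  moreover have "AE z in lborel \<Otimes>\<^sub>M (lborel :: real measure). fst z \<noteq> c"
  proof (rule lborel_pair.AE_pair_measure)
    show "AE x in lborel. AE y in (lborel :: real measure). fst (x, y) \<noteq> c"
      using AE_lborel_singleton[of c] by eventually_elim simp
    show "{z \<in> space (lborel \<Otimes>\<^sub>M lborel). fst z \<noteq> c} \<in> sets (lborel \<Otimes>\<^sub>M (lborel :: real measure))"
      by measurable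
  qed
  ultimately have "AE z in lebesgue. snd z \<noteq> g (fst z)"
      "AE z in (lebesgue :: (real \<times> real) measure). fst z \<noteq> c"
    unfolding lborel_prod by (auto simp only: AE_completion)
  then show "AE z in leb_D. snd z \<noteq> g (fst z)" "AE z in leb_D. fst z \<noteq> c"
    by (auto simp: AE_restrict_space_iff elim: eventually_mono)
qed

lemma AE_off_interfaces: "AE z in leb_D. off_interfaces n ug z"
proof -
  have "AE z in leb_D. 1 - snd z \<noteq> interface_position ug i (fst z)" for i
    using AE_off_graph(1)[of "\<lambda>x. 1 - interface_position ug i x"] by (rule AE_mp) auto
  then have "AE z in leb_D. \<forall>i\<in>{1..<n}. 1 - snd z \<noteq> interface_position ug i (fst z)"
    by (simp add: AE_finite_all)
  with AE_off_graph(2)[of "\<lambda>x. x" "1/2"] show ?thesis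
    unfolding off_interfaces_def by auto
qed

text \<open>The layer sought is the first one whose lower interface lies below the point.\<close>

lemma layers_cover:
  assumes "n \<ge> 1" "z \<in> unit_square" "off_interfaces n ug z"
  shows "\<exists>i\<in>{1..n}. z \<in> layer n ug i"
proof -
  define P where "P i \<longleftrightarrow> 1 \<le> i \<and> (i = n \<or> 1 - snd z < interface_position ug i (fst z))" for i
  define i where "i = (LEAST i. P i)"
  have "P n" using assms(1) by (simp add: P_def)
  then have "P i" "i \<le> n" unfolding i_def by (auto intro: LeastI Least_le)
  have "interface_position ug (i - 1) (fst z) < 1 - snd z" if "i \<noteq> 1"
  proof -
    have "1 \<le> i - 1" "i - 1 < n" using that \<open>P i\<close> \<open>i \<le> n\<close> by (auto simp: P_def)
    then have "\<not> P (i - 1)"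
      using not_less_Least[of "i - 1" P] by (simp add: i_def)
    with \<open>1 \<le> i - 1\<close> \<open>i - 1 < n\<close> assms(3) show ?thesis
      by (force simp: P_def off_interfaces_def)
  qed
  moreover have "i \<in> {1..n}" using \<open>P i\<close> \<open>i \<le> n\<close> by (simp add: P_def)
  ultimately show ?thesis
    using \<open>P i\<close> assms(2,3) by (intro bexI[of _ i]) (auto simp: in_layer_iff P_def off_interfaces_def)
qed

text \<open>Almost every point lies in some layer, so the smallest of the layer values bounds the permeability from below.\<close>

lemma permeability_in_permeabilities:
  assumes "n \<ge> 1" and pos: "\<And>i. i \<in> {1..n} \<Longrightarrow> 0 < snd u i"
  shows "permeability n u \<in> permeabilities"
proof -
  let ?\<kappa> = "snd u"
  have eq: "permeability n u z = (\<Sum>i=1..n. ?\<kappa> i * indicator (layer n (fst u) i) z)" for z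
    by (simp add: permeability_def case_prod_beta)
  define lo where "lo = Min (?\<kappa> ` {1..n})"
  define hi where "hi = (\<Sum>i=1..n. ?\<kappa> i)"
  have "lo > 0" using assms by (auto simp: lo_def)
  then have lo_pos: "0 < ereal lo" by simp
  have lower: "AE z in leb_D. lo \<le> permeability n u z"
    using AE_off_interfaces[of n "fst u"] AE_space[of leb_D]
  proof eventually_elim
    fix z assume "off_interfaces n (fst u) z" "z \<in> space leb_D"
    then have "\<exists>i\<in>{1..n}. z \<in> layer n (fst u) i"
      by (intro layers_cover assms(1)) simp_all
    then obtain i where i: "i \<in> {1..n}" "z \<in> layer n (fst u) i" by blast
    have "lo \<le> ?\<kappa> i" using i(1) by (simp add: lo_def)
    also have "?\<kappa> i = ?\<kappa> i * indicator (layer n (fst u) i) z" using i(2) by simp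
    also have "\<dots> \<le> permeability n u z"
      unfolding eq using i(1) pos
      by (intro member_le_sum) (auto simp: less_imp_le)
    finally show "lo \<le> permeability n u z" .
  qed
  have upper: "\<bar>permeability n u z\<bar> \<le> hi" for z
  proof -
    have "0 \<le> permeability n u z"
      unfolding eq using pos by (intro sum_nonneg) (auto simp: less_imp_le)
    moreover have "permeability n u z \<le> hi"
      unfolding eq hi_def using pos by (intro sum_mono) (auto simp: indicator_def less_imp_le)
    ultimately show ?thesis by simp
  qed
  have [measurable]: "permeability n u \<in> borel_measurable leb_D"
    by (rule borel_measurable_permeability)
  have "esssup leb_D (\<lambda>z. ereal \<bar>permeability n u z\<bar>) \<le> ereal hi"
    using upper by (intro esssup_I) auto
  moreover have "esssup leb_D (\<lambda>z. - ereal (permeability n u z)) \<le> ereal (- lo)"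
    using lower by (intro esssup_I) (auto elim!: eventually_mono)
  then have "ereal lo \<le> - esssup leb_D (\<lambda>z. - ereal (permeability n u z))"
    by (subst (asm) ereal_minus_le_minus[symmetric]) (simp only: uminus_ereal.simps minus_minus)
  then have "0 < - esssup leb_D (\<lambda>z. - ereal (permeability n u z))"
    by (rule less_le_trans[OF lo_pos])
  moreover have "esssup leb_D (\<lambda>z. ereal \<bar>permeability n u z\<bar>) < \<infinity>"
    using calculation(1) by (rule le_less_trans) simp
  ultimately show ?thesis
    unfolding permeabilities_def
    by (intro CollectI conjI borel_measurable_permeability)
qed

text \<open>Off the interfaces all inequalities that decide about the layer of a point are strict, and strict inequalities
  between continuous functions persist under small perturbations.\<close>

lemma layer_indicator_tendsto:
  assumes i: "i \<in> {1..n}" and lim: "w \<longlonglongrightarrow> ug" and off: "off_interfaces n ug z"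
  shows "(\<lambda>m. indicator (layer n (w m) i) z :: real) \<longlonglongrightarrow> indicator (layer n ug i) z"
proof -
  have pos: "(\<lambda>m. interface_position (w m) k (fst z)) \<longlonglongrightarrow> interface_position ug k (fst z)" for k
    using continuous_on_tendsto_compose[OF continuous_interface_position lim] by simp
  have stable: "\<forall>\<^sub>F m in sequentially. (interface_position (w m) k (fst z) < 1 - snd z \<longleftrightarrow>
      interface_position ug k (fst z) < 1 - snd z) \<and> (1 - snd z < interface_position (w m) k (fst z) \<longleftrightarrow>
      1 - snd z < interface_position ug k (fst z))" if "k \<in> {1..<n}" for k
  proof -
    have "1 - snd z \<noteq> interface_position ug k (fst z)"
      using off that by (auto simp: off_interfaces_def)
    then consider "interface_position ug k (fst z) < 1 - snd z" | "1 - snd z < interface_position ug k (fst z)"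
      by linarith
    then show ?thesis
    proof cases
      case 1
      show ?thesis using order_tendstoD(2)[OF pos 1] by eventually_elim (use 1 in auto)
    next
      case 2
      show ?thesis using order_tendstoD(1)[OF pos 2] by eventually_elim (use 2 in auto)
    qed
  qed
  have "\<forall>\<^sub>F m in sequentially. z \<in> layer n (w m) i \<longleftrightarrow> z \<in> layer n ug i"
  proof -
    have 1: "\<forall>\<^sub>F m in sequentially. i = 1 \<or> (interface_position (w m) (i - 1) (fst z) < 1 - snd z \<longleftrightarrow>
      interface_position ug (i - 1) (fst z) < 1 - snd z)"
    proof (cases "i = 1")
      case False
      then have "i - 1 \<in> {1..<n}" using i by auto
      from stable[OF this] show ?thesis by eventually_elim simp
    qed simp
    have 2: "\<forall>\<^sub>F m in sequentially. i = n \<or> (1 - snd z < interface_position (w m) i (fst z) \<longleftrightarrow>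
      1 - snd z < interface_position ug i (fst z))"
    proof (cases "i = n")
      case False
      then have "i \<in> {1..<n}" using i by auto
      from stable[OF this] show ?thesis by eventually_elim simp
    qed simp
    from 1 2 show ?thesis
      by eventually_elim (use in_layer_iff[OF i] in blast)
  qed
  then have "\<forall>\<^sub>F m in sequentially. indicator (layer n ug i) z = (indicator (layer n (w m) i) z :: real)"
    by eventually_elim (simp add: indicator_def)
  then show ?thesis
    by (rule Lim_transform_eventually[OF tendsto_const])
qed

text \<open>Dominated convergence: almost every point lies off the interfaces of the limit, where the permeabilities
  converge, and a convergent sequence of parameters has bounded permeabilities.\<close>

lemma continuous_energy_form_permeability:
  assumes v: "v \<in> V"
  shows "continuous_on UNIV (\<lambda>u. energy_form (permeability n u) v v)"
  unfolding continuous_on_sequentially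
proof (intro allI ballI impI, elim conjE)
  fix w :: "nat \<Rightarrow> param" and u :: param
  assume lim: "w \<longlonglongrightarrow> u"
  have lim1: "(\<lambda>m. fst (w m)) \<longlonglongrightarrow> fst u" and "(\<lambda>m. snd (w m)) \<longlonglongrightarrow> snd u"
    using lim by (auto intro: tendsto_fst tendsto_snd)
  then have lim2: "(\<lambda>m. snd (w m) i) \<longlonglongrightarrow> snd u i" for i
    using continuous_on_tendsto_compose[OF continuous_on_product_coordinates[of i]] by simp
  have eq: "permeability n u z = (\<Sum>i=1..n. snd u i * indicator (layer n (fst u) i) z)" for u z
    by (simp add: permeability_def case_prod_beta)
  have "(\<lambda>m. \<Sum>i=1..n. \<bar>snd (w m) i\<bar>) \<longlonglongrightarrow> (\<Sum>i=1..n. \<bar>snd u i\<bar>)"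
    by (intro tendsto_intros lim2)
  then obtain B where B: "\<And>m. norm (\<Sum>i=1..n. \<bar>snd (w m) i\<bar>) \<le> B"
    using convergent_imp_Bseq convergentI BseqD by metis
  have bound: "\<bar>permeability n (w m) z\<bar> \<le> B" for m z
  proof -
    have "\<bar>permeability n (w m) z\<bar> \<le> (\<Sum>i=1..n. \<bar>snd (w m) i * indicator (layer n (fst (w m)) i) z\<bar>)"
      unfolding eq by (rule sum_abs)
    also have "\<dots> \<le> (\<Sum>i=1..n. \<bar>snd (w m) i\<bar>)"
      by (intro sum_mono) (auto simp: indicator_def)
    also have "\<dots> \<le> B" using B[of m] by simp
    finally show ?thesis .
  qed
  have grad: "grad v \<in> borel_measurable leb_D"
    by (rule L2_D_measurable[OF grad_L2_D[OF v]])
  have "(\<lambda>m. energy_form (permeability n (w m)) v v) \<longlonglongrightarrow> energy_form (permeability n u) v v"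
    unfolding energy_form_def
  proof (rule integral_dominated_convergence[where w = "\<lambda>z. B * (grad v z \<bullet> grad v z)"])
    show "integrable leb_D (\<lambda>z. B * (grad v z \<bullet> grad v z))"
      using L2_D_inner_integrable[OF grad_L2_D[OF v] grad_L2_D[OF v]] by simp
    show "AE z in leb_D. (\<lambda>m. permeability n (w m) z * (grad v z \<bullet> grad v z)) \<longlonglongrightarrow>
        permeability n u z * (grad v z \<bullet> grad v z)"
      using AE_off_interfaces[of n "fst u"]
    proof eventually_elim
      fix z assume "off_interfaces n (fst u) z"
      then show "(\<lambda>m. permeability n (w m) z * (grad v z \<bullet> grad v z)) \<longlonglongrightarrow>
          permeability n u z * (grad v z \<bullet> grad v z)"
        unfolding eq by (intro tendsto_intros lim2 layer_indicator_tendsto lim1) auto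
    qed
    show "AE z in leb_D. norm (permeability n (w m) z * (grad v z \<bullet> grad v z)) \<le> B * (grad v z \<bullet> grad v z)" for m
      using bound by (intro AE_I2) (simp add: abs_mult mult_right_mono)
  qed (use grad in \<open>auto intro!: borel_measurable_times borel_measurable_inner borel_measurable_permeability\<close>)
  then show "((\<lambda>u. energy_form (permeability n u) v v) \<circ> w) \<longlonglongrightarrow> energy_form (permeability n u) v v"
    by (simp add: comp_def)
qed

section \<open>Measurability of the observation map\<close>

text \<open>Parameter vectors are functions that are constantly \<open>undefined\<close> off their index set \<open>I\<close>.  They are
  compared with the space of all functions on the naturals, whose product topology is second countable and has
  the product \<open>\<sigma>\<close>-algebra as its Borel sets.\<close>

lemma borel_measurable_PiM_inclusion:
  "(\<lambda>x. x) \<in> borel_measurable (\<Pi>\<^sub>M i\<in>I. lborel :: real measure)" for I :: "nat set"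
proof (rule measurable_coordinatewise_then_product)
  fix i
  show "(\<lambda>x. x i) \<in> borel_measurable (\<Pi>\<^sub>M i\<in>I. lborel :: real measure)"
  proof (cases "i \<in> I")
    case True
    then show ?thesis using measurable_component_singleton[of i I "\<lambda>_. lborel"] by simp
  next
    case False
    then have "x i = undefined" if "x \<in> space (\<Pi>\<^sub>M i\<in>I. lborel :: real measure)" for x
      using that by (auto simp: space_PiM PiE_def extensional_def)
    then show ?thesis by (subst measurable_cong[of _ _ "\<lambda>_. undefined"]) auto
  qed
qed

lemma borel_measurable_param_inclusion: "(\<lambda>u. u) \<in> borel_measurable (param_lebesgue n)"
proof -
  have "(\<lambda>u. ((fst (fst u), fst (snd (fst u)), snd (snd (fst u))), snd u)) \<in> borel_measurable (param_lebesgue n)"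
    unfolding param_lebesgue_def
    by (intro borel_measurable_Pair measurable_compose[OF _ borel_measurable_PiM_inclusion]) measurable
  then show ?thesis by simp
qed

lemma space_param_space: "space (param_space n cstar) = param_set n cstar"
  unfolding param_space_def param_lebesgue_def
  by (auto simp: space_restrict_space space_pair_measure space_PiM param_set_def thicknesses_def PiE_def)

lemma open_in_param_space:
  assumes "open W"
  shows "param_set n cstar \<inter> W \<in> sets (param_space n cstar)"
proof -
  have "(\<lambda>u. u) \<in> borel_measurable (param_space n cstar)"
    unfolding param_space_def by (intro measurable_restrict_space1 borel_measurable_param_inclusion)
  from measurable_sets[OF this borel_open[OF assms]] show ?thesis
    by (simp add: space_param_space Int_commute)
qed

lemma param_set_permeability:
  assumes "n \<ge> 1" "u \<in> param_set n cstar"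
  shows "permeability n u \<in> permeabilities"
  using assms by (intro permeability_in_permeabilities) (auto simp: param_set_def PiE_def)

text \<open>A supremum of continuous functions, even of uncountably many, has open superlevel sets.\<close>

lemma borel_measurable_solution_energy:
  assumes f: "f \<in> V_dual" and n: "n \<ge> 1"
  shows "(\<lambda>u. f (solution_map f (permeability n u))) \<in> borel_measurable (param_space n cstar)"
  unfolding borel_measurable_iff_greater
proof
  fix c
  define W where "W = (\<Union>v\<in>V. {u. c < 2 * f v - energy_form (permeability n u) v v})"
  have "open W"
    unfolding W_def
    by (intro open_UN ballI open_Collect_less continuous_intros continuous_energy_form_permeability)
  moreover have "{u \<in> space (param_space n cstar). c < f (solution_map f (permeability n u))} =
      param_set n cstar \<inter> W"
    using less_solution_energy_iff[OF f param_set_permeability[OF n]]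
    by (auto simp: W_def space_param_space)
  ultimately show "{u \<in> space (param_space n cstar). c < f (solution_map f (permeability n u))}
      \<in> sets (param_space n cstar)"
    using open_in_param_space by simp
qed

lemma borel_measurable_observation_map:
  assumes n: "n \<ge> 1" and f: "f \<in> V_dual" and l: "\<And>j. l j \<in> V_dual"
  shows "observation_map n f l \<in> borel_measurable (param_space n cstar)"
proof -
  have "(\<lambda>u. l j (solution_map f (permeability n u))) \<in> borel_measurable (param_space n cstar)" for j
  proof -
    let ?g = "\<lambda>p. f p + l j p"
    have "(\<lambda>u. (?g (solution_map ?g (permeability n u)) - f (solution_map f (permeability n u)) -
        l j (solution_map (l j) (permeability n u))) / 2) \<in> borel_measurable (param_space n cstar)"
      by (intro borel_measurable_divide borel_measurable_diff borel_measurable_const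
          borel_measurable_solution_energy[OF f n] borel_measurable_solution_energy[OF l n]
          borel_measurable_solution_energy[OF V_dual_add[OF f l] n])
    then show ?thesis
      by (rule measurable_cong[THEN iffD1, rotated])
        (simp only: space_param_space solution_polarization[OF f l param_set_permeability[OF n]])
  qed
  then show ?thesis
    unfolding borel_measurable_euclidean_space[of "observation_map n f l"]
    by (auto simp: Basis_vec_def inner_axis observation_map_def)
qed

section \<open>The prior\<close>

text \<open>Each admissible prior has its whole mass on the positive half-line, so restricting the parameters to positive
  permeabilities does not change the total mass.\<close>

lemma permeability_density_integral:
  assumes "permeability_density g"
  shows "(\<integral>\<^sup>+t. ennreal (g t) * indicator {0<..} t \<partial>lborel) = 1"
proof -
  have [measurable]: "g \<in> borel_measurable borel"
    using assms by (auto simp: permeability_density_def)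
  have "prob_space (density lborel g) \<and> emeasure (density lborel g) {..0} = 0"
    using assms unfolding permeability_density_def
  proof (elim conjE disjE exE)
    fix m \<sigma> :: real
    assume "0 < \<sigma>" and eq: "density lborel g = distr (density lborel (normal_density m \<sigma>)) borel exp"
    interpret N: prob_space "density lborel (normal_density m \<sigma>)"
      using \<open>0 < \<sigma>\<close> by (rule prob_space_normal_density)
    have "emeasure (density lborel g) {..0} = emeasure (density lborel (normal_density m \<sigma>)) (exp -` {..0} \<inter> UNIV)"
      unfolding eq by (subst emeasure_distr) auto
    also have "exp -` {..0} \<inter> UNIV = ({} :: real set)" by (auto simp: not_le)
    finally show ?thesis unfolding eq by (simp add: N.prob_space_distr)
  next
    fix lo hi :: real
    assume "0 < lo" "lo < hi" and eq: "density lborel g = uniform_measure lborel {lo..hi}"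
    have "{lo..hi} \<inter> {..0} = {}" using \<open>0 < lo\<close> by auto
    then show ?thesis
      unfolding eq using \<open>lo < hi\<close>
      by (auto simp: emeasure_uniform_measure intro!: prob_space_uniform_measure)
  next
    fix r :: real
    assume "0 < r" and eq: "density lborel g = density lborel (exponential_density r)"
    have "emeasure (density lborel (exponential_density r)) {..0} =
        (\<integral>\<^sup>+t. ennreal (exponential_density r t) * indicator {..0} t \<partial>lborel)"
      by (subst emeasure_density) auto
    also have "\<dots> = 0"
      using AE_lborel_singleton[of 0]
      by (subst nn_integral_0_iff_AE) (auto simp: exponential_density_def indicator_def elim!: eventually_mono)
    finally show ?thesis
      unfolding eq using prob_space_exponential_density[OF \<open>0 < r\<close>] by simp
  qed
  then have prob: "emeasure (density lborel g) UNIV = 1" and null: "emeasure (density lborel g) {..0} = 0"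
    using prob_space.emeasure_space_1[of "density lborel g"] by auto
  have "emeasure (density lborel g) ({0<..} \<union> {..0}) =
      emeasure (density lborel g) {0<..} + emeasure (density lborel g) {..0}"
    by (rule plus_emeasure[symmetric]) auto
  moreover have "{0<..} \<union> {..0} = (UNIV :: real set)" by auto
  ultimately have "emeasure (density lborel g) {0<..} = 1"
    using prob null by simp
  then show ?thesis by (simp add: emeasure_density)
qed

lemma sets_thicknesses: "thicknesses n \<in> sets (\<Pi>\<^sub>M i\<in>{1..<n}. lborel)"
proof -
  have "thicknesses n = {x \<in> space (\<Pi>\<^sub>M i\<in>{1..<n}. lborel). (\<Sum>i\<in>{1..<n}. x i) \<le> 1 \<and> (\<forall>i\<in>{1..<n}. 0 \<le> x i)}"
    by (auto simp: thicknesses_def space_PiM)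
  also have "\<dots> \<in> sets (\<Pi>\<^sub>M i\<in>{1..<n}. lborel)" by measurable
  finally show ?thesis .
qed

text \<open>The set lies between the cubes with side lengths \<open>1/n\<close> and \<open>1\<close>.\<close>

lemma emeasure_thicknesses:
  "0 < emeasure (\<Pi>\<^sub>M i\<in>{1..<n}. lborel) (thicknesses n)"
  "emeasure (\<Pi>\<^sub>M i\<in>{1..<n}. lborel) (thicknesses n) < \<infinity>"
proof -
  interpret product_sigma_finite "\<lambda>_::nat. lborel :: real measure" ..
  have box: "emeasure (\<Pi>\<^sub>M i\<in>{1..<n}. lborel) (\<Pi>\<^sub>E i\<in>{1..<n}. {0..r}) = ennreal r ^ (n - 1)" if "0 \<le> r" for r
    using that by (subst emeasure_PiM) auto
  have "(\<Pi>\<^sub>E i\<in>{1..<n}. {0..1 / real n}) \<subseteq> thicknesses n"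
  proof
    fix x :: "nat \<Rightarrow> real" assume x: "x \<in> (\<Pi>\<^sub>E i\<in>{1..<n}. {0..1 / real n})"
    have "(\<Sum>i\<in>{1..<n}. x i) \<le> of_nat (card {1..<n}) * (1 / real n)"
      using x by (intro sum_bounded_above) auto
    also have "\<dots> \<le> 1" by (cases "n = 0") (auto simp: field_simps)
    finally show "x \<in> thicknesses n"
      using x by (auto simp: thicknesses_def PiE_iff)
  qed
  then have "ennreal (1 / real n) ^ (n - 1) \<le> emeasure (\<Pi>\<^sub>M i\<in>{1..<n}. lborel) (thicknesses n)"
    using emeasure_mono[OF _ sets_thicknesses] box[of "1 / real n"] by (metis divide_nonneg_nonneg of_nat_0_le_iff zero_le_one)
  moreover have "0 < ennreal (1 / real n) ^ (n - 1)"
    by (cases "n = 0") (auto simp: ennreal_power ennreal_zero_less_divide)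
  ultimately show "0 < emeasure (\<Pi>\<^sub>M i\<in>{1..<n}. lborel) (thicknesses n)"
    by (rule less_le_trans[rotated])
  have "thicknesses n \<subseteq> (\<Pi>\<^sub>E i\<in>{1..<n}. {0..1})"
  proof
    fix x assume x: "x \<in> thicknesses n"
    have "x i \<le> 1" if "i \<in> {1..<n}" for i
    proof -
      have "x i \<le> (\<Sum>i\<in>{1..<n}. x i)"
        using x that by (intro member_le_sum) (auto simp: thicknesses_def)
      then show ?thesis using x by (simp add: thicknesses_def)
    qed
    then show "x \<in> (\<Pi>\<^sub>E i\<in>{1..<n}. {0..1})"
      using x by (auto simp: thicknesses_def PiE_iff)
  qed
  then have "emeasure (\<Pi>\<^sub>M i\<in>{1..<n}. lborel) (thicknesses n) \<le> ennreal 1 ^ (n - 1)"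
    using box[of 1] emeasure_mono[of _ "\<Pi>\<^sub>E i\<in>{1..<n}. {0..1}" "\<Pi>\<^sub>M i\<in>{1..<n}. lborel :: real measure"]
    by (simp add: sets_PiM_I_finite)
  then show "emeasure (\<Pi>\<^sub>M i\<in>{1..<n}. lborel) (thicknesses n) < \<infinity>"
    by (rule le_less_trans) simp
qed

lemma nn_integral_uniform_density:
  assumes "A \<in> sets M" "0 < emeasure M A" "emeasure M A < \<infinity>"
  shows "(\<integral>\<^sup>+x. ennreal (uniform_density M A x) \<partial>M) = 1"
proof -
  have m: "0 < measure M A" "emeasure M A = ennreal (measure M A)"
    using assms(2,3) by (auto simp: measure_def enn2real_positive_iff)
  have "(\<integral>\<^sup>+x. ennreal (uniform_density M A x) \<partial>M) = (\<integral>\<^sup>+x. ennreal (1 / measure M A) * indicator A x \<partial>M)"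
    by (intro nn_integral_cong) (auto simp: uniform_density_def indicator_def)
  also have "\<dots> = ennreal (1 / measure M A) * ennreal (measure M A)"
    using assms(1) m by (simp add: nn_integral_cmult_indicator)
  also have "\<dots> = 1"
    using m(1) by (simp flip: ennreal_mult)
  finally show ?thesis .
qed

lemma nn_integral_pair_times:
  assumes [measurable]: "f \<in> borel_measurable M" "g \<in> borel_measurable N" and "sigma_finite_measure N"
  shows "(\<integral>\<^sup>+z. f (fst z) * g (snd z) \<partial>(M \<Otimes>\<^sub>M N)) = (\<integral>\<^sup>+x. f x \<partial>M) * (\<integral>\<^sup>+y. g y \<partial>N)"
proof -
  interpret sigma_finite_measure N by fact
  have "(\<integral>\<^sup>+z. f (fst z) * g (snd z) \<partial>(M \<Otimes>\<^sub>M N)) = (\<integral>\<^sup>+x. (\<integral>\<^sup>+y. f x * g y \<partial>N) \<partial>M)"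
    by (subst nn_integral_fst[symmetric]) auto
  also have "\<dots> = (\<integral>\<^sup>+x. f x \<partial>M) * (\<integral>\<^sup>+y. g y \<partial>N)"
    by (simp add: nn_integral_cmult nn_integral_multc)
  finally show ?thesis .
qed

lemma sigma_finite_PiM_lborel: "finite I \<Longrightarrow> sigma_finite_measure (\<Pi>\<^sub>M i\<in>I. lborel :: real measure)"
proof -
  assume "finite I"
  interpret product_sigma_finite "\<lambda>_. lborel :: real measure" ..
  interpret finite_product_sigma_finite "\<lambda>_. lborel :: real measure" I
    by standard fact
  show ?thesis ..
qed

lemma sets_param_set: "param_set n cstar \<in> sets (param_lebesgue n)"
proof -
  have "({1..n} \<rightarrow>\<^sub>E {0<..}) \<in> sets (\<Pi>\<^sub>M i\<in>{1..n}. lborel :: real measure)"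
    by (intro sets_PiM_I_finite) auto
  then show ?thesis
    unfolding param_set_def param_lebesgue_def
    by (intro pair_measureI sets_thicknesses) auto
qed

lemma borel_measurable_uniform_density:
  assumes [measurable]: "A \<in> sets M"
  shows "uniform_density M A \<in> borel_measurable M"
  unfolding uniform_density_def by measurable

lemma borel_measurable_prior_density:
  assumes "\<And>i. i \<in> {1..n} \<Longrightarrow> permeability_density (\<pi> i)"
  shows "prior_density n cstar \<pi> \<in> borel_measurable (param_lebesgue n)"
proof -
  have [measurable]: "\<pi> i \<in> borel_measurable lborel" if "i \<in> {1..n}" for i
    using assms[OF that] by (simp add: permeability_density_def)
  note [measurable] = borel_measurable_uniform_density[OF sets_thicknesses]
    borel_measurable_uniform_density[of "{-cstar..cstar}" lborel]
  show ?thesis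
    unfolding prior_density_def param_lebesgue_def case_prod_beta by measurable
qed

text \<open>Tonelli's theorem factors the total mass into one-dimensional integrals and the integrals of uniform densities.
  The indicator of the positive permeabilities, from the restriction to \<open>param_set\<close>, is split over the factors.\<close>

lemma prob_space_prior:
  assumes "cstar > 0" and \<pi>: "\<And>i. i \<in> {1..n} \<Longrightarrow> permeability_density (\<pi> i)"
  shows "prob_space (prior n cstar \<pi>)"
proof
  let ?A = "\<Pi>\<^sub>M i\<in>{1..<n}. lborel :: real measure" and ?K = "\<Pi>\<^sub>M i\<in>{1..n}. lborel :: real measure"
  let ?ua = "uniform_density ?A (thicknesses n)" and ?uc = "uniform_density lborel {-cstar..cstar}"
  let ?k = "\<lambda>\<kappa>. \<Prod>i=1..n. \<pi> i (\<kappa> i)"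
  note d[measurable] = borel_measurable_uniform_density[OF sets_thicknesses]
    borel_measurable_uniform_density[of "{-cstar..cstar}" lborel]
  have [measurable]: "\<pi> i \<in> borel_measurable lborel" if "i \<in> {1..n}" for i
    using \<pi>[OF that] by (simp add: permeability_density_def)
  have nonneg: "0 \<le> \<pi> i t" if "i \<in> {1..n}" for i t
    using \<pi>[OF that] by (simp add: permeability_density_def)
  interpret product_sigma_finite "\<lambda>_::nat. lborel :: real measure" ..
  have sf: "sigma_finite_measure ?A" "sigma_finite_measure ?K"
    by (simp_all add: sigma_finite_PiM_lborel)
  interpret AC: pair_sigma_finite ?A "lborel :: real measure"
    using sf(1) by (simp add: pair_sigma_finite_def sigma_finite_lborel)
  have sf_AC: "sigma_finite_measure (?A \<Otimes>\<^sub>M (lborel :: real measure))" ..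

  have k1: "(\<integral>\<^sup>+\<kappa>. ennreal (?k \<kappa>) * indicator ({1..n} \<rightarrow>\<^sub>E {0<..}) \<kappa> \<partial>?K) = 1"
  proof -
    have "(\<integral>\<^sup>+\<kappa>. ennreal (?k \<kappa>) * indicator ({1..n} \<rightarrow>\<^sub>E {0<..}) \<kappa> \<partial>?K) =
        (\<integral>\<^sup>+\<kappa>. (\<Prod>i=1..n. ennreal (\<pi> i (\<kappa> i)) * indicator {0<..} (\<kappa> i)) \<partial>?K)"
    proof (rule nn_integral_cong)
      fix \<kappa> assume "\<kappa> \<in> space ?K"
      then have "indicator ({1..n} \<rightarrow>\<^sub>E {0<..}) \<kappa> = (\<Prod>i=1..n. indicator {0<..} (\<kappa> i) :: ennreal)"
        by (auto simp: indicator_def space_PiM PiE_iff prod.neutral intro!: prod_zero[symmetric])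
      then show "ennreal (?k \<kappa>) * indicator ({1..n} \<rightarrow>\<^sub>E {0<..}) \<kappa> =
          (\<Prod>i=1..n. ennreal (\<pi> i (\<kappa> i)) * indicator {0<..} (\<kappa> i))"
        using prod_ennreal[of "{1..n}" "\<lambda>i. \<pi> i (\<kappa> i)"] nonneg by (simp add: prod.distrib)
    qed
    also have "\<dots> = (\<Prod>i=1..n. \<integral>\<^sup>+t. ennreal (\<pi> i t) * indicator {0<..} t \<partial>lborel)"
      by (intro product_nn_integral_prod) auto
    also have "\<dots> = 1"
      using permeability_density_integral[OF \<pi>] by simp
    finally show ?thesis .
  qed
  have "emeasure (prior n cstar \<pi>) (space (prior n cstar \<pi>)) =
      (\<integral>\<^sup>+u. ennreal (prior_density n cstar \<pi> u) \<partial>param_space n cstar)"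
    using borel_measurable_prior_density[OF \<pi>] unfolding prior_def param_space_def
    by (subst emeasure_density) (auto simp: measurable_restrict_space1 intro!: nn_integral_cong)
  also have "\<dots> = (\<integral>\<^sup>+u. ennreal (prior_density n cstar \<pi> u) * indicator (param_set n cstar) u \<partial>param_lebesgue n)"
    unfolding param_space_def using sets_param_set by (subst nn_integral_restrict_space) auto
  also have "\<dots> = (\<integral>\<^sup>+u. (ennreal (?ua (fst (fst u))) * (ennreal (?ua (fst (snd (fst u)))) * ennreal (?uc (snd (snd (fst u)))))) *
      (ennreal (?k (snd u)) * indicator ({1..n} \<rightarrow>\<^sub>E {0<..}) (snd u)) \<partial>param_lebesgue n)"
    using nonneg
    by (intro nn_integral_cong)
      (auto simp: prior_density_def param_set_def uniform_density_def indicator_def ennreal_mult'[symmetric] prod_nonneg mult.assoc)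
  also have "\<dots> = (\<integral>\<^sup>+a. ennreal (?ua a) \<partial>?A) * ((\<integral>\<^sup>+b. ennreal (?ua b) \<partial>?A) * (\<integral>\<^sup>+c. ennreal (?uc c) \<partial>lborel)) * 1"
  proof -
    let ?f3 = "\<lambda>bc. ennreal (?ua (fst bc)) * ennreal (?uc (snd bc))"
    let ?f2 = "\<lambda>g. ennreal (?ua (fst g)) * ?f3 (snd g)"
    let ?h = "\<lambda>\<kappa>. ennreal (?k \<kappa>) * indicator ({1..n} \<rightarrow>\<^sub>E {0<..}) \<kappa>"
    have m3: "?f3 \<in> borel_measurable (?A \<Otimes>\<^sub>M lborel)" by measurable
    have m2: "?f2 \<in> borel_measurable (?A \<Otimes>\<^sub>M (?A \<Otimes>\<^sub>M lborel))" using m3 by measurable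
    have "({1..n} \<rightarrow>\<^sub>E {0<..}) \<in> sets ?K" by (intro sets_PiM_I_finite) auto
    then have mh: "?h \<in> borel_measurable ?K" by measurable
    have "(\<integral>\<^sup>+u. ?f2 (fst u) * ?h (snd u) \<partial>param_lebesgue n) =
        (\<integral>\<^sup>+g. ?f2 g \<partial>(?A \<Otimes>\<^sub>M (?A \<Otimes>\<^sub>M lborel))) * (\<integral>\<^sup>+\<kappa>. ?h \<kappa> \<partial>?K)"
      unfolding param_lebesgue_def by (rule nn_integral_pair_times[OF m2 mh sf(2)])
    also have "(\<integral>\<^sup>+g. ?f2 g \<partial>(?A \<Otimes>\<^sub>M (?A \<Otimes>\<^sub>M lborel))) =
        (\<integral>\<^sup>+a. ennreal (?ua a) \<partial>?A) * (\<integral>\<^sup>+bc. ?f3 bc \<partial>(?A \<Otimes>\<^sub>M lborel))"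
      by (rule nn_integral_pair_times[OF _ m3 sf_AC]) measurable
    also have "(\<integral>\<^sup>+bc. ?f3 bc \<partial>(?A \<Otimes>\<^sub>M lborel)) = (\<integral>\<^sup>+b. ennreal (?ua b) \<partial>?A) * (\<integral>\<^sup>+c. ennreal (?uc c) \<partial>lborel)"
      by (rule nn_integral_pair_times) (measurable, rule sigma_finite_lborel)
    finally show ?thesis unfolding k1 .
  qed
  also have "\<dots> = 1"
  proof -
    have "(\<integral>\<^sup>+c. ennreal (?uc c) \<partial>lborel) = 1"
      using assms(1) by (intro nn_integral_uniform_density) auto
    then show ?thesis
      unfolding nn_integral_uniform_density[OF sets_thicknesses emeasure_thicknesses] by simp
  qed
  finally show "emeasure (prior n cstar \<pi>) (space (prior n cstar \<pi>)) = 1" .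
qed

section \<open>Conditioning on a noisy observation\<close>

lemma independent_joint_distribution:
  assumes "prob_space M" and ind: "independent M S X N Y"
  shows "distr M (S \<Otimes>\<^sub>M N) (\<lambda>\<omega>. (X \<omega>, Y \<omega>)) = distr M S X \<Otimes>\<^sub>M distr M N Y"
proof (rule sym, rule pair_measure_eqI)
  interpret prob_space M by fact
  have [measurable]: "X \<in> M \<rightarrow>\<^sub>M S" "Y \<in> M \<rightarrow>\<^sub>M N"
    and indep: "indep_set (sets (vimage_algebra (space M) X S)) (sets (vimage_algebra (space M) Y N))"
    using ind by (auto simp: independent_def)
  show "sigma_finite_measure (distr M S X)" "sigma_finite_measure (distr M N Y)"
    by (intro prob_space_imp_sigma_finite prob_space_distr; measurable)+
  show "sets (distr M S X \<Otimes>\<^sub>M distr M N Y) = sets (distr M (S \<Otimes>\<^sub>M N) (\<lambda>\<omega>. (X \<omega>, Y \<omega>)))"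
    by (simp cong: sets_pair_measure_cong)
  fix A B assume "A \<in> sets (distr M S X)" "B \<in> sets (distr M N Y)"
  then have [measurable]: "A \<in> sets S" "B \<in> sets N" by auto
  have "X -` A \<inter> space M \<in> sets (vimage_algebra (space M) X S)" "Y -` B \<inter> space M \<in> sets (vimage_algebra (space M) Y N)"
    by (intro in_vimage_algebra; fact)+
  from indep_setD[OF indep this] have "prob ((X -` A \<inter> space M) \<inter> (Y -` B \<inter> space M)) = prob (X -` A \<inter> space M) * prob (Y -` B \<inter> space M)"
    .
  moreover have "(\<lambda>\<omega>. (X \<omega>, Y \<omega>)) -` (A \<times> B) \<inter> space M = (X -` A \<inter> space M) \<inter> (Y -` B \<inter> space M)"
    by auto
  ultimately show "emeasure (distr M S X) A * emeasure (distr M N Y) B =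
      emeasure (distr M (S \<Otimes>\<^sub>M N) (\<lambda>\<omega>. (X \<omega>, Y \<omega>))) (A \<times> B)"
    by (simp add: emeasure_distr emeasure_eq_measure ennreal_mult)
qed

lemma nn_integral_lborel_translate:
  fixes f :: "'a::euclidean_space \<Rightarrow> ennreal"
  assumes [measurable]: "f \<in> borel_measurable borel"
  shows "(\<integral>\<^sup>+x. f (a + x) \<partial>lborel) = (\<integral>\<^sup>+x. f x \<partial>lborel)"
proof -
  have "(\<integral>\<^sup>+x. f x \<partial>lborel) = (\<integral>\<^sup>+x. f x \<partial>distr lborel borel ((+) a))"
    by (simp only: lborel_distr_plus)
  also have "\<dots> = (\<integral>\<^sup>+x. f (a + x) \<partial>lborel)"
    by (subst nn_integral_distr) auto
  finally show ?thesis ..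
qed

text \<open>A prior \<open>P\<close>, a forward map \<open>h\<close>, and a noise density that is proportional to \<open>r\<close>: the likelihood of the
  datum \<open>y\<close> at \<open>v\<close> is \<open>r (y - h v)\<close>.  The constant of proportionality cancels in Bayes' formula.  The bounds
  on \<open>r\<close> make the normalising constant finite and positive for all \<open>y\<close>.\<close>

locale additive_noise_likelihood =
  fixes P :: "'u measure" and h :: "'u \<Rightarrow> 'e::euclidean_space" and r :: "'e \<Rightarrow> real"
  assumes prior: "prob_space P"
    and h [measurable]: "h \<in> borel_measurable P"
    and r [measurable]: "r \<in> borel_measurable borel"
    and r_pos: "0 < r e" and r_le_1: "r e \<le> 1"
begin

sublocale prior: prob_space P by (rule prior)

definition normaliser :: "'e \<Rightarrow> real" where
  "normaliser y = (LINT v|P. r (y - h v))"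

definition posterior :: "'e \<Rightarrow> 'u measure" where
  "posterior y = density P (\<lambda>v. ennreal (r (y - h v) / normaliser y))"

lemma integrable_likelihood: "integrable P (\<lambda>v. r (y - h v))"
  using r_pos r_le_1 by (intro prior.integrable_const_bound[of _ 1]) (auto simp: less_imp_le abs_of_pos)

lemma normaliser_pos: "0 < normaliser y"
proof -
  have "normaliser y \<noteq> 0"
  proof
    assume "normaliser y = 0"
    then have "AE v in P. r (y - h v) = 0"
      unfolding normaliser_def
      using integral_nonneg_eq_0_iff_AE[OF integrable_likelihood] r_pos by (simp add: less_imp_le)
    then have "AE v in P. False"
      using r_pos by (auto elim!: eventually_mono simp: less_le)
    then show False by simp
  qed
  moreover have "0 \<le> normaliser y"
    unfolding normaliser_def using r_pos by (intro Bochner_Integration.integral_nonneg) (simp add: less_imp_le)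
  ultimately show ?thesis by simp
qed

lemma nn_integral_likelihood: "(\<integral>\<^sup>+v. ennreal (r (y - h v)) \<partial>P) = ennreal (normaliser y)"
  unfolding normaliser_def using r_pos
  by (intro nn_integral_eq_integral integrable_likelihood) (auto simp: less_imp_le)

lemma measurable_likelihood [measurable]:
  "(\<lambda>(y, v). r (y - h v)) \<in> borel_measurable (borel \<Otimes>\<^sub>M P)"
  by measurable

lemma measurable_normaliser [measurable]: "normaliser \<in> borel_measurable borel"
  unfolding normaliser_def using measurable_likelihood by measurable

lemma sets_posterior [simp]: "sets (posterior y) = sets P"
  by (simp add: posterior_def)

lemma emeasure_posterior:
  assumes [measurable]: "A \<in> sets P"
  shows "emeasure (posterior y) A = (\<integral>\<^sup>+v. ennreal (r (y - h v)) * indicator A v \<partial>P) / ennreal (normaliser y)"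
proof -
  have "emeasure (posterior y) A = (\<integral>\<^sup>+v. ennreal (r (y - h v) / normaliser y) * indicator A v \<partial>P)"
    unfolding posterior_def by (rule emeasure_density) auto
  also have "\<dots> = (\<integral>\<^sup>+v. (ennreal (r (y - h v)) * indicator A v) / ennreal (normaliser y) \<partial>P)"
    using r_pos normaliser_pos[of y]
    by (intro nn_integral_cong) (auto simp: divide_ennreal less_imp_le indicator_def)
  also have "\<dots> = (\<integral>\<^sup>+v. ennreal (r (y - h v)) * indicator A v \<partial>P) / ennreal (normaliser y)"
    by (rule nn_integral_divide) measurable
  finally show ?thesis .
qed

lemma prob_space_posterior: "prob_space (posterior y)"
proof
  have "emeasure (posterior y) (space P) = (\<integral>\<^sup>+v. ennreal (r (y - h v)) * indicator (space P) v \<partial>P) / ennreal (normaliser y)"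
    by (rule emeasure_posterior) simp
  also have "(\<integral>\<^sup>+v. ennreal (r (y - h v)) * indicator (space P) v \<partial>P) = ennreal (normaliser y)"
    unfolding nn_integral_likelihood[symmetric] by (intro nn_integral_cong) simp
  also have "ennreal (normaliser y) / ennreal (normaliser y) = 1"
    using normaliser_pos[of y] by (simp add: divide_ennreal less_imp_le)
  finally show "emeasure (posterior y) (space (posterior y)) = 1"
    by (simp add: posterior_def)
qed

lemma measurable_emeasure_posterior:
  assumes [measurable]: "A \<in> sets P"
  shows "(\<lambda>y. emeasure (posterior y) A) \<in> borel_measurable borel"
  unfolding emeasure_posterior[OF assms] by measurable

lemma posterior_kernel:
  assumes "sets S = sets P"
  shows "posterior \<in> borel \<rightarrow>\<^sub>M prob_algebra S"
proof (rule measurable_prob_algebraI)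
  show "prob_space (posterior y)" for y by (rule prob_space_posterior)
  show "posterior \<in> borel \<rightarrow>\<^sub>M subprob_algebra S"
    using assms measurable_emeasure_posterior
    by (intro measurable_subprob_algebra prob_space_imp_subprob_space prob_space_posterior) auto
qed

lemma RN_deriv_posterior:
  "AE v in P. RN_deriv P (posterior y) v = ennreal (r (y - h v) / normaliser y)"
  using prior.RN_deriv_unique[of "\<lambda>v. ennreal (r (y - h v) / normaliser y)" "posterior y"]
  by (auto simp: posterior_def elim!: eventually_mono)

lemma absolutely_continuous_posterior: "absolutely_continuous P (posterior y)"
  unfolding posterior_def by (rule absolutely_continuousI_density) measurable

text \<open>Bayes' theorem.  Translating the noise turns the joint law of \<open>u\<close> and \<open>Y = h(u) + \<eta>\<close> into the measure with
  density proportional to \<open>r (y - h v)\<close> with respect to the product of \<open>P\<close> and Lebesgue measure.  Integrating out \<open>v\<close>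
  gives the law of \<open>Y\<close>; disintegrating the joint law along \<open>Y\<close> gives the posterior.\<close>

lemma posterior_is_conditional_distribution:
  fixes M :: "'w measure"
  assumes M: "prob_space M" and S: "sets S = sets P"
    and u: "u \<in> M \<rightarrow>\<^sub>M S" "distr M S u = P"
    and \<eta>: "\<eta> \<in> borel_measurable M" "distr M borel \<eta> = density lborel (\<lambda>e. ennreal (r e / s))"
    and ind: "independent M S u borel \<eta>"
  shows "regular_conditional_distribution M S u borel (\<lambda>\<omega>. h (u \<omega>) + \<eta> \<omega>) posterior"
proof -
  interpret M: prob_space M by fact
  define Y where "Y \<omega> = h (u \<omega>) + \<eta> \<omega>" for \<omega>
  define c where "c = ennreal (1 / s)"
  have [measurable]: "u \<in> M \<rightarrow>\<^sub>M S" "\<eta> \<in> borel_measurable M" by fact+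
  have [measurable]: "h \<in> borel_measurable S"
    using h S measurable_cong_sets by blast
  have [measurable]: "Y \<in> borel_measurable M" unfolding Y_def by measurable
  have dens: "ennreal (r e / s) = c * ennreal (r e)" for e
    using r_pos[of e] by (simp add: c_def ennreal_mult'[symmetric] mult.commute less_imp_le flip: ennreal_mult'')
  interpret N: sigma_finite_measure "density lborel (\<lambda>e. ennreal (r e / s)) :: 'e measure"
    unfolding \<eta>(2)[symmetric] by (intro prob_space_imp_sigma_finite M.prob_space_distr) measurable
  interpret PL: pair_sigma_finite P "lborel :: 'e measure" ..
  \<comment> \<open>The joint law of \<open>u\<close> and \<open>Y\<close> on rectangles, by the substitution \<open>y = h v + e\<close>.\<close>
  have joint: "emeasure M ((u -` A \<inter> space M) \<inter> (Y -` B \<inter> space M)) =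
      (\<integral>\<^sup>+y. c * (\<integral>\<^sup>+v. ennreal (r (y - h v)) * indicator A v \<partial>P) * indicator B y \<partial>lborel)"
    if [measurable]: "A \<in> sets P" "B \<in> sets borel" for A B
  proof -
    have [measurable]: "A \<in> sets S" using S that by simp
    let ?N = "density lborel (\<lambda>e. ennreal (r e / s)) :: 'e measure"
    let ?E = "{z \<in> space (P \<Otimes>\<^sub>M ?N). fst z \<in> A \<and> h (fst z) + snd z \<in> B}"
    have E: "?E \<in> sets (P \<Otimes>\<^sub>M ?N)" by measurable
    have "sets (S \<Otimes>\<^sub>M borel) = sets (P \<Otimes>\<^sub>M ?N)"
      by (rule sets_pair_measure_cong) (simp_all add: S)
    then have E': "?E \<in> sets (S \<Otimes>\<^sub>M borel)" using E by simp
    have "(u -` A \<inter> space M) \<inter> (Y -` B \<inter> space M) = (\<lambda>\<omega>. (u \<omega>, \<eta> \<omega>)) -` ?E \<inter> space M"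
      using measurable_space[OF u(1)] sets_eq_imp_space_eq[OF S] by (auto simp: Y_def space_pair_measure)
    then have "emeasure M ((u -` A \<inter> space M) \<inter> (Y -` B \<inter> space M)) =
        emeasure (distr M (S \<Otimes>\<^sub>M borel) (\<lambda>\<omega>. (u \<omega>, \<eta> \<omega>))) ?E"
      using E' by (subst emeasure_distr) auto
    also have "distr M (S \<Otimes>\<^sub>M borel) (\<lambda>\<omega>. (u \<omega>, \<eta> \<omega>)) = P \<Otimes>\<^sub>M ?N"
      using independent_joint_distribution[OF M ind] u(2) \<eta>(2) by simp
    also have "emeasure (P \<Otimes>\<^sub>M ?N) ?E = (\<integral>\<^sup>+v. \<integral>\<^sup>+e. indicator ?E (v, e) \<partial>?N \<partial>P)"
      by (rule N.emeasure_pair_measure[OF E])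
    also have "\<dots> = (\<integral>\<^sup>+v. \<integral>\<^sup>+e. indicator A v * indicator B (h v + e) \<partial>?N \<partial>P)"
      by (intro nn_integral_cong) (auto simp: indicator_def space_pair_measure)
    also have "\<dots> = (\<integral>\<^sup>+v. \<integral>\<^sup>+y. c * (ennreal (r (y - h v)) * indicator A v) * indicator B y \<partial>lborel \<partial>P)"
    proof (rule nn_integral_cong)
      fix v assume "v \<in> space P"
      have "(\<integral>\<^sup>+e. indicator A v * indicator B (h v + e) \<partial>density lborel (\<lambda>e. ennreal (r e / s))) =
          (\<integral>\<^sup>+e. c * (ennreal (r ((h v + e) - h v)) * indicator A v) * indicator B (h v + e) \<partial>lborel)"
        by (subst nn_integral_density) (auto simp: dens mult_ac)
      also have "\<dots> = (\<integral>\<^sup>+y. c * (ennreal (r (y - h v)) * indicator A v) * indicator B y \<partial>lborel)"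
        by (rule nn_integral_lborel_translate[of "\<lambda>y. c * (ennreal (r (y - h v)) * indicator A v) * indicator B y"]) measurable
      finally show "(\<integral>\<^sup>+e. indicator A v * indicator B (h v + e) \<partial>density lborel (\<lambda>e. ennreal (r e / s))) =
          (\<integral>\<^sup>+y. c * (ennreal (r (y - h v)) * indicator A v) * indicator B y \<partial>lborel)" .
    qed
    also have "\<dots> = (\<integral>\<^sup>+y. \<integral>\<^sup>+v. c * (ennreal (r (y - h v)) * indicator A v) * indicator B y \<partial>P \<partial>lborel)"
      by (rule PL.Fubini'[symmetric]) measurable
    also have "\<dots> = (\<integral>\<^sup>+y. c * (\<integral>\<^sup>+v. ennreal (r (y - h v)) * indicator A v \<partial>P) * indicator B y \<partial>lborel)"
      by (intro nn_integral_cong) (simp add: nn_integral_multc nn_integral_cmult)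
    finally show ?thesis .
  qed
  have distr_Y: "distr M borel Y = density lborel (\<lambda>y. c * ennreal (normaliser y))"
  proof (rule measure_eqI)
    fix B assume "B \<in> sets (distr M borel Y)"
    then have [measurable]: "B \<in> sets borel" by simp
    have "u -` space P \<inter> space M = space M"
      using measurable_space[OF u(1)] sets_eq_imp_space_eq[OF S] by auto
    then have "emeasure (distr M borel Y) B = emeasure M ((u -` space P \<inter> space M) \<inter> (Y -` B \<inter> space M))"
      by (subst emeasure_distr) (auto intro!: arg_cong[where f="emeasure M"])
    also have "\<dots> = (\<integral>\<^sup>+y. c * (\<integral>\<^sup>+v. ennreal (r (y - h v)) * indicator (space P) v \<partial>P) * indicator B y \<partial>lborel)"
      by (rule joint) auto
    also have "\<dots> = (\<integral>\<^sup>+y. c * ennreal (normaliser y) * indicator B y \<partial>lborel)"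
      unfolding nn_integral_likelihood[symmetric]
      by (intro nn_integral_cong arg_cong2[where f="(*)"] refl) auto
    also have "\<dots> = emeasure (density lborel (\<lambda>y. c * ennreal (normaliser y))) B"
      by (subst emeasure_density) auto
    finally show "emeasure (distr M borel Y) B = emeasure (density lborel (\<lambda>y. c * ennreal (normaliser y))) B" .
  qed simp
  \<comment> \<open>The normaliser in the posterior cancels against the density of \<open>Y\<close>.\<close>
  have disintegration: "(\<integral>\<^sup>+\<omega>. emeasure (posterior (Y \<omega>)) A * indicator (Y -` B \<inter> space M) \<omega> \<partial>M) =
      emeasure M ((u -` A \<inter> space M) \<inter> (Y -` B \<inter> space M))"
    if A[measurable]: "A \<in> sets P" and [measurable]: "B \<in> sets borel" for A B
  proof -
    note [measurable] = measurable_emeasure_posterior[OF A]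
    have "(\<integral>\<^sup>+\<omega>. emeasure (posterior (Y \<omega>)) A * indicator (Y -` B \<inter> space M) \<omega> \<partial>M) =
        (\<integral>\<^sup>+\<omega>. emeasure (posterior (Y \<omega>)) A * indicator B (Y \<omega>) \<partial>M)"
      by (intro nn_integral_cong) (auto simp: indicator_def)
    also have "\<dots> = (\<integral>\<^sup>+y. emeasure (posterior y) A * indicator B y \<partial>distr M borel Y)"
      by (subst nn_integral_distr) auto
    also have "\<dots> = (\<integral>\<^sup>+y. c * ennreal (normaliser y) * (emeasure (posterior y) A * indicator B y) \<partial>lborel)"
      unfolding distr_Y by (subst nn_integral_density) auto
    also have "\<dots> = (\<integral>\<^sup>+y. c * (\<integral>\<^sup>+v. ennreal (r (y - h v)) * indicator A v \<partial>P) * indicator B y \<partial>lborel)"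
    proof (rule nn_integral_cong)
      fix y
      have "ennreal (normaliser y) * emeasure (posterior y) A = (\<integral>\<^sup>+v. ennreal (r (y - h v)) * indicator A v \<partial>P)"
      proof -
        have "ennreal (normaliser y) * inverse (ennreal (normaliser y)) = 1"
          using normaliser_pos[of y] by (simp add: inverse_ennreal less_imp_le flip: ennreal_mult)
        then show ?thesis
          unfolding emeasure_posterior[OF A] divide_ennreal_def
          by (simp only: mult.left_commute[of "ennreal (normaliser y)"] mult_1_right)
      qed
      then show "c * ennreal (normaliser y) * (emeasure (posterior y) A * indicator B y) =
          c * (\<integral>\<^sup>+v. ennreal (r (y - h v)) * indicator A v \<partial>P) * indicator B y"
        by (simp only: mult.assoc flip: mult.assoc[of "ennreal (normaliser y)"])
    qed
    also have "\<dots> = emeasure M ((u -` A \<inter> space M) \<inter> (Y -` B \<inter> space M))"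
      by (rule joint[symmetric]) fact+
    finally show ?thesis .
  qed
  define F where "F = vimage_algebra (space M) Y borel"
  have sets_F: "sets F = {Y -` B \<inter> space M | B. B \<in> sets borel}"
    unfolding F_def by (rule sets_vimage_algebra2) auto
  have sub: "subalgebra M F"
    unfolding subalgebra_def sets_F by (auto simp: F_def)
  interpret F: finite_measure_subalgebra M F
    by (standard, rule sub)
  have Y_F: "Y \<in> F \<rightarrow>\<^sub>M borel"
    unfolding F_def by (rule measurable_vimage_algebra1) auto
  have "AE \<omega> in M. measure (posterior (Y \<omega>)) A =
      real_cond_exp M F (indicator (u -` A \<inter> space M)) \<omega>" if "A \<in> sets S" for A
  proof -
    have A[measurable]: "A \<in> sets P" "A \<in> sets S" using that S by auto
    note [measurable] = measurable_emeasure_posterior[OF A(1)]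
    have meas[measurable]: "(\<lambda>y. measure (posterior y) A) \<in> borel_measurable borel"
      unfolding measure_def by measurable
    have le1: "measure (posterior y) A \<le> 1" for y
      by (rule prob_space.prob_le_1[OF prob_space_posterior])
    have em: "ennreal (measure (posterior y) A) = emeasure (posterior y) A" for y
    proof -
      interpret prob_space "posterior y" by (rule prob_space_posterior)
      show ?thesis by (simp add: emeasure_eq_measure)
    qed
    have int: "integrable M (\<lambda>\<omega>. measure (posterior (Y \<omega>)) A)"
      using le1 by (intro M.integrable_const_bound[of _ 1]) auto
    have "AE \<omega> in M. real_cond_exp M F (indicator (u -` A \<inter> space M)) \<omega> = measure (posterior (Y \<omega>)) A"
    proof (rule F.real_cond_exp_charact)
      fix C assume "C \<in> sets F"
      then obtain B where B: "C = Y -` B \<inter> space M" and [measurable]: "B \<in> sets borel"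
        unfolding sets_F by auto
      have C[measurable]: "C \<in> sets M" unfolding B by measurable
      have "(LINT \<omega>:C|M. measure (posterior (Y \<omega>)) A) =
          enn2real (\<integral>\<^sup>+\<omega>. ennreal (indicator C \<omega> * measure (posterior (Y \<omega>)) A) \<partial>M)"
        unfolding set_lebesgue_integral_def by (subst integral_eq_nn_integral) auto
      also have "(\<integral>\<^sup>+\<omega>. ennreal (indicator C \<omega> * measure (posterior (Y \<omega>)) A) \<partial>M) =
          (\<integral>\<^sup>+\<omega>. emeasure (posterior (Y \<omega>)) A * indicator (Y -` B \<inter> space M) \<omega> \<partial>M)"
        unfolding B by (intro nn_integral_cong) (auto simp: indicator_def em)
      also have "\<dots> = emeasure M ((u -` A \<inter> space M) \<inter> C)"
        unfolding B by (rule disintegration) fact+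
      also have "enn2real \<dots> = (LINT \<omega>:C|M. indicator (u -` A \<inter> space M) \<omega>)"
        unfolding set_lebesgue_integral_def
        by (simp add: indicator_inter_arith[symmetric] measure_def Int_commute)
      finally show "(LINT \<omega>:C|M. indicator (u -` A \<inter> space M) \<omega>) = (LINT \<omega>:C|M. measure (posterior (Y \<omega>)) A)"
        by simp
    next
      show "integrable M (indicator (u -` A \<inter> space M) :: _ \<Rightarrow> real)"
        by (intro integrable_real_indicator) (auto simp: M.emeasure_eq_measure)
      show "(\<lambda>\<omega>. measure (posterior (Y \<omega>)) A) \<in> borel_measurable F"
        using Y_F by measurable
    qed (rule int)
    then show ?thesis by (auto elim!: eventually_mono)
  qed
  then show ?thesis
    unfolding regular_conditional_distribution_def F_def Y_def[symmetric]
    using posterior_kernel[OF S] u(1) by auto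
qed

end

section \<open>The posterior of the layer model\<close>

lemma borel_measurable_weighted_norm [measurable]: "weighted_norm \<Gamma> \<in> borel_measurable borel"
  unfolding weighted_norm_def
  by (intro borel_measurable_continuous_onI continuous_intros matrix_vector_mult_linear_continuous_on)

theorem theorem3p2:
  fixes n :: nat and cstar :: real
    and f :: "(real \<times> real \<Rightarrow> real) \<Rightarrow> real"
    and l :: "'j::finite \<Rightarrow> (real \<times> real \<Rightarrow> real) \<Rightarrow> real"
    and \<Gamma> :: "real^'j^'j"
    and \<pi> :: "nat \<Rightarrow> real \<Rightarrow> real"
  assumes "n \<ge> 2" and "cstar > 0"
    and "f \<in> V_dual" and "\<And>j. l j \<in> V_dual"
    and "sym_pos_def \<Gamma>"
    and "\<And>i. i \<in> {1..n} \<Longrightarrow> permeability_density (\<pi> i)"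
  shows "prob_space (prior n cstar \<pi>) \<and>
    (\<forall>y. evidence n cstar \<pi> f l \<Gamma> y > 0) \<and>
    (\<forall>(M :: 'w measure) u \<eta>.
       prob_space M \<and>
       u \<in> M \<rightarrow>\<^sub>M param_space n cstar \<and> distr M (param_space n cstar) u = prior n cstar \<pi> \<and>
       \<eta> \<in> M \<rightarrow>\<^sub>M borel \<and> distr M borel \<eta> = gaussian \<Gamma> \<and>
       independent M (param_space n cstar) u borel \<eta> \<longrightarrow>
       (\<exists>\<mu>. regular_conditional_distribution M (param_space n cstar) u
              borel (\<lambda>\<omega>. observation_map n f l (u \<omega>) + \<eta> \<omega>) \<mu> \<and>
            (\<forall>y. absolutely_continuous (prior n cstar \<pi>) (\<mu> y) \<and>
              (AE v in prior n cstar \<pi>. RN_deriv (prior n cstar \<pi>) (\<mu> y) v =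
                 ennreal (exp (- potential n f l \<Gamma> v y) / evidence n cstar \<pi> f l \<Gamma> y)))))"
proof (intro conjI allI impI)
  have n: "n \<ge> 1" using assms(1) by simp
  let ?P = "prior n cstar \<pi>" and ?S = "param_space n cstar"
  let ?r = "\<lambda>e. exp (- (weighted_norm \<Gamma> e)\<^sup>2 / 2)"
  show prob: "prob_space ?P"
    by (rule prob_space_prior[OF assms(2,6)])
  have sets_P: "sets ?S = sets ?P" by (simp add: prior_def)
  have "observation_map n f l \<in> borel_measurable ?S"
    by (rule borel_measurable_observation_map[OF n assms(3,4)])
  then have "observation_map n f l \<in> borel_measurable ?P"
    by (simp only: measurable_cong_sets[OF sets_P refl])
  then interpret L: additive_noise_likelihood ?P "observation_map n f l" ?r
    by (intro additive_noise_likelihood.intro prob) auto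
  have likelihood: "?r (y - observation_map n f l v) = exp (- potential n f l \<Gamma> v y)" for v y
    by (simp add: potential_def)
  have evidence: "L.normaliser y = evidence n cstar \<pi> f l \<Gamma> y" for y
    unfolding L.normaliser_def evidence_def likelihood ..
  show "evidence n cstar \<pi> f l \<Gamma> y > 0" for y
    using L.normaliser_pos[of y] by (simp only: evidence)
  fix M :: "'w measure" and u \<eta>
  assume M: "prob_space M \<and>
       u \<in> M \<rightarrow>\<^sub>M ?S \<and> distr M ?S u = ?P \<and>
       \<eta> \<in> M \<rightarrow>\<^sub>M borel \<and> distr M borel \<eta> = gaussian \<Gamma> \<and> independent M ?S u borel \<eta>"
  show "\<exists>\<mu>. regular_conditional_distribution M ?S u
              borel (\<lambda>\<omega>. observation_map n f l (u \<omega>) + \<eta> \<omega>) \<mu> \<and>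
            (\<forall>y. absolutely_continuous ?P (\<mu> y) \<and>
              (AE v in ?P. RN_deriv ?P (\<mu> y) v =
                 ennreal (exp (- potential n f l \<Gamma> v y) / evidence n cstar \<pi> f l \<Gamma> y)))"
  proof (intro exI conjI allI)
    show "regular_conditional_distribution M ?S u borel
        (\<lambda>\<omega>. observation_map n f l (u \<omega>) + \<eta> \<omega>) L.posterior"
      by (rule L.posterior_is_conditional_distribution[OF _ sets_P])
        (use M in \<open>auto simp: gaussian_def\<close>)
    show "absolutely_continuous ?P (L.posterior y)" for y
      by (rule L.absolutely_continuous_posterior)
    show "AE v in ?P. RN_deriv ?P (L.posterior y) v =
        ennreal (exp (- potential n f l \<Gamma> v y) / evidence n cstar \<pi> f l \<Gamma> y)" for y
      using L.RN_deriv_posterior[of y] unfolding evidence likelihood .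
  qed
qed

end
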